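(* Let $\{X_\alpha:\alpha\in A\}$ be an uncountable family of separable Banach spaces. (1) The $c_0$-sum $\bigoplus_{c_0}\{X_\alpha:\alpha\in A\}$ belongs to the class $\mathcal E_0$, and if $1<p<\infty$ then the $\ell_p$-sum $\bigoplus_{\ell_p}\{X_\alpha:\alpha\in A\}$ also belongs to $\mathcal E_0$. (2) All the weak$^\ast$ convergent sequences of the dual ball of the $\ell_1$-sum $\bigoplus_{\ell_1}\{X_\alpha:\alpha\in A\}$ are fiber convergent (the dual ball being considered with its weak$^\ast$ topology).
   Context: Compact spaces are Hausdorff. For a compact space $K$, $\mathcal Q(K)$ is the set of all Hausdorff quotient spaces $L=K/E$ ($E$ an equivalence relation on $K$, quotient topology), each with its canonical projection $p_L:K\to L$. It is ordered by: $L\le L'$ iff there is a continuous surjection $q:L'\to L$ (the natural projection) with $q\,p_{L'}=p_L$; equivalently, the equivalence relation of $L'$ is contained in that of $L$. Suprema in $\mathcal Q(K)$ correspond to intersections of equivalence relations. $\mathcal Q_\omega(K)\subset\mathcal Q(K)$ is the set of quotients of countable weight. A family $\mathcal S\subset\mathcal Q_\omega(K)$ is cofinal if for every $L\in\mathcal Q_\omega(K)$ there is $L'\in\mathcal S$ with $L\le L'$; it is a $\sigma$-semilattice if the supremum of every countable subset of $\mathcal S$ belongs to $\mathcal S$. Given a continuous surjection $\pi:M\to N$, a sequence $(x_n)$ in $N$ converging to $x\in N$ is called $\pi$-fiber convergent if for every $y\in\pi^{-1}(x)$ there are $y_n\in\pi^{-1}(x_n)$ with $y_n\to y$. If $K$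 is a compact space of uncountable weight and $(x_n)$ is a sequence in $K$ converging to $x\in K$, then $(x_n)$ is called fiber convergent if there is a cofinal $\sigma$-semilattice $\mathcal S\subset\mathcal Q_\omega(K)$ such that for all $L'\le L$ in $\mathcal S$, with natural projection $\pi:L\to L'$, the sequence $(p_{L'}(x_n))_n$ (which converges to $p_{L'}(x)$) is $\pi$-fiber convergent. A nonseparable Banach space $X$ belongs to the class $\mathcal E_0$ if the fiber convergent sequences of $(B_{X^\ast},w^\ast)$ are exactly those sequences $(x_n^\ast)$ in $B_{X^\ast}$ that are weak$^\ast$ convergent to a point $x^\ast\in B_{X^\ast}$ with $\|x_n^\ast\|\to\|x^\ast\|$. Here $B_{X^\ast}$ is the closed unit ball of the dual $X^\ast$ (the dual ball of $X$). *)

theory Defs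
  imports "HOL-Analysis.Analysis" "HOL-Library.Function_Algebras"
begin

section \<open>Banach spaces carried by linear subspaces\<close>

instantiation "fun" :: (type, real_vector) real_vector
begin

definition scaleR_fun :: "real \<Rightarrow> ('a \<Rightarrow> 'b) \<Rightarrow> 'a \<Rightarrow> 'b"
  where "scaleR_fun c f = (\<lambda>x. c *\<^sub>R f x)"

instance
  by standard (simp_all add: scaleR_fun_def plus_fun_def fun_eq_iff
      scaleR_add_right scaleR_add_left)

end

text \<open>
  A normed space is a pair of a linear subspace \<open>V\<close> of some real vector space and a function \<open>N\<close>
  whose restriction to \<open>V\<close> is a norm. The values of \<open>N\<close> outside \<open>V\<close> are irrelevant. Every family
  of real normed spaces can be presented in this way inside one ambient vector space, for instance
  inside the product of its members.
\<close>

definition normed_space_on :: "'v::real_vector set \<Rightarrow> ('v \<Rightarrow> real) \<Rightarrow> bool" where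
  "normed_space_on V N \<longleftrightarrow>
     subspace V \<and>
     (\<forall>x\<in>V. 0 \<le> N x) \<and>
     (\<forall>x\<in>V. N x = 0 \<longleftrightarrow> x = 0) \<and>
     (\<forall>x\<in>V. \<forall>c. N (c *\<^sub>R x) = \<bar>c\<bar> * N x) \<and>
     (\<forall>x\<in>V. \<forall>y\<in>V. N (x + y) \<le> N x + N y)"

text \<open>The case distinction is needed because \<^locale>\<open>Metric_space\<close> demands a distance function that is
  nonnegative and symmetric on the whole type.\<close>

definition norm_dist :: "'v::real_vector set \<Rightarrow> ('v \<Rightarrow> real) \<Rightarrow> 'v \<Rightarrow> 'v \<Rightarrow> real" where
  "norm_dist V N x y = (if x \<in> V \<and> y \<in> V then N (x - y) else 0)"

lemma Metric_space_norm_dist: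
  assumes "normed_space_on V N"
  shows "Metric_space V (norm_dist V N)"
proof
  have V: "subspace V" and nonneg: "\<And>x. x \<in> V \<Longrightarrow> 0 \<le> N x"
    and zero: "\<And>x. x \<in> V \<Longrightarrow> N x = 0 \<longleftrightarrow> x = 0"
    and scale: "\<And>c x. x \<in> V \<Longrightarrow> N (c *\<^sub>R x) = \<bar>c\<bar> * N x"
    and tri: "\<And>x y. x \<in> V \<Longrightarrow> y \<in> V \<Longrightarrow> N (x + y) \<le> N x + N y"
    using assms by (auto simp: normed_space_on_def)
  note diff = subspace_diff[OF V]
  show "0 \<le> norm_dist V N x y" for x y
    by (simp add: norm_dist_def nonneg diff)
  show "norm_dist V N x y = norm_dist V N y x" for x y
    using scale[OF diff, of x y "-1"] by (auto simp: norm_dist_def)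
  show "norm_dist V N x y = 0 \<longleftrightarrow> x = y" if "x \<in> V" "y \<in> V" for x y
    using that by (simp add: norm_dist_def zero diff)
  show "norm_dist V N x z \<le> norm_dist V N x y + norm_dist V N y z"
    if "x \<in> V" "y \<in> V" "z \<in> V" for x y z
    using that tri[OF diff diff, of x y y z] by (simp add: norm_dist_def)
qed

definition norm_topology :: "'v::real_vector set \<Rightarrow> ('v \<Rightarrow> real) \<Rightarrow> 'v topology" where
  "norm_topology V N = Metric_space.mtopology V (norm_dist V N)"

definition banach_space_on :: "'v::real_vector set \<Rightarrow> ('v \<Rightarrow> real) \<Rightarrow> bool" where
  "banach_space_on V N \<longleftrightarrow>
     normed_space_on V N \<and> Metric_space.mcomplete V (norm_dist V N)"

definition separable_on :: "'v::real_vector set \<Rightarrow> ('v \<Rightarrow> real) \<Rightarrow> bool" where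
  "separable_on V N \<longleftrightarrow> separable_space (norm_topology V N)"

section \<open>The dual ball with its weak-star topology\<close>

text \<open>Functionals on \<open>V\<close> are represented by functions that are \<^const>\<open>undefined\<close> outside \<open>V\<close>, so
  that each functional has exactly one representative.\<close>

definition dual_space :: "'v::real_vector set \<Rightarrow> ('v \<Rightarrow> real) \<Rightarrow> ('v \<Rightarrow> real) set" where
  "dual_space V N = {\<phi> \<in> extensional V.
     (\<forall>x\<in>V. \<forall>y\<in>V. \<phi> (x + y) = \<phi> x + \<phi> y) \<and>
     (\<forall>x\<in>V. \<forall>c. \<phi> (c *\<^sub>R x) = c * \<phi> x) \<and>
     (\<exists>C. \<forall>x\<in>V. \<bar>\<phi> x\<bar> \<le> C * N x)}"

definition dual_norm :: "'v::real_vector set \<Rightarrow> ('v \<Rightarrow> real) \<Rightarrow> ('v \<Rightarrow> real) \<Rightarrow> real" where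
  "dual_norm V N \<phi> = (SUP x\<in>{x \<in> V. N x \<le> 1}. \<bar>\<phi> x\<bar>)"

definition dual_ball :: "'v::real_vector set \<Rightarrow> ('v \<Rightarrow> real) \<Rightarrow> ('v \<Rightarrow> real) set" where
  "dual_ball V N = {\<phi> \<in> dual_space V N. dual_norm V N \<phi> \<le> 1}"

text \<open>The weak-star topology is the topology of pointwise convergence on \<open>V\<close>.\<close>

definition weak_star_ball :: "'v::real_vector set \<Rightarrow> ('v \<Rightarrow> real) \<Rightarrow> ('v \<Rightarrow> real) topology" where
  "weak_star_ball V N = subtopology (product_topology (\<lambda>_. euclideanreal) V) (dual_ball V N)"

section \<open>Hausdorff quotients of a compact space\<close>

text \<open>A quotient of \<open>K\<close> is represented by its equivalence relation; its points are the
  equivalence classes.\<close>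

definition quotient_proj :: "('a \<times> 'a) set \<Rightarrow> 'a \<Rightarrow> 'a set" where
  "quotient_proj E x = E `` {x}"

definition quotient_topology :: "'a topology \<Rightarrow> ('a \<times> 'a) set \<Rightarrow> 'a set topology" where
  "quotient_topology K E = topology (\<lambda>U. U \<subseteq> topspace K // E \<and>
     openin K {x \<in> topspace K. quotient_proj E x \<in> U})"

lemma openin_quotient_topology:
  "openin (quotient_topology K E) U \<longleftrightarrow>
     U \<subseteq> topspace K // E \<and> openin K {x \<in> topspace K. quotient_proj E x \<in> U}"
proof -
  have "istopology (\<lambda>U. U \<subseteq> topspace K // E \<and> openin K {x \<in> topspace K. quotient_proj E x \<in> U})"
    unfolding istopology_def
  proof (intro conjI allI impI)
    fix S T
    assume S: "S \<subseteq> topspace K // E \<and> openin K {x \<in> topspace K. quotient_proj E x \<in> S}"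
      and T: "T \<subseteq> topspace K // E \<and> openin K {x \<in> topspace K. quotient_proj E x \<in> T}"
    show "S \<inter> T \<subseteq> topspace K // E" using S by blast
    have "{x \<in> topspace K. quotient_proj E x \<in> S \<inter> T} =
        {x \<in> topspace K. quotient_proj E x \<in> S} \<inter> {x \<in> topspace K. quotient_proj E x \<in> T}"
      by blast
    then show "openin K {x \<in> topspace K. quotient_proj E x \<in> S \<inter> T}"
      using S T by (simp add: openin_Int)
  next
    fix \<U>
    assume U: "\<forall>S\<in>\<U>. S \<subseteq> topspace K // E \<and> openin K {x \<in> topspace K. quotient_proj E x \<in> S}"
    then show "\<Union>\<U> \<subseteq> topspace K // E" by blast
    have "{x \<in> topspace K. quotient_proj E x \<in> \<Union>\<U>} =
        (\<Union>S\<in>\<U>. {x \<in> topspace K. quotient_proj E x \<in> S})"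
      by blast
    then show "openin K {x \<in> topspace K. quotient_proj E x \<in> \<Union>\<U>}"
      using U by auto
  qed
  then show ?thesis by (simp add: quotient_topology_def)
qed

lemma topspace_quotient_topology: "topspace (quotient_topology K E) = topspace K // E"
proof
  show "topspace (quotient_topology K E) \<subseteq> topspace K // E"
    using openin_quotient_topology[of K E "topspace (quotient_topology K E)"] by simp
  have "{x \<in> topspace K. quotient_proj E x \<in> topspace K // E} = topspace K"
    by (auto simp: quotient_proj_def quotientI)
  then have "openin (quotient_topology K E) (topspace K // E)"
    by (simp add: openin_quotient_topology)
  then show "topspace K // E \<subseteq> topspace (quotient_topology K E)"
    by (rule openin_subset)
qed

lemma quotient_map_quotient_proj: "quotient_map K (quotient_topology K E) (quotient_proj E)"
  unfolding quotient_map_def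
  by (auto simp: topspace_quotient_topology openin_quotient_topology quotient_proj_def
      quotient_def)

definition hausdorff_quotients :: "'a topology \<Rightarrow> ('a \<times> 'a) set set" where
  "hausdorff_quotients K =
     {E. equiv (topspace K) E \<and> Hausdorff_space (quotient_topology K E)}"

definition countable_weight_quotients :: "'a topology \<Rightarrow> ('a \<times> 'a) set set" where
  "countable_weight_quotients K =
     {E \<in> hausdorff_quotients K. second_countable (quotient_topology K E)}"

definition natural_projection ::
    "'a topology \<Rightarrow> ('a \<times> 'a) set \<Rightarrow> ('a \<times> 'a) set \<Rightarrow> ('a set \<Rightarrow> 'a set) \<Rightarrow> bool" where
  "natural_projection K L L' q \<longleftrightarrow>
     continuous_map (quotient_topology K L) (quotient_topology K L') q \<and>
     q ` topspace (quotient_topology K L) = topspace (quotient_topology K L') \<and>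
     (\<forall>x\<in>topspace K. q (quotient_proj L x) = quotient_proj L' x)"

definition quotient_le :: "'a topology \<Rightarrow> ('a \<times> 'a) set \<Rightarrow> ('a \<times> 'a) set \<Rightarrow> bool" where
  "quotient_le K L L' \<longleftrightarrow> (\<exists>q. natural_projection K L' L q)"

definition is_quotient_sup :: "'a topology \<Rightarrow> ('a \<times> 'a) set set \<Rightarrow> ('a \<times> 'a) set \<Rightarrow> bool" where
  "is_quotient_sup K \<C> L \<longleftrightarrow>
     L \<in> hausdorff_quotients K \<and>
     (\<forall>M\<in>\<C>. quotient_le K M L) \<and>
     (\<forall>L'\<in>hausdorff_quotients K. (\<forall>M\<in>\<C>. quotient_le K M L') \<longrightarrow> quotient_le K L L')"

definition cofinal_quotients :: "'a topology \<Rightarrow> ('a \<times> 'a) set set \<Rightarrow> bool" where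
  "cofinal_quotients K \<S> \<longleftrightarrow>
     (\<forall>L\<in>countable_weight_quotients K. \<exists>L'\<in>\<S>. quotient_le K L L')"

definition sigma_semilattice :: "'a topology \<Rightarrow> ('a \<times> 'a) set set \<Rightarrow> bool" where
  "sigma_semilattice K \<S> \<longleftrightarrow>
     (\<forall>\<C>. \<C> \<subseteq> \<S> \<and> countable \<C> \<longrightarrow> (\<exists>L\<in>\<S>. is_quotient_sup K \<C> L))"

section \<open>Fiber convergence\<close>

definition map_fiber_convergent ::
    "'a topology \<Rightarrow> 'b topology \<Rightarrow> ('a \<Rightarrow> 'b) \<Rightarrow> (nat \<Rightarrow> 'b) \<Rightarrow> 'b \<Rightarrow> bool" where
  "map_fiber_convergent M N \<pi> x l \<longleftrightarrow>
     (\<forall>n. x n \<in> topspace N) \<and> limitin N x l sequentially \<and>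
     (\<forall>y\<in>topspace M. \<pi> y = l \<longrightarrow>
        (\<exists>z. (\<forall>n. z n \<in> topspace M \<and> \<pi> (z n) = x n) \<and> limitin M z y sequentially))"

definition fiber_convergent :: "'a topology \<Rightarrow> (nat \<Rightarrow> 'a) \<Rightarrow> 'a \<Rightarrow> bool" where
  "fiber_convergent K x l \<longleftrightarrow>
     compact_space K \<and> Hausdorff_space K \<and> \<not> second_countable K \<and>
     (\<forall>n. x n \<in> topspace K) \<and> limitin K x l sequentially \<and>
     (\<exists>\<S> \<subseteq> countable_weight_quotients K. cofinal_quotients K \<S> \<and> sigma_semilattice K \<S> \<and>
        (\<forall>L\<in>\<S>. \<forall>L'\<in>\<S>. \<forall>\<pi>. natural_projection K L L' \<pi> \<longrightarrow>
           map_fiber_convergent (quotient_topology K L) (quotient_topology K L') \<pi>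
             (\<lambda>n. quotient_proj L' (x n)) (quotient_proj L' l)))"

definition class_E0 :: "'v::real_vector set \<Rightarrow> ('v \<Rightarrow> real) \<Rightarrow> bool" where
  "class_E0 V N \<longleftrightarrow>
     banach_space_on V N \<and> \<not> separable_on V N \<and>
     (\<forall>x l. fiber_convergent (weak_star_ball V N) x l \<longleftrightarrow>
        (\<forall>n. x n \<in> dual_ball V N) \<and> l \<in> dual_ball V N \<and>
        limitin (weak_star_ball V N) x l sequentially \<and>
        (\<lambda>n. dual_norm V N (x n)) \<longlonglongrightarrow> dual_norm V N l)"

section \<open>Direct sums\<close>

definition c0_sum ::
    "'i set \<Rightarrow> ('i \<Rightarrow> 'b::real_vector set) \<Rightarrow> ('i \<Rightarrow> 'b \<Rightarrow> real) \<Rightarrow> ('i \<Rightarrow> 'b) set" where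
  "c0_sum A V N = {f. (\<forall>\<alpha>\<in>A. f \<alpha> \<in> V \<alpha>) \<and> (\<forall>\<alpha>. \<alpha> \<notin> A \<longrightarrow> f \<alpha> = 0) \<and>
     (\<forall>\<epsilon>>0. finite {\<alpha> \<in> A. \<epsilon> \<le> N \<alpha> (f \<alpha>)})}"

definition c0_norm :: "'i set \<Rightarrow> ('i \<Rightarrow> 'b::real_vector \<Rightarrow> real) \<Rightarrow> ('i \<Rightarrow> 'b) \<Rightarrow> real" where
  "c0_norm A N f = (SUP \<alpha>\<in>A. N \<alpha> (f \<alpha>))"

definition lp_sum ::
    "real \<Rightarrow> 'i set \<Rightarrow> ('i \<Rightarrow> 'b::real_vector set) \<Rightarrow> ('i \<Rightarrow> 'b \<Rightarrow> real) \<Rightarrow> ('i \<Rightarrow> 'b) set" where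
  "lp_sum p A V N = {f. (\<forall>\<alpha>\<in>A. f \<alpha> \<in> V \<alpha>) \<and> (\<forall>\<alpha>. \<alpha> \<notin> A \<longrightarrow> f \<alpha> = 0) \<and>
     (\<lambda>\<alpha>. N \<alpha> (f \<alpha>) powr p) summable_on A}"

definition lp_norm ::
    "real \<Rightarrow> 'i set \<Rightarrow> ('i \<Rightarrow> 'b::real_vector \<Rightarrow> real) \<Rightarrow> ('i \<Rightarrow> 'b) \<Rightarrow> real" where
  "lp_norm p A N f = (\<Sum>\<^sub>\<infinity>\<alpha>\<in>A. N \<alpha> (f \<alpha>) powr p) powr (1 / p)"

end

theory Submission
  imports Defs
begin

text \<open>
  Let \<open>K\<close> be the dual ball of the sum \<open>X\<close>. Every member of \<open>X\<close> is approximated by its finite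
  restrictions, so a functional is determined by its coordinates, and for countable \<open>B\<close> the
  relation "equal coordinates in \<open>B\<close>" has a quotient of countable weight, because the summands are
  separable. By compactness each quotient of countable weight lies below one of these.

  Let \<open>y\<close> agree with \<open>l\<close> on \<open>B\<close>. For the \<open>\<ell>\<^sub>1\<close>-sum the functionals that equal \<open>x n\<close> on \<open>B\<close> and \<open>y\<close> off
  \<open>B\<close> stay in \<open>K\<close> and converge to \<open>y\<close>. In the other cases the \<open>q\<close>-th powers of the dual norms of the two
  parts add up, where \<open>q\<close> is the conjugate exponent (\<open>q = 1\<close> for the \<open>c\<^sub>0\<close>-sum), and each functional
  has countable support. If the norms converge, the part of \<open>y\<close> off \<open>B\<close> can be added to \<open>x n\<close> after
  multiplication with a factor tending to \<open>1\<close>. Conversely, if \<open>(x n)\<close> is fiber convergent to \<open>l\<close>, fill \<open>l\<close>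
  up to norm one by a coordinate outside all supports: the lifts of \<open>x n\<close> must carry almost the same
  extra mass there, whence \<open>limsup \<parallel>x n\<parallel> \<le> \<parallel>l\<parallel>\<close>.
\<close>

section \<open>Quotients of compact spaces\<close>

text \<open>Fiber convergence asserts that some cofinal sigma-semilattice exists, so the two
  directions treat it differently. To establish it, the semilattice is chosen: it is indexed by a
  family of countable index sets closed under countable unions, and fiber points are lifted inside
  \<open>K\<close> itself, which settles all upper quotients over a given lower one at once. To
  exploit it, the semilattice is arbitrary and its members need not be given by coordinates. A
  member \<open>L'\<close> is therefore caught between two coordinate relations: it refines that of
  \<open>B0\<close>, so lifts keep their coordinates there, and it is refined by that of
  \<open>B1\<close>, so it cannot notice a change at an index outside \<open>B1\<close>. A second
  member \<open>L\<close> is then taken fine enough to see that index. The bound from below for the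
  norms is weak-star lower semicontinuity. The bound from above is sharp because the mass added to
  \<open>l\<close> is all that the ball leaves free. Uncountability is required of the nonzero
  summands, because zero summands add nothing to the weight of \<open>K\<close>.\<close>

lemma quotient_proj_eq_iff:
  assumes "equiv S E" "x \<in> S" "y \<in> S"
  shows "quotient_proj E x = quotient_proj E y \<longleftrightarrow> (x, y) \<in> E"
  unfolding quotient_proj_def using assms by (rule eq_equiv_class_iff)

lemma continuous_map_quotient_proj:
  "continuous_map K (quotient_topology K E) (quotient_proj E)"
  by (rule quotient_imp_continuous_map[OF quotient_map_quotient_proj])

lemma quotient_proj_image_topspace:
  "quotient_proj E ` topspace K = topspace (quotient_topology K E)"
  by (rule quotient_imp_surjective_map[OF quotient_map_quotient_proj])

lemma compact_space_quotient_topology: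
  "compact_space K \<Longrightarrow> compact_space (quotient_topology K E)"
  using image_compactin[OF _ continuous_map_quotient_proj, of K "topspace K" E]
  by (simp add: compact_space_def quotient_proj_image_topspace)

lemma quotient_proj_lift:
  assumes E: "equiv (topspace K) E" and h: "continuous_map K Z h"
    and eq: "\<forall>(x, y)\<in>E. h x = h y"
  shows "\<exists>g. continuous_map (quotient_topology K E) Z g \<and>
    g ` topspace (quotient_topology K E) = h ` topspace K \<and>
    (\<forall>x\<in>topspace K. g (quotient_proj E x) = h x)"
proof -
  have eq': "h x = h y"
    if "x \<in> topspace K" "y \<in> topspace K" "quotient_proj E x = quotient_proj E y" for x y
    using that eq by (auto simp: quotient_proj_eq_iff[OF E])
  show ?thesis
  proof (rule quotient_map_lift_exists[OF quotient_map_quotient_proj h eq'])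
    fix g assume "continuous_map (quotient_topology K E) Z g"
      "g ` topspace (quotient_topology K E) = h ` topspace K"
      "\<And>x. x \<in> topspace K \<Longrightarrow> g (quotient_proj E x) = h x"
    then show ?thesis by (intro exI[of _ g]) simp
  qed
qed

text \<open>The universal property of the quotient supplies the natural projection, with its
  continuity and surjectivity, from the inclusion of relations alone. Later order statements are
  therefore checked as inclusions.\<close>

lemma quotient_le_iff_superset:
  assumes E: "equiv (topspace K) E" and E': "equiv (topspace K) E'"
  shows "quotient_le K E E' \<longleftrightarrow> E' \<subseteq> E"
proof
  assume "quotient_le K E E'"
  then obtain q where "natural_projection K E' E q"
    unfolding quotient_le_def by (rule exE)
  then have q: "q (quotient_proj E' x) = quotient_proj E x" if "x \<in> topspace K" for x
    using that by (simp add: natural_projection_def)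
  show "E' \<subseteq> E"
  proof (rule subrelI)
    fix x y assume xy: "(x, y) \<in> E'"
    then have top: "x \<in> topspace K" "y \<in> topspace K"
      using equiv_type[OF E'] by auto
    then have "quotient_proj E' x = quotient_proj E' y"
      using xy by (simp add: quotient_proj_eq_iff[OF E'])
    then have "quotient_proj E x = quotient_proj E y"
      by (simp flip: q[OF top(1)] q[OF top(2)])
    then show "(x, y) \<in> E"
      using top by (simp add: quotient_proj_eq_iff[OF E])
  qed
next
  assume sub: "E' \<subseteq> E"
  have "\<forall>(x, y)\<in>E'. quotient_proj E x = quotient_proj E y"
  proof clarify
    fix x y assume "(x, y) \<in> E'"
    then show "quotient_proj E x = quotient_proj E y"
      using sub equiv_type[OF E'] by (subst quotient_proj_eq_iff[OF E]) auto
  qed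
  from quotient_proj_lift[where h = "quotient_proj E", OF E' continuous_map_quotient_proj this]
  obtain q where "continuous_map (quotient_topology K E') (quotient_topology K E) q \<and>
    q ` topspace (quotient_topology K E') = quotient_proj E ` topspace K \<and>
    (\<forall>x\<in>topspace K. q (quotient_proj E' x) = quotient_proj E x)"
    by (rule exE)
  then have "natural_projection K E' E q"
    by (simp add: natural_projection_def quotient_proj_image_topspace)
  then show "quotient_le K E E'"
    unfolding quotient_le_def by (rule exI[of _ q])
qed

text \<open>A continuous injection from a compact space into a Hausdorff space is an embedding. The
  quotient by the kernel of \<open>g\<close> is thus homeomorphic to a subspace of \<open>Y\<close>
  and inherits both properties.\<close>

lemma countable_weight_quotients_kernel:
  assumes K: "compact_space K" and Y: "Hausdorff_space Y" "second_countable Y"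
    and g: "continuous_map K Y g"
    and E_def: "E = {(x, y) \<in> topspace K \<times> topspace K. g x = g y}"
  shows "E \<in> countable_weight_quotients K"
proof -
  have E: "equiv (topspace K) E"
    by (auto simp: E_def equiv_def refl_on_def sym_def trans_def)
  have gE: "g x = g y \<longleftrightarrow> quotient_proj E x = quotient_proj E y"
    if "x \<in> topspace K" "y \<in> topspace K" for x y
    using that quotient_proj_eq_iff[OF E that] by (simp add: E_def)
  have "\<forall>(x, y)\<in>E. g x = g y"
    by (auto simp: E_def)
  from quotient_proj_lift[where h = g, OF E g this]
  obtain h where h: "continuous_map (quotient_topology K E) Y h"
    and hx: "\<forall>x\<in>topspace K. h (quotient_proj E x) = g x"
    by (elim exE conjE)
  have inj: "inj_on h (topspace (quotient_topology K E))"
    unfolding quotient_proj_image_topspace[symmetric] inj_on_def using hx gE by auto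
  have emb: "embedding_map (quotient_topology K E) Y h"
    by (rule continuous_imp_embedding_map[OF h compact_space_quotient_topology[OF K] Y(1) inj])
  note homeo = embedding_map_imp_homeomorphic_space[OF emb]
  have "Hausdorff_space (quotient_topology K E)"
    using homeomorphic_Hausdorff_space[OF homeo] Hausdorff_space_subtopology[OF Y(1)] by simp
  moreover have "second_countable (quotient_topology K E)"
    using homeomorphic_space_second_countability[OF homeo] second_countable_subtopology[OF Y(2)]
    by simp
  ultimately show ?thesis
    using E by (simp add: countable_weight_quotients_def hausdorff_quotients_def)
qed

text \<open>Serves to refute countable weight of the dual ball: a second countable space would be
  one of its own quotients of countable weight.\<close>

lemma Id_on_countable_weight_quotients:
  assumes "Hausdorff_space K" "second_countable K"
  shows "Id_on (topspace K) \<in> countable_weight_quotients K"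
proof -
  have E: "equiv (topspace K) (Id_on (topspace K))"
    by (auto simp: equiv_def refl_on_def sym_def trans_def)
  have "inj_on (quotient_proj (Id_on (topspace K))) (topspace K)"
    by (rule inj_onI) (use quotient_proj_eq_iff[OF E] in auto)
  then have "homeomorphic_map K (quotient_topology K (Id_on (topspace K)))
      (quotient_proj (Id_on (topspace K)))"
    by (simp add: homeomorphic_map_def quotient_map_quotient_proj)
  then have "K homeomorphic_space quotient_topology K (Id_on (topspace K))"
    by (rule homeomorphic_map_imp_homeomorphic_space)
  then show ?thesis
    using assms E homeomorphic_Hausdorff_space homeomorphic_space_second_countability
    by (fastforce simp: countable_weight_quotients_def hausdorff_quotients_def)
qed

text \<open>A pair of points in different classes is separated by basic open sets of the quotient whose
  closures are disjoint; there are countably many pairs of such sets, and by compactness finitely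
  many coordinates suffice for each of them.\<close>

lemma countable_weight_quotient_countable_coordinates:
  fixes ev :: "'j \<Rightarrow> 'a \<Rightarrow> real"
  assumes K: "compact_space K"
    and ev: "\<And>i. i \<in> I \<Longrightarrow> continuous_map K euclideanreal (ev i)"
    and sep: "\<And>x y. x \<in> topspace K \<Longrightarrow> y \<in> topspace K \<Longrightarrow> x \<noteq> y \<Longrightarrow> \<exists>i\<in>I. ev i x \<noteq> ev i y"
    and E: "E \<in> countable_weight_quotients K"
  obtains J where "countable J" "J \<subseteq> I"
    "\<And>x y. x \<in> topspace K \<Longrightarrow> y \<in> topspace K \<Longrightarrow> (\<forall>j\<in>J. ev j x = ev j y) \<Longrightarrow> (x, y) \<in> E"
proof -
  let ?L = "quotient_topology K E" and ?p = "quotient_proj E"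
  have eq: "equiv (topspace K) E" and H: "Hausdorff_space ?L" and sc: "second_countable ?L"
    using E by (auto simp: countable_weight_quotients_def hausdorff_quotients_def)
  have p: "continuous_map K ?L ?p"
    by (rule continuous_map_quotient_proj)
  note surj = quotient_proj_image_topspace[of E K]
  have reg: "regular_space ?L"
    by (rule compact_Hausdorff_imp_regular_space[OF compact_space_quotient_topology[OF K] H])
  obtain \<B> where \<B>: "countable \<B>" "\<And>U. U \<in> \<B> \<Longrightarrow> openin ?L U"
    and base: "\<And>U c. openin ?L U \<Longrightarrow> c \<in> U \<Longrightarrow> \<exists>V\<in>\<B>. c \<in> V \<and> V \<subseteq> U"
    using sc unfolding second_countable_def by metis
  define W where "W = {(U, V) \<in> \<B> \<times> \<B>. (?L closure_of U) \<inter> (?L closure_of V) = {}}"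
  have fin: "\<exists>J. finite J \<and> J \<subseteq> I \<and> (\<forall>x\<in>topspace K. \<forall>y\<in>topspace K.
      ?p x \<in> ?L closure_of U \<longrightarrow> ?p y \<in> ?L closure_of V \<longrightarrow> (\<exists>j\<in>J. ev j x \<noteq> ev j y))"
    if "(U, V) \<in> W" for U V
  proof -
    let ?C = "\<lambda>U. {x \<in> topspace K. ?p x \<in> ?L closure_of U}"
    \<comment> \<open>The sets \<open>?O i\<close> of pairs distinguished by \<open>ev i\<close> are
      open in the square of \<open>K\<close>. By \<open>sep\<close> they cover the compact product
      of the two preimages, which avoids the diagonal because the closures are disjoint.\<close>
    let ?O = "\<lambda>i. {z \<in> topspace (prod_topology K K). ev i (fst z) - ev i (snd z) \<in> - {0}}"
    have comp: "compactin K (?C U)" for U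
      using K closedin_continuous_map_preimage[OF p closedin_closure_of]
        closedin_compact_space by blast
    have "compactin (prod_topology K K) (?C U \<times> ?C V)"
      using comp compactin_Times by blast
    moreover have "\<forall>S\<in>?O ` I. openin (prod_topology K K) S"
    proof clarsimp
      fix i assume "i \<in> I"
      then have "continuous_map (prod_topology K K) euclideanreal
          (\<lambda>z. ev i (fst z) - ev i (snd z))"
        using ev continuous_map_compose[OF continuous_map_fst, unfolded comp_def]
          continuous_map_compose[OF continuous_map_snd, unfolded comp_def]
        by (intro continuous_map_diff) blast+
      then have "openin (prod_topology K K) (?O i)"
        by (rule openin_continuous_map_preimage) auto
      then show "openin (prod_topology K K) {z \<in> topspace K \<times> topspace K. ev i (fst z) \<noteq> ev i (snd z)}"
        by (simp add: case_prod_unfold)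
    qed
    moreover have "?C U \<times> ?C V \<subseteq> \<Union>(?O ` I)"
    proof clarsimp
      fix x y assume *: "x \<in> topspace K" "y \<in> topspace K"
        "?p x \<in> ?L closure_of U" "?p y \<in> ?L closure_of V"
      then have "x \<noteq> y" using \<open>(U, V) \<in> W\<close> by (auto simp: W_def)
      then show "\<exists>i\<in>I. ev i x \<noteq> ev i y" using sep * by blast
    qed
    ultimately obtain \<F> where F: "finite \<F>" "\<F> \<subseteq> ?O ` I" "?C U \<times> ?C V \<subseteq> \<Union>\<F>"
      unfolding compactin_def by meson
    then obtain J where J: "finite J" "J \<subseteq> I" "\<F> = ?O ` J"
      by (meson finite_subset_image)
    have "\<exists>j\<in>J. ev j x \<noteq> ev j y"
      if "x \<in> topspace K" "y \<in> topspace K" "?p x \<in> ?L closure_of U" "?p y \<in> ?L closure_of V" for x y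
    proof -
      have "(x, y) \<in> \<Union>(?O ` J)" using F(3) that unfolding J(3) by blast
      then show ?thesis by auto
    qed
    then show ?thesis using J by blast
  qed
  have "\<exists>J. finite J \<and> J \<subseteq> I \<and> (\<forall>x\<in>topspace K. \<forall>y\<in>topspace K.
      ?p x \<in> ?L closure_of fst z \<longrightarrow> ?p y \<in> ?L closure_of snd z \<longrightarrow> (\<exists>j\<in>J. ev j x \<noteq> ev j y))"
    if "z \<in> W" for z
    using fin[of "fst z" "snd z"] that by simp
  then obtain J where J: "\<forall>z\<in>W. finite (J z) \<and> J z \<subseteq> I \<and> (\<forall>x\<in>topspace K. \<forall>y\<in>topspace K.
      ?p x \<in> ?L closure_of fst z \<longrightarrow> ?p y \<in> ?L closure_of snd z \<longrightarrow> (\<exists>j\<in>J z. ev j x \<noteq> ev j y))"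
    by (rule bchoice[OF ballI, THEN exE])
  show ?thesis
  proof
    have "W \<subseteq> \<B> \<times> \<B>" by (auto simp: W_def)
    then have "countable W" using \<B>(1) by (meson countable_SIGMA countable_subset)
    moreover have "countable (J z)" if "z \<in> W" for z
      using J that by (simp add: countable_finite)
    ultimately show "countable (\<Union>z\<in>W. J z)" by blast
    show "(\<Union>z\<in>W. J z) \<subseteq> I" using J by (meson UN_least)
    fix x y assume xy: "x \<in> topspace K" "y \<in> topspace K" "\<forall>j\<in>\<Union>z\<in>W. J z. ev j x = ev j y"
    show "(x, y) \<in> E"
    proof (rule ccontr)
      assume "(x, y) \<notin> E"
      then have ne: "?p x \<noteq> ?p y" using xy quotient_proj_eq_iff[OF eq] by blast
      have px: "?p x \<in> topspace ?L" and py: "?p y \<in> topspace ?L" using surj xy by auto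
      obtain U0 V0 where 0: "openin ?L U0" "openin ?L V0" "?p x \<in> U0" "?p y \<in> V0" "disjnt U0 V0"
        using H px py ne unfolding Hausdorff_space_def by meson
      obtain U where U: "U \<in> \<B>" "?p x \<in> U" "U \<subseteq> U0" using base 0 by meson
      have "?p y \<notin> ?L closure_of U"
        using 0 U unfolding in_closure_of disjnt_iff by blast
      \<comment> \<open>The Hausdorff property only keeps \<open>?p y\<close> out of the closure of
        \<open>U\<close>. Regularity, applied to \<open>?p y\<close> and that closure, leads to a
        \<open>V\<close> whose closure misses it.\<close>
      then obtain W1 W2 where W12: "openin ?L W1" "openin ?L W2" "?p y \<in> W1"
        "?L closure_of U \<subseteq> W2" "disjnt W1 W2"
        using reg py closedin_closure_of unfolding regular_space_def by (metis DiffI)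
      obtain V where V: "V \<in> \<B>" "?p y \<in> V" "V \<subseteq> W1" using base W12 by meson
      have "(?L closure_of V) \<inter> W2 = {}"
      proof (rule equals0I)
        fix c assume "c \<in> (?L closure_of V) \<inter> W2"
        then obtain d where "d \<in> V" "d \<in> W2" using W12(2) by (auto simp: in_closure_of)
        then show False using V(3) W12(5) by (auto simp: disjnt_iff)
      qed
      then have "(U, V) \<in> W" using U V W12 by (auto simp: W_def)
      moreover have "?p x \<in> ?L closure_of U" "?p y \<in> ?L closure_of V"
        using U V \<B>(2) by (meson closure_of_subset openin_subset subsetD)+
      ultimately have "\<exists>j\<in>J (U, V). ev j x \<noteq> ev j y"
        using bspec[OF J, of "(U, V)"] xy(1,2) by simp
      then show False using xy(3) \<open>(U, V) \<in> W\<close> by blast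
    qed
  qed
qed

text \<open>The order reverses inclusion, so the supremum is the intersection. The factor
  \<open>topspace K \<times> topspace K\<close> fixes the value for the empty family, whose supremum
  is the one-point quotient.\<close>

lemma is_quotient_sup_Inter:
  assumes C: "\<C> \<subseteq> hausdorff_quotients K"
    and L: "L \<in> hausdorff_quotients K" "L = topspace K \<times> topspace K \<inter> \<Inter>\<C>"
  shows "is_quotient_sup K \<C> L"
proof -
  have eq: "equiv (topspace K) E" if "E \<in> hausdorff_quotients K" for E
    using that by (simp add: hausdorff_quotients_def)
  have le: "quotient_le K E E' \<longleftrightarrow> E' \<subseteq> E"
    if "E \<in> hausdorff_quotients K" "E' \<in> hausdorff_quotients K" for E E'
    using that by (intro quotient_le_iff_superset eq)
  show ?thesis
    unfolding is_quotient_sup_def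
  proof (intro conjI ballI impI)
    fix M assume "M \<in> \<C>"
    then show "quotient_le K M L"
      using C L(2) by (subst le[OF _ L(1)]) auto
  next
    fix L' assume L': "L' \<in> hausdorff_quotients K" "\<forall>M\<in>\<C>. quotient_le K M L'"
    have "L' \<subseteq> M" if "M \<in> \<C>" for M
      using C L' that by (simp add: le subset_iff)
    moreover have "L' \<subseteq> topspace K \<times> topspace K"
      using equiv_type[OF eq[OF L'(1)]] .
    ultimately show "quotient_le K L L'"
      using L(2) by (subst le[OF L(1) L'(1)]) auto
  qed (rule L(1))
qed

text \<open>Sequences lifted in \<open>K\<close> project to every quotient, so \<open>lift\<close>
  mentions only the lower relation \<open>L'\<close>: one lift in \<open>K\<close> over
  \<open>L'\<close> serves every \<open>L\<close> above it.\<close>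

lemma map_fiber_convergent_quotients:
  assumes eq: "equiv (topspace K) L" "equiv (topspace K) L'"
    and \<pi>: "natural_projection K L L' \<pi>"
    and x: "\<And>n. x n \<in> topspace K" "limitin K x l sequentially"
    and lift: "\<And>y. (y, l) \<in> L' \<Longrightarrow> \<exists>z. (\<forall>n. (z n, x n) \<in> L') \<and> limitin K z y sequentially"
  shows "map_fiber_convergent (quotient_topology K L) (quotient_topology K L') \<pi>
    (\<lambda>n. quotient_proj L' (x n)) (quotient_proj L' l)"
proof -
  have surj: "topspace (quotient_topology K E) = quotient_proj E ` topspace K" for E
    by (rule quotient_proj_image_topspace[symmetric])
  have lim: "limitin (quotient_topology K E) (\<lambda>n. quotient_proj E (z n)) (quotient_proj E y) sequentially"
    if "limitin K z y sequentially" for E z y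
    using continuous_map_limit[OF continuous_map_quotient_proj that] by (simp add: comp_def)
  have l: "l \<in> topspace K" using x(2) by (simp add: limitin_def)
  have sub: "L' \<subseteq> topspace K \<times> topspace K" using eq(2) by (auto simp: equiv_def refl_on_def)
  show ?thesis
    unfolding map_fiber_convergent_def
  proof (intro conjI allI ballI impI)
    fix c assume cL: "c \<in> topspace (quotient_topology K L)" and c: "\<pi> c = quotient_proj L' l"
    obtain y where y: "y \<in> topspace K" "c = quotient_proj L y"
      using cL[unfolded surj] by (auto elim!: imageE)
    then have "quotient_proj L' y = quotient_proj L' l"
      using c \<pi> by (auto simp: natural_projection_def)
    then have "(y, l) \<in> L'"
      using y(1) l by (simp add: quotient_proj_eq_iff[OF eq(2)])
    from lift[OF this] obtain z where z: "\<forall>n. (z n, x n) \<in> L'" "limitin K z y sequentially"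
      by (elim exE conjE)
    show "\<exists>z. (\<forall>n. z n \<in> topspace (quotient_topology K L) \<and> \<pi> (z n) = quotient_proj L' (x n)) \<and>
        limitin (quotient_topology K L) z c sequentially"
    proof (intro exI[of _ "\<lambda>n. quotient_proj L (z n)"] conjI allI)
      fix n
      have zn: "z n \<in> topspace K" using z(1) sub by blast
      then show "quotient_proj L (z n) \<in> topspace (quotient_topology K L)" using surj by auto
      have "\<pi> (quotient_proj L (z n)) = quotient_proj L' (z n)"
        using \<pi> zn by (simp add: natural_projection_def)
      also have "\<dots> = quotient_proj L' (x n)"
        using z(1) zn x(1) quotient_proj_eq_iff[OF eq(2)] by simp
      finally show "\<pi> (quotient_proj L (z n)) = quotient_proj L' (x n)" .
      show "limitin (quotient_topology K L) (\<lambda>n. quotient_proj L (z n)) c sequentially"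
        unfolding y(2) by (rule lim[OF z(2)])
    qed
  next
    show "quotient_proj L' (x n) \<in> topspace (quotient_topology K L')" for n
      unfolding surj by (rule imageI[OF x(1)])
  qed (rule lim[OF x(2)])
qed

text \<open>The representatives \<open>z n\<close> are chosen arbitrarily in their
  \<open>L\<close>-classes and need not converge in \<open>K\<close>. What survives is the
  convergence of continuous functions that factor through \<open>L\<close>.\<close>

lemma map_fiber_convergent_quotients_lift:
  assumes eq: "equiv (topspace K) L" "equiv (topspace K) L'"
    and \<pi>: "natural_projection K L L' \<pi>"
    and x: "\<And>n. x n \<in> topspace K"
    and fc: "map_fiber_convergent (quotient_topology K L) (quotient_topology K L') \<pi>
      (\<lambda>n. quotient_proj L' (x n)) (quotient_proj L' l)"
    and y: "(y, l) \<in> L'"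
  obtains z where "\<And>n. (z n, x n) \<in> L'"
    "\<And>g. continuous_map K euclideanreal g \<Longrightarrow> \<forall>(a, b)\<in>L. g a = g b \<Longrightarrow>
      (\<lambda>n. g (z n)) \<longlonglongrightarrow> g y"
proof -
  have surj: "topspace (quotient_topology K E) = quotient_proj E ` topspace K" for E
    by (rule quotient_proj_image_topspace[symmetric])
  have yl: "y \<in> topspace K" "l \<in> topspace K"
    using y eq(2) by (auto simp: equiv_def refl_on_def)
  have "\<pi> (quotient_proj L y) = quotient_proj L' l"
    using \<pi> yl y quotient_proj_eq_iff[OF eq(2)] by (simp add: natural_projection_def)
  moreover have "quotient_proj L y \<in> topspace (quotient_topology K L)"
    unfolding surj by (rule imageI[OF yl(1)])
  ultimately have "\<exists>c. (\<forall>n. c n \<in> topspace (quotient_topology K L) \<and> \<pi> (c n) = quotient_proj L' (x n)) \<and>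
      limitin (quotient_topology K L) c (quotient_proj L y) sequentially"
    using fc by (simp add: map_fiber_convergent_def)
  then obtain c where c: "\<forall>n. c n \<in> topspace (quotient_topology K L) \<and> \<pi> (c n) = quotient_proj L' (x n)"
      "limitin (quotient_topology K L) c (quotient_proj L y) sequentially"
    by (elim exE conjE)
  have "\<forall>n. \<exists>a. a \<in> topspace K \<and> c n = quotient_proj L a"
    using c(1) unfolding surj by blast
  from choice[OF this] obtain z where z: "\<forall>n. z n \<in> topspace K \<and> c n = quotient_proj L (z n)"
    by (rule exE)
  show ?thesis
  proof
    fix n
    have "quotient_proj L' (z n) = quotient_proj L' (x n)"
      using c(1) z \<pi> by (simp add: natural_projection_def)
    then show "(z n, x n) \<in> L'" using z x by (simp add: quotient_proj_eq_iff[OF eq(2)])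
  next
    fix g :: "'a \<Rightarrow> real" assume g: "continuous_map K euclideanreal g" "\<forall>(a, b)\<in>L. g a = g b"
    from quotient_proj_lift[where h = g, OF eq(1) g]
    obtain h where h: "continuous_map (quotient_topology K L) euclideanreal h"
      "\<forall>x\<in>topspace K. h (quotient_proj L x) = g x"
      by (elim exE conjE)
    show "(\<lambda>n. g (z n)) \<longlonglongrightarrow> g y"
      using continuous_map_limit[OF h(1) c(2)] h(2) z yl by (simp add: comp_def)
  qed
qed

section \<open>Normed spaces and dual balls\<close>

context
  fixes V :: "'v::real_vector set" and N :: "'v \<Rightarrow> real"
  assumes normed: "normed_space_on V N"
begin

lemma normed_space_on_subspace: "subspace V"
  using normed by (simp add: normed_space_on_def)

lemma normed_space_on_nonneg: "x \<in> V \<Longrightarrow> 0 \<le> N x"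
  using normed by (simp add: normed_space_on_def)

lemma normed_space_on_eq_0: "x \<in> V \<Longrightarrow> N x = 0 \<longleftrightarrow> x = 0"
  using normed by (simp add: normed_space_on_def)

lemma normed_space_on_scale: "x \<in> V \<Longrightarrow> N (c *\<^sub>R x) = \<bar>c\<bar> * N x"
  using normed by (simp add: normed_space_on_def)

lemma normed_space_on_triangle: "x \<in> V \<Longrightarrow> y \<in> V \<Longrightarrow> N (x + y) \<le> N x + N y"
  using normed by (simp add: normed_space_on_def)

lemma normed_space_on_zero: "N 0 = 0"
  using normed_space_on_eq_0[OF subspace_0[OF normed_space_on_subspace]] by simp

lemma normed_space_on_minus: "x \<in> V \<Longrightarrow> N (- x) = N x"
  using normed_space_on_scale[of x "-1"] by simp

lemma normed_space_on_diff_commute: "x \<in> V \<Longrightarrow> y \<in> V \<Longrightarrow> N (x - y) = N (y - x)"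
  using normed_space_on_minus[of "x - y"] subspace_diff[OF normed_space_on_subspace] by simp

lemma separable_on_iff_dense:
  "separable_on V N \<longleftrightarrow>
    (\<exists>D. countable D \<and> D \<subseteq> V \<and> (\<forall>x\<in>V. \<forall>e>0. \<exists>d\<in>D. N (x - d) < e))"
proof -
  interpret Metric_space V "norm_dist V N" by (rule Metric_space_norm_dist[OF normed])
  have "mtopology closure_of D = V \<longleftrightarrow> (\<forall>x\<in>V. \<forall>e>0. \<exists>d\<in>D. N (x - d) < e)" if "D \<subseteq> V" for D
  proof -
    have "mtopology closure_of D = {x \<in> V. \<forall>e>0. \<exists>d\<in>D. N (x - d) < e}"
      unfolding metric_closure_of using that by (force simp: norm_dist_def)
    then show ?thesis by blast
  qed
  then show ?thesis
    unfolding separable_on_def separable_space_def norm_topology_def by auto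
qed

lemma mcomplete_norm_dist_iff:
  "Metric_space.mcomplete V (norm_dist V N) \<longleftrightarrow>
    (\<forall>s. (\<forall>n. s n \<in> V) \<and> (\<forall>e>0. \<exists>m. \<forall>i\<ge>m. \<forall>j\<ge>m. N (s i - s j) < e) \<longrightarrow>
      (\<exists>x\<in>V. (\<lambda>n. N (s n - x)) \<longlonglongrightarrow> 0))"
proof -
  interpret Metric_space V "norm_dist V N" by (rule Metric_space_norm_dist[OF normed])
  have "MCauchy s \<longleftrightarrow> (\<forall>n. s n \<in> V) \<and> (\<forall>e>0. \<exists>m. \<forall>i\<ge>m. \<forall>j\<ge>m. N (s i - s j) < e)" for s
    unfolding MCauchy_def by (auto simp: norm_dist_def image_subset_iff)
  moreover have "limitin mtopology s x sequentially \<longleftrightarrow> x \<in> V \<and> (\<lambda>n. N (s n - x)) \<longlonglongrightarrow> 0"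
    if "\<forall>n. s n \<in> V" for s x
    unfolding limitin_metric_dist_null using that
    by (auto simp: norm_dist_def)
  ultimately show ?thesis
    unfolding mcomplete_def by (intro all_cong1) auto
qed

text \<open>The one-step extension in the Hahn-Banach theorem. A partial functional is given by its
  graph \<open>G\<close>, and domination by \<open>N\<close> is a condition on the points of the
  graph.\<close>

lemma norming_functional_extension:
  assumes G: "subspace G" and le: "\<And>z. z \<in> G \<Longrightarrow> fst z \<in> V \<and> snd z \<le> N (fst z)"
    and u: "u \<in> V"
  shows "\<exists>c. \<forall>z\<in>{x + y |x y. x \<in> G \<and> y \<in> span {(u, c)}}. fst z \<in> V \<and> snd z \<le> N (fst z)"
proof -
  note V = normed_space_on_subspace
  let ?S = "(\<lambda>z. snd z - N (fst z - u)) ` G"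
  have *: "snd z - N (fst z - u) \<le> N (fst w + u) - snd w" if "z \<in> G" "w \<in> G" for z w
  proof -
    have "snd (z + w) \<le> N (fst (z + w))"
      using le subspace_add[OF G that] by blast
    also have "fst (z + w) = (fst z - u) + (fst w + u)" by simp
    also have "N \<dots> \<le> N (fst z - u) + N (fst w + u)"
      using le that u by (intro normed_space_on_triangle subspace_diff[OF V] subspace_add[OF V]) auto
    finally show ?thesis by simp
  qed
  have 0: "0 \<in> G" using subspace_0[OF G] .
  \<comment> \<open>Any value between the numbers \<open>snd z - N (fst z - u)\<close> and the
    numbers \<open>N (fst w + u) - snd w\<close> would do. The supremum of the former is such a
    value by the inequality above.\<close>
  define c where "c = Sup ?S"
  have bdd: "bdd_above ?S" using *[OF _ 0] by (auto intro!: bdd_aboveI2)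
  have c1: "snd z - c \<le> N (fst z - u)" if "z \<in> G" for z
    using cSup_upper[OF imageI[OF that] bdd] by (simp add: c_def)
  have c2: "snd w + c \<le> N (fst w + u)" if "w \<in> G" for w
  proof -
    have "c \<le> N (fst w + u) - snd w"
      unfolding c_def using 0 * that by (intro cSup_least) auto
    then show ?thesis by simp
  qed
  show ?thesis
  proof (intro exI[of _ c] ballI)
    fix z assume "z \<in> {x + y |x y. x \<in> G \<and> y \<in> span {(u, c)}}"
    then obtain x y where "x \<in> G" "z = x + y" "y \<in> span {(u, c)}" by blast
    then obtain t where x: "x \<in> G" "z = x + t *\<^sub>R (u, c)"
      unfolding span_singleton by blast
    have xV: "fst x \<in> V" using le x by blast
    have zV: "fst z \<in> V"
      using xV u x by (simp add: subspace_add[OF V] subspace_scale[OF V])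
    have scaled: "(1 / s) *\<^sub>R x \<in> G" for s using subspace_scale[OF G] x by blast
    have N: "s * N y = N (s *\<^sub>R y)" if "s > 0" "y \<in> V" for s y
      using normed_space_on_scale[OF that(2)] that by simp
    have "snd z \<le> N (fst z)"
    \<comment> \<open>Dividing by the absolute value of \<open>t\<close> reduces to the two bounds
      on \<open>c\<close>: \<open>c2\<close> for positive \<open>t\<close>, \<open>c1\<close> for
      negative \<open>t\<close>.\<close>
    proof (cases t "0 :: real" rule: linorder_cases)
      case equal
      then show ?thesis using x le by simp
    next
      case greater
      have "t * (snd x / t + c) \<le> t * N (fst x /\<^sub>R t + u)"
        using c2[OF scaled[of t]] greater by (simp add: divide_inverse_commute)
      also have "\<dots> = N (fst z)"
        using greater x xV u
        by (subst N) (auto simp: scaleR_add_right intro!: subspace_add[OF V] subspace_scale[OF V])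
      finally have "t * (snd x / t + c) \<le> N (fst z)" .
      moreover have "snd z = t * (snd x / t + c)" using greater x by (simp add: distrib_left)
      ultimately show ?thesis by simp
    next
      case less
      define s where "s = - t"
      have s: "s > 0" "t = - s" using less by (auto simp: s_def)
      have "s * (snd x / s - c) \<le> s * N (fst x /\<^sub>R s - u)"
        using c1[OF scaled[of s]] s by (simp add: divide_inverse_commute)
      also have "\<dots> = N (fst z)"
        using s x xV u
        by (subst N) (auto simp: scaleR_diff_right intro!: subspace_diff[OF V] subspace_scale[OF V])
      finally have "s * (snd x / s - c) \<le> N (fst z)" .
      moreover have "snd z = s * (snd x / s - c)" using s x by (simp add: right_diff_distrib)
      ultimately show ?thesis by simp
    qed
    then show "fst z \<in> V \<and> snd z \<le> N (fst z)" using zV by simp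
  qed
qed

text \<open>The Hahn-Banach theorem in its norming form, by Zorn's lemma over graphs, for which the
  upper bound of a chain is simply its union.\<close>

theorem norming_functional:
  assumes v: "v \<in> V"
  obtains \<phi> where "\<And>x y. x \<in> V \<Longrightarrow> y \<in> V \<Longrightarrow> \<phi> (x + y) = \<phi> x + \<phi> y"
    "\<And>x c. x \<in> V \<Longrightarrow> \<phi> (c *\<^sub>R x) = c * \<phi> x"
    "\<And>x. x \<in> V \<Longrightarrow> \<bar>\<phi> x\<bar> \<le> N x" "\<phi> v = N v"
proof -
  note V = normed_space_on_subspace
  define \<G> where "\<G> = {G. subspace G \<and> (v, N v) \<in> G \<and> (\<forall>z\<in>G. fst z \<in> V \<and> snd z \<le> N (fst z))}"
  have "span {(v, N v)} \<in> \<G>"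
  proof -
    have "t * N v \<le> N (t *\<^sub>R v)" for t
      using normed_space_on_scale[OF v, of t] mult_right_mono[of t "\<bar>t\<bar>" "N v"]
        normed_space_on_nonneg[OF v] by simp
    then have "fst z \<in> V \<and> snd z \<le> N (fst z)" if "z \<in> span {(v, N v)}" for z
      using that v by (auto simp: span_singleton subspace_scale[OF V])
    then show ?thesis
      unfolding \<G>_def using span_base[of "(v, N v)" "{(v, N v)}"] by auto
  qed
  moreover have "\<Union>\<C> \<in> \<G>" if "\<C> \<noteq> {}" "subset.chain \<G> \<C>" for \<C>
  proof -
    have sub: "\<C> \<subseteq> \<G>" and chain: "\<And>X Y. X \<in> \<C> \<Longrightarrow> Y \<in> \<C> \<Longrightarrow> X \<subseteq> Y \<or> Y \<subseteq> X"
      using that(2) by (auto simp: subset_chain_def)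
    have sp: "subspace X" if "X \<in> \<C>" for X using sub that by (auto simp: \<G>_def)
    have "subspace (\<Union>\<C>)"
      unfolding subspace_def
    proof (intro conjI ballI allI)
      show "0 \<in> \<Union>\<C>" using \<open>\<C> \<noteq> {}\<close> sp subspace_0 by blast
    next
      fix x y assume "x \<in> \<Union>\<C>" "y \<in> \<Union>\<C>"
      then obtain X where "X \<in> \<C>" "x \<in> X" "y \<in> X" using chain by blast
      then show "x + y \<in> \<Union>\<C>" using sp subspace_add by blast
    next
      fix x c assume "x \<in> \<Union>\<C>"
      then show "c *\<^sub>R x \<in> \<Union>\<C>" using sp subspace_scale by blast
    qed
    then show ?thesis using sub \<open>\<C> \<noteq> {}\<close> by (auto simp: \<G>_def)
  qed
  ultimately have "\<exists>G\<in>\<G>. \<forall>X\<in>\<G>. G \<subseteq> X \<longrightarrow> X = G"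
    by (intro subset_Zorn_nonempty) auto
  then obtain G where "G \<in> \<G>" and max: "\<And>X. X \<in> \<G> \<Longrightarrow> G \<subseteq> X \<Longrightarrow> X = G" by blast
  then have G: "subspace G" and vG: "(v, N v) \<in> G"
    and le: "\<And>z. z \<in> G \<Longrightarrow> fst z \<in> V \<and> snd z \<le> N (fst z)"
    by (auto simp: \<G>_def)
  have total: "\<exists>a. (u, a) \<in> G" if u: "u \<in> V" for u
  proof -
    obtain c where c: "\<forall>z\<in>{x + y |x y. x \<in> G \<and> y \<in> span {(u, c)}}.
        fst z \<in> V \<and> snd z \<le> N (fst z)"
      using norming_functional_extension[OF G le u] by (rule exE)
    let ?H = "{x + y |x y. x \<in> G \<and> y \<in> span {(u, c)}}"
    have GH: "G \<subseteq> ?H"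
    proof
      fix z assume "z \<in> G"
      then have "z = z + 0 \<and> z \<in> G \<and> 0 \<in> span {(u, c)}" by (simp add: span_zero)
      then show "z \<in> ?H" by blast
    qed
    have "?H \<in> \<G>"
      unfolding \<G>_def
      by (rule CollectI) (rule conjI[OF subspace_sums[OF G subspace_span] conjI[OF subsetD[OF GH vG] c]])
    then have "?H = G" using GH by (rule max)
    moreover have "(u, c) \<in> ?H"
    proof -
      have "(u, c) = 0 + (u, c) \<and> 0 \<in> G \<and> (u, c) \<in> span {(u, c)}"
        using subspace_0[OF G] by (simp add: span_base)
      then show ?thesis by blast
    qed
    ultimately have "(u, c) \<in> G" by simp
    then show ?thesis by (rule exI)
  qed
  \<comment> \<open>Domination alone forces a graph to be single-valued: \<open>a - b\<close> and
    \<open>b - a\<close> both lie over the vector \<open>0\<close>, hence are at most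
    \<open>N 0 = 0\<close>.\<close>
  have unique: "a = b" if "(x, a) \<in> G" "(x, b) \<in> G" for x a b
  proof -
    have "(x, a) - (x, b) \<in> G" "(x, b) - (x, a) \<in> G" using subspace_diff[OF G] that by blast+
    from le[OF this(1)] le[OF this(2)] show ?thesis using normed_space_on_zero by simp
  qed
  define \<phi> where "\<phi> x = (THE a. (x, a) \<in> G)" for x
  have \<phi>: "\<phi> x = a \<longleftrightarrow> (x, a) \<in> G" if xV: "x \<in> V" for x a
  proof -
    obtain b where b: "(x, b) \<in> G" using total[OF xV] by (rule exE)
    have "\<phi> x = b" unfolding \<phi>_def by (rule the_equality) (rule b, rule unique[OF _ b])
    then show ?thesis using b unique[OF b] by blast
  qed
  have graph: "(x, \<phi> x) \<in> G" if "x \<in> V" for x using \<phi>[OF that, of "\<phi> x"] by simp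
  have add: "\<phi> (x + y) = \<phi> x + \<phi> y" if "x \<in> V" "y \<in> V" for x y
    using subspace_add[OF G graph[OF that(1)] graph[OF that(2)]] that
    by (subst \<phi>) (simp_all add: subspace_add[OF V])
  have scale: "\<phi> (c *\<^sub>R x) = c * \<phi> x" if "x \<in> V" for x c
    using subspace_scale[OF G graph[OF that], of c] that
    by (subst \<phi>) (simp_all add: subspace_scale[OF V])
  have "\<bar>\<phi> x\<bar> \<le> N x" if "x \<in> V" for x
    using le[OF graph[OF that]] le[OF graph[of "- x"]] that subspace_neg[OF V that] scale[OF that, of "-1"]
      normed_space_on_minus[OF that] by simp
  moreover have "\<phi> v = N v" using \<phi>[OF v] vG by simp
  ultimately show ?thesis using that add scale by blast
qed

section \<open>Bounded functionals and the dual norm\<close>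

lemma dual_spaceI:
  assumes "\<phi> \<in> extensional V" "\<And>x y. x \<in> V \<Longrightarrow> y \<in> V \<Longrightarrow> \<phi> (x + y) = \<phi> x + \<phi> y"
    "\<And>x c. x \<in> V \<Longrightarrow> \<phi> (c *\<^sub>R x) = c * \<phi> x" "\<And>x. x \<in> V \<Longrightarrow> \<bar>\<phi> x\<bar> \<le> C * N x"
  shows "\<phi> \<in> dual_space V N"
  unfolding dual_space_def using assms by blast

lemma dual_space_plus: "\<phi> \<in> dual_space V N \<Longrightarrow> x \<in> V \<Longrightarrow> y \<in> V \<Longrightarrow> \<phi> (x + y) = \<phi> x + \<phi> y"
  by (simp add: dual_space_def)

lemma dual_space_scaleR: "\<phi> \<in> dual_space V N \<Longrightarrow> x \<in> V \<Longrightarrow> \<phi> (c *\<^sub>R x) = c * \<phi> x"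
  by (simp add: dual_space_def)

lemma dual_space_zero: "\<phi> \<in> dual_space V N \<Longrightarrow> \<phi> 0 = 0"
  using dual_space_scaleR[OF _ subspace_0[OF normed_space_on_subspace], of \<phi> 0] by simp

lemma dual_space_combination:
  assumes "\<phi> \<in> dual_space V N" "\<psi> \<in> dual_space V N"
  shows "restrict (\<lambda>x. a * \<phi> x + b * \<psi> x) V \<in> dual_space V N"
proof -
  obtain C D where CD: "\<forall>x\<in>V. \<bar>\<phi> x\<bar> \<le> C * N x" "\<forall>x\<in>V. \<bar>\<psi> x\<bar> \<le> D * N x"
    using assms by (auto simp: dual_space_def)
  have "\<bar>a * \<phi> x + b * \<psi> x\<bar> \<le> (\<bar>a\<bar> * C + \<bar>b\<bar> * D) * N x" if "x \<in> V" for x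
  proof -
    have "\<bar>a * \<phi> x + b * \<psi> x\<bar> \<le> \<bar>a\<bar> * \<bar>\<phi> x\<bar> + \<bar>b\<bar> * \<bar>\<psi> x\<bar>"
      by (metis abs_mult abs_triangle_ineq)
    also have "\<dots> \<le> \<bar>a\<bar> * (C * N x) + \<bar>b\<bar> * (D * N x)"
      using CD that by (intro add_mono mult_left_mono) auto
    finally show ?thesis by (simp add: algebra_simps)
  qed
  then show ?thesis
    using assms subspace_add[OF normed_space_on_subspace] subspace_scale[OF normed_space_on_subspace]
    by (intro dual_spaceI[of _ "\<bar>a\<bar> * C + \<bar>b\<bar> * D"])
      (simp_all add: dual_space_plus dual_space_scaleR distrib_left)
qed

lemma dual_norm_bdd_above:
  assumes "\<phi> \<in> dual_space V N"
  shows "bdd_above ((\<lambda>x. \<bar>\<phi> x\<bar>) ` {x \<in> V. N x \<le> 1})"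
proof -
  obtain C where C: "\<forall>x\<in>V. \<bar>\<phi> x\<bar> \<le> C * N x"
    using assms by (auto simp: dual_space_def)
  \<comment> \<open>The constant \<open>C\<close> can be negative when \<open>V\<close> is trivial,
    hence its absolute value.\<close>
  have "\<bar>\<phi> x\<bar> \<le> \<bar>C\<bar>" if "x \<in> V" "N x \<le> 1" for x
  proof -
    have "C * N x \<le> \<bar>C\<bar> * 1"
      using that normed_space_on_nonneg by (intro mult_mono) auto
    then show ?thesis using C that by force
  qed
  then show ?thesis by (auto simp: bdd_above_def)
qed

lemma dual_norm_nonneg:
  assumes "\<phi> \<in> dual_space V N"
  shows "0 \<le> dual_norm V N \<phi>"
proof -
  have "\<bar>\<phi> 0\<bar> \<le> dual_norm V N \<phi>"
    unfolding dual_norm_def using subspace_0[OF normed_space_on_subspace] normed_space_on_zero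
    by (intro cSUP_upper dual_norm_bdd_above[OF assms]) auto
  then show ?thesis by simp
qed

lemma abs_le_dual_norm_unit:
  assumes "\<phi> \<in> dual_space V N" "x \<in> V" "N x \<le> 1"
  shows "\<bar>\<phi> x\<bar> \<le> dual_norm V N \<phi>"
  unfolding dual_norm_def using assms by (intro cSUP_upper dual_norm_bdd_above) auto

lemma abs_le_dual_norm:
  assumes "\<phi> \<in> dual_space V N" "x \<in> V"
  shows "\<bar>\<phi> x\<bar> \<le> dual_norm V N \<phi> * N x"
proof (cases "x = 0")
  case True
  have "\<phi> (0 *\<^sub>R x) = 0 * \<phi> x" using assms unfolding dual_space_def by blast
  then have "\<phi> x = 0" using True by simp
  then show ?thesis using True normed_space_on_zero by simp
next
  case False
  then have pos: "N x > 0" using normed_space_on_nonneg normed_space_on_eq_0 assms(2) by fastforce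
  have "\<bar>\<phi> ((1 / N x) *\<^sub>R x)\<bar> \<le> dual_norm V N \<phi>"
    using assms pos normed_space_on_scale
    by (intro abs_le_dual_norm_unit) (auto simp: subspace_scale[OF normed_space_on_subspace])
  then show ?thesis
    using assms pos by (simp add: dual_space_def abs_mult divide_le_eq)
qed

lemma dual_norm_le:
  assumes "\<And>x. x \<in> V \<Longrightarrow> N x \<le> 1 \<Longrightarrow> \<bar>\<phi> x\<bar> \<le> C"
  shows "dual_norm V N \<phi> \<le> C"
  unfolding dual_norm_def using assms subspace_0[OF normed_space_on_subspace] normed_space_on_zero
  by (intro cSUP_least) auto

lemma less_dual_norm:
  assumes "\<phi> \<in> dual_space V N" "c < dual_norm V N \<phi>"
  obtains x where "x \<in> V" "N x \<le> 1" "c < \<bar>\<phi> x\<bar>"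
  using assms(2) dual_norm_le[of \<phi> c] by (meson linorder_not_le order_less_imp_le)

text \<open>By homogeneity the supremum bound becomes one inequality per vector. The ball is then an
  intersection of pointwise conditions, which is the form used for compactness.\<close>

lemma dual_ball_iff:
  "\<phi> \<in> dual_ball V N \<longleftrightarrow> \<phi> \<in> extensional V \<and> (\<forall>x\<in>V. \<forall>y\<in>V. \<phi> (x + y) = \<phi> x + \<phi> y) \<and>
     (\<forall>x\<in>V. \<forall>c. \<phi> (c *\<^sub>R x) = c * \<phi> x) \<and> (\<forall>x\<in>V. \<bar>\<phi> x\<bar> \<le> N x)" (is "_ \<longleftrightarrow> ?R")
proof
  assume *: "\<phi> \<in> dual_ball V N"
  have "\<bar>\<phi> x\<bar> \<le> N x" if "x \<in> V" for x
  proof -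
    have "\<bar>\<phi> x\<bar> \<le> dual_norm V N \<phi> * N x"
      using * that by (intro abs_le_dual_norm) (auto simp: dual_ball_def)
    also have "\<dots> \<le> 1 * N x"
      using * that normed_space_on_nonneg by (intro mult_right_mono) (auto simp: dual_ball_def)
    finally show ?thesis by simp
  qed
  then show ?R using * by (simp add: dual_ball_def dual_space_def)
next
  assume R: ?R
  then have "\<phi> \<in> dual_space V N" by (intro dual_spaceI[of _ 1]) auto
  moreover have "dual_norm V N \<phi> \<le> 1" using R by (intro dual_norm_le) force
  ultimately show "\<phi> \<in> dual_ball V N" by (simp add: dual_ball_def)
qed

section \<open>The weak-star topology of the ball and its compactness\<close>

lemma topspace_weak_star_ball: "topspace (weak_star_ball V N) = dual_ball V N"
  unfolding weak_star_ball_def by (auto simp: PiE_def dual_ball_def dual_space_def)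

lemma continuous_map_weak_star_eval:
  "v \<in> V \<Longrightarrow> continuous_map (weak_star_ball V N) euclideanreal (\<lambda>\<phi>. \<phi> v)"
  unfolding weak_star_ball_def
  by (intro continuous_map_from_subtopology continuous_map_product_projection)

lemma limitin_weak_star_ball:
  assumes "\<And>n. x n \<in> dual_ball V N"
  shows "limitin (weak_star_ball V N) x l sequentially \<longleftrightarrow>
    l \<in> dual_ball V N \<and> (\<forall>v\<in>V. (\<lambda>n. x n v) \<longlonglongrightarrow> l v)"
proof -
  have "dual_ball V N \<subseteq> extensional V" by (auto simp: dual_ball_def dual_space_def)
  then show ?thesis
    unfolding weak_star_ball_def limitin_subtopology limitin_componentwise
    using assms by (auto simp: PiE_def intro!: always_eventually)
qed

lemma Hausdorff_weak_star_ball: "Hausdorff_space (weak_star_ball V N)"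
  unfolding weak_star_ball_def
  by (intro Hausdorff_space_subtopology) (simp add: Hausdorff_space_product_topology)

text \<open>The Banach-Alaoglu theorem: by \<open>dual_ball_iff\<close> the ball is cut out of a
  product of compact intervals by closed conditions, each of which involves finitely many
  coordinates.\<close>

theorem compact_weak_star_ball: "compact_space (weak_star_ball V N)"
proof -
  let ?P = "product_topology (\<lambda>_. euclideanreal) V"
  let ?C = "\<lambda>Q. {\<phi> \<in> topspace ?P. Q \<phi>}"
  note V = normed_space_on_subspace
  have cont: "continuous_map ?P euclideanreal (\<lambda>\<phi>. \<phi> v)" if "v \<in> V" for v
    using that by (rule continuous_map_product_projection)
  have closed: "closedin ?P {\<phi> \<in> topspace ?P. f \<phi> \<in> S}"
    if "continuous_map ?P euclideanreal f" "closed S" for f :: "('v \<Rightarrow> real) \<Rightarrow> real" and S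
    using that by (intro closedin_continuous_map_preimage) auto
  have "closedin ?P (topspace ?P
      \<inter> (\<Inter>x\<in>V. \<Inter>y\<in>V. topspace ?P \<inter> {\<phi> \<in> topspace ?P. \<phi> (x + y) - (\<phi> x + \<phi> y) \<in> {0}})
      \<inter> (\<Inter>x\<in>V. \<Inter>c. {\<phi> \<in> topspace ?P. \<phi> (c *\<^sub>R x) - c * \<phi> x \<in> {0}})
      \<inter> (\<Inter>x\<in>V. {\<phi> \<in> topspace ?P. \<phi> x \<in> {- N x..N x}}))"
    by (intro closedin_Int closedin_INT closedin_topspace closed continuous_intros
        continuous_map_diff continuous_map_add continuous_map_real_mult_left cont
        subspace_add[OF V] subspace_scale[OF V])
      (use subspace_0[OF V] in auto)
  also have "\<dots> = dual_ball V N"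
    using subspace_0[OF V] by (auto simp: dual_ball_iff PiE_def abs_le_iff minus_le_iff)
  finally have "closedin ?P (dual_ball V N)" .
  moreover have "dual_ball V N \<subseteq> PiE V (\<lambda>x. {- N x..N x})"
    by (auto simp: dual_ball_iff PiE_def abs_le_iff minus_le_iff)
  moreover have "compactin ?P (PiE V (\<lambda>x. {- N x..N x}))"
    by (simp add: compactin_PiE)
  ultimately have "compactin ?P (dual_ball V N)"
    using closed_compactin by blast
  then show ?thesis
    unfolding weak_star_ball_def by (rule compact_space_subtopology)
qed

end

section \<open>The dual ball of a sum of separable spaces\<close>

definition coord :: "'i \<Rightarrow> 'b::zero \<Rightarrow> 'i \<Rightarrow> 'b" where
  "coord \<alpha> v = (\<lambda>\<beta>. if \<beta> = \<alpha> then v else 0)"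

definition block :: "'i set \<Rightarrow> ('i \<Rightarrow> 'b::zero) \<Rightarrow> 'i \<Rightarrow> 'b" where
  "block B f = (\<lambda>\<beta>. if \<beta> \<in> B then f \<beta> else 0)"

lemma block_add: "block B (f + g) = block B f + block B g" for f :: "'i \<Rightarrow> 'b::monoid_add"
  by (auto simp: block_def fun_eq_iff)

lemma block_scaleR: "block B (c *\<^sub>R f) = c *\<^sub>R block B f" for f :: "'i \<Rightarrow> 'b::real_vector"
  by (auto simp: block_def fun_eq_iff scaleR_fun_def)

lemma block_split: "f = block B f + block (- B) f" for f :: "'i \<Rightarrow> 'b::monoid_add"
  by (auto simp: block_def fun_eq_iff)

lemma block_block: "block B (block C f) = block (B \<inter> C) f"
  by (auto simp: block_def fun_eq_iff)

lemma block_coord: "block B (coord \<alpha> v) = (if \<alpha> \<in> B then coord \<alpha> v else 0)"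
  by (auto simp: block_def coord_def fun_eq_iff)

lemma block_singleton: "block {\<alpha>} f = coord \<alpha> (f \<alpha>)"
  by (auto simp: block_def coord_def fun_eq_iff)

lemma block_insert:
  "\<alpha> \<notin> F \<Longrightarrow> block (insert \<alpha> F) f = coord \<alpha> (f \<alpha>) + block F f" for f :: "'i \<Rightarrow> 'b::monoid_add"
  by (auto simp: block_def coord_def fun_eq_iff)

lemma coord_diff: "coord \<alpha> (v - w) = coord \<alpha> v - coord \<alpha> w" for v :: "'b::ab_group_add"
  by (auto simp: coord_def fun_eq_iff)

lemma second_countable_euclidean:
  "second_countable (euclidean :: 'a::second_countable_topology topology)"
proof -
  obtain \<B> :: "'a set set" where \<B>: "countable \<B>" "\<And>C. C \<in> \<B> \<Longrightarrow> open C"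
    "\<And>S. open S \<Longrightarrow> \<exists>U. U \<subseteq> \<B> \<and> S = \<Union>U"
    by (rule univ_second_countable) blast
  have "\<exists>V\<in>\<B>. x \<in> V \<and> V \<subseteq> U" if "open U" "x \<in> U" for U x
    using \<B>(3)[OF that(1)] that(2) by blast
  then show ?thesis
    unfolding second_countable_def using \<B> by (intro exI[of _ \<B>]) auto
qed

text \<open>The features common to the c0-sum and the lp-sums: isometrically embedded summands,
  block projections of norm at most one, and approximation by finite blocks.\<close>

locale separable_sum =
  fixes A :: "'i set" and V :: "'i \<Rightarrow> 'b::real_vector set" and N :: "'i \<Rightarrow> 'b \<Rightarrow> real"
    and X :: "('i \<Rightarrow> 'b) set" and M :: "('i \<Rightarrow> 'b) \<Rightarrow> real"
  assumes summand: "\<alpha> \<in> A \<Longrightarrow> normed_space_on (V \<alpha>) (N \<alpha>)"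
    and separable: "\<alpha> \<in> A \<Longrightarrow> separable_on (V \<alpha>) (N \<alpha>)"
    and uncountable_index: "uncountable {\<alpha> \<in> A. V \<alpha> \<noteq> {0}}"
    and normed: "normed_space_on X M"
    and in_summand: "f \<in> X \<Longrightarrow> \<alpha> \<in> A \<Longrightarrow> f \<alpha> \<in> V \<alpha>"
    and coord_in: "\<alpha> \<in> A \<Longrightarrow> v \<in> V \<alpha> \<Longrightarrow> coord \<alpha> v \<in> X"
    and norm_coord: "\<alpha> \<in> A \<Longrightarrow> v \<in> V \<alpha> \<Longrightarrow> M (coord \<alpha> v) = N \<alpha> v"
    and block_in: "f \<in> X \<Longrightarrow> block B f \<in> X"
    and norm_block_le: "f \<in> X \<Longrightarrow> M (block B f) \<le> M f"
    and finite_approx: "f \<in> X \<Longrightarrow> e > 0 \<Longrightarrow> \<exists>F. finite F \<and> F \<subseteq> A \<and> M (block (- F) f) < e"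
begin

abbreviation K :: "(('i \<Rightarrow> 'b) \<Rightarrow> real) topology" where
  "K \<equiv> weak_star_ball X M"

lemmas X_subspace = normed_space_on_subspace[OF normed]
lemmas topspace_K = topspace_weak_star_ball[OF normed]
lemmas dual_plus = dual_space_plus[OF normed]
lemmas dual_scaleR = dual_space_scaleR[OF normed]
lemmas dual_zero = dual_space_zero[OF normed]

section \<open>Functionals on the sum and their coordinates\<close>

lemma zero_in_sum: "0 \<in> X"
  by (rule subspace_0[OF X_subspace])

lemma dual_diff:
  assumes "\<phi> \<in> dual_space X M" "f \<in> X" "g \<in> X"
  shows "\<phi> (f - g) = \<phi> f - \<phi> g"
  using dual_plus[OF assms(1) subspace_diff[OF X_subspace assms(2,3)] assms(3)] by simp

lemma dual_ball_subset: "\<phi> \<in> dual_ball X M \<Longrightarrow> \<phi> \<in> dual_space X M"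
  by (simp add: dual_ball_def)

lemma dual_block_split:
  assumes "\<phi> \<in> dual_space X M" "f \<in> X"
  shows "\<phi> f = \<phi> (block B f) + \<phi> (block (- B) f)"
  using dual_plus[OF assms(1) block_in[OF assms(2), of B] block_in[OF assms(2), of "- B"]]
  by (simp flip: block_split)

lemma dual_block_finite:
  assumes \<phi>: "\<phi> \<in> dual_space X M" and f: "f \<in> X" and F: "finite F" "F \<subseteq> A"
  shows "\<phi> (block F f) = (\<Sum>\<alpha>\<in>F. \<phi> (coord \<alpha> (f \<alpha>)))"
  using F
proof (induction F rule: finite_induct)
  case empty
  have "block {} f = 0" by (simp add: block_def fun_eq_iff)
  then have "\<phi> (block {} f) = 0" by (simp only: dual_zero[OF \<phi>])
  then show ?case by simp
next
  case (insert \<alpha> F)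
  then show ?case
    using dual_plus[OF \<phi> coord_in[of \<alpha> "f \<alpha>"] block_in[OF f, of F]] in_summand[OF f, of \<alpha>]
    by (simp add: block_insert del: plus_fun_apply)
qed

definition agree :: "'i set \<Rightarrow> (('i \<Rightarrow> 'b) \<Rightarrow> real) \<Rightarrow> (('i \<Rightarrow> 'b) \<Rightarrow> real) \<Rightarrow> bool" where
  "agree B \<phi> \<psi> \<longleftrightarrow> (\<forall>\<alpha>\<in>B. \<forall>v\<in>V \<alpha>. \<phi> (coord \<alpha> v) = \<psi> (coord \<alpha> v))"

lemma agree_mono: "agree C \<phi> \<psi> \<Longrightarrow> B \<subseteq> C \<Longrightarrow> agree B \<phi> \<psi>"
  by (auto simp: agree_def)

text \<open>The finite sets \<open>F n\<close>, off which \<open>f\<close> has norm below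
  \<open>1 / (n + 1)\<close>, are found from \<open>f\<close> alone. Their union therefore serves
  all pairs of functionals and can be chosen vector by vector in
  \<open>coord_rel_cofinal\<close>.\<close>

lemma countably_many_coordinates:
  assumes f: "f \<in> X"
  shows "\<exists>B. countable B \<and> B \<subseteq> A \<and>
    (\<forall>\<phi>\<in>dual_space X M. \<forall>\<psi>\<in>dual_space X M. agree B \<phi> \<psi> \<longrightarrow> \<phi> f = \<psi> f)"
proof -
  have "\<forall>n. \<exists>F. finite F \<and> F \<subseteq> A \<and> M (block (- F) f) < 1 / real (Suc n)"
    using finite_approx[OF f] by simp
  from choice[OF this] obtain F where
    F: "\<forall>n. finite (F n) \<and> F n \<subseteq> A \<and> M (block (- F n) f) < 1 / real (Suc n)" by (rule exE)
  show ?thesis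
  proof (intro exI[of _ "\<Union>n. F n"] conjI ballI impI)
    show "countable (\<Union>n. F n)" using F by (simp add: countable_finite)
    show "(\<Union>n. F n) \<subseteq> A" using F by blast
    fix \<phi> \<psi> assume \<phi>: "\<phi> \<in> dual_space X M" and \<psi>: "\<psi> \<in> dual_space X M"
      and eq: "agree (\<Union>n. F n) \<phi> \<psi>"
    let ?c = "dual_norm X M \<phi> + dual_norm X M \<psi>"
    have "\<bar>\<phi> f - \<psi> f\<bar> \<le> ?c * (1 / real (Suc n))" for n
    proof -
      let ?r = "block (- F n) f"
      have r: "?r \<in> X" by (rule block_in[OF f])
      have "\<phi> (coord \<alpha> (f \<alpha>)) = \<psi> (coord \<alpha> (f \<alpha>))" if "\<alpha> \<in> F n" for \<alpha>
        using eq in_summand[OF f, of \<alpha>] F that unfolding agree_def by blast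
      then have "\<phi> (block (F n) f) = \<psi> (block (F n) f)"
        using F by (simp add: dual_block_finite[OF \<phi> f] dual_block_finite[OF \<psi> f])
      then have "\<phi> f - \<psi> f = \<phi> ?r - \<psi> ?r"
        using dual_block_split[OF \<phi> f, of "F n"] dual_block_split[OF \<psi> f, of "F n"] by simp
      also have "\<bar>\<dots>\<bar> \<le> \<bar>\<phi> ?r\<bar> + \<bar>\<psi> ?r\<bar>" by (rule abs_triangle_ineq4)
      also have "\<dots> \<le> ?c * M ?r"
        using abs_le_dual_norm[OF normed \<phi> r] abs_le_dual_norm[OF normed \<psi> r]
        by (simp add: distrib_right)
      also have "\<dots> \<le> ?c * (1 / real (Suc n))"
        using F dual_norm_nonneg[OF normed \<phi>] dual_norm_nonneg[OF normed \<psi>]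
        by (intro mult_left_mono) (auto simp: less_imp_le)
      finally show ?thesis .
    qed
    moreover have "(\<lambda>n. ?c * (1 / real (Suc n))) \<longlonglongrightarrow> 0"
      using tendsto_mult[OF tendsto_const[of ?c] LIMSEQ_inverse_real_of_nat]
      by (simp add: inverse_eq_divide)
    ultimately have "\<bar>\<phi> f - \<psi> f\<bar> \<le> 0"
      by (intro LIMSEQ_le_const) auto
    then show "\<phi> f = \<psi> f" by simp
  qed
qed

lemma agree_imp_eq:
  assumes "\<phi> \<in> dual_space X M" "\<psi> \<in> dual_space X M" "agree A \<phi> \<psi>"
  shows "\<phi> = \<psi>"
proof (rule extensionalityI)
  show "\<phi> \<in> extensional X" "\<psi> \<in> extensional X"
    using assms by (auto simp: dual_space_def)
  fix f assume "f \<in> X"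
  from countably_many_coordinates[OF this] show "\<phi> f = \<psi> f"
    using assms agree_mono by blast
qed

text \<open>The adjoint of the block projection. Applying \<open>restrict\<close> keeps the
  canonical form of a functional, so that parts of functionals can be compared by equality of
  functions.\<close>

definition restr :: "'i set \<Rightarrow> (('i \<Rightarrow> 'b) \<Rightarrow> real) \<Rightarrow> ('i \<Rightarrow> 'b) \<Rightarrow> real" where
  "restr B \<phi> = restrict (\<lambda>f. \<phi> (block B f)) X"

lemma restr_apply: "f \<in> X \<Longrightarrow> restr B \<phi> f = \<phi> (block B f)"
  by (simp add: restr_def)

lemma abs_restr_le:
  assumes \<phi>: "\<phi> \<in> dual_space X M" and f: "f \<in> X"
  shows "\<bar>restr B \<phi> f\<bar> \<le> dual_norm X M \<phi> * M f"
proof -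
  have "\<bar>restr B \<phi> f\<bar> \<le> dual_norm X M \<phi> * M (block B f)"
    using abs_le_dual_norm[OF normed \<phi> block_in[OF f]] by (simp add: restr_apply f)
  also have "\<dots> \<le> dual_norm X M \<phi> * M f"
    using norm_block_le[OF f] dual_norm_nonneg[OF normed \<phi>] by (rule mult_left_mono)
  finally show ?thesis .
qed

lemma restr_in:
  assumes "\<phi> \<in> dual_space X M"
  shows "restr B \<phi> \<in> dual_space X M"
proof (rule dual_spaceI[OF normed])
  show "restr B \<phi> \<in> extensional X" by (simp add: restr_def)
qed (use abs_restr_le[OF assms] in \<open>simp_all add: restr_apply block_in block_add block_scaleR
    subspace_add[OF X_subspace] subspace_scale[OF X_subspace] dual_plus[OF assms] dual_scaleR[OF assms]\<close>)

lemma restr_coord: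
  assumes "\<phi> \<in> dual_space X M" "\<alpha> \<in> A" "v \<in> V \<alpha>"
  shows "restr B \<phi> (coord \<alpha> v) = (if \<alpha> \<in> B then \<phi> (coord \<alpha> v) else 0)"
  using assms by (simp add: restr_apply coord_in block_coord dual_zero)

lemma agree_imp_restr_eq:
  assumes "\<phi> \<in> dual_space X M" "\<psi> \<in> dual_space X M" "agree B \<phi> \<psi>"
  shows "restr B \<phi> = restr B \<psi>"
proof (rule agree_imp_eq)
  show "agree A (restr B \<phi>) (restr B \<psi>)"
    using assms by (auto simp: agree_def restr_coord)
qed (use assms in \<open>auto intro: restr_in\<close>)

lemma restr_eq_self:
  assumes "\<phi> \<in> dual_space X M" "\<And>\<alpha> v. \<alpha> \<in> A \<Longrightarrow> \<alpha> \<notin> B \<Longrightarrow> v \<in> V \<alpha> \<Longrightarrow> \<phi> (coord \<alpha> v) = 0"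
  shows "restr B \<phi> = \<phi>"
proof (rule agree_imp_eq)
  show "agree A (restr B \<phi>) \<phi>"
    using assms by (auto simp: agree_def restr_coord)
qed (use assms in \<open>auto intro: restr_in\<close>)

text \<open>A larger \<open>B\<close> gives a smaller relation, hence a higher quotient. Unions of
  index sets give intersections of relations, hence suprema.\<close>

definition coord_rel :: "'i set \<Rightarrow> ((('i \<Rightarrow> 'b) \<Rightarrow> real) \<times> (('i \<Rightarrow> 'b) \<Rightarrow> real)) set" where
  "coord_rel B = {(\<phi>, \<psi>) \<in> topspace K \<times> topspace K. agree B \<phi> \<psi>}"

lemma coord_rel_iff:
  "(\<phi>, \<psi>) \<in> coord_rel B \<longleftrightarrow> \<phi> \<in> dual_ball X M \<and> \<psi> \<in> dual_ball X M \<and> agree B \<phi> \<psi>"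
  by (simp add: coord_rel_def topspace_K)

text \<open>Members of the ball are 1-Lipschitz for \<open>M\<close>, so agreement passes from a
  dense subset of a summand to the whole summand.\<close>

lemma agree_dense:
  assumes \<phi>: "\<phi> \<in> dual_ball X M" "\<psi> \<in> dual_ball X M" and \<alpha>: "\<alpha> \<in> A" and D: "D \<subseteq> V \<alpha>"
    and dense: "\<And>v e. v \<in> V \<alpha> \<Longrightarrow> 0 < e \<Longrightarrow> \<exists>d\<in>D. N \<alpha> (v - d) < e"
    and eq: "\<And>d. d \<in> D \<Longrightarrow> \<phi> (coord \<alpha> d) = \<psi> (coord \<alpha> d)" and v: "v \<in> V \<alpha>"
  shows "\<phi> (coord \<alpha> v) = \<psi> (coord \<alpha> v)"
proof -
  have "\<bar>\<phi> (coord \<alpha> v) - \<psi> (coord \<alpha> v)\<bar> \<le> 0 + e" if e: "0 < e" for e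
  proof -
    obtain d where d: "d \<in> D" "N \<alpha> (v - d) < e / 2"
      using dense[OF v half_gt_zero[OF e]] by blast
    have dV: "d \<in> V \<alpha>" using d D by blast
    have in_X: "coord \<alpha> (v - d) \<in> X"
      using subspace_diff[OF normed_space_on_subspace[OF summand[OF \<alpha>]] v dV] by (rule coord_in[OF \<alpha>])
    have "\<bar>\<theta> (coord \<alpha> v) - \<theta> (coord \<alpha> d)\<bar> < e / 2" if "\<theta> \<in> dual_ball X M" for \<theta>
    proof -
      have "\<bar>\<theta> (coord \<alpha> (v - d))\<bar> \<le> M (coord \<alpha> (v - d))"
        using that in_X by (simp add: dual_ball_iff[OF normed])
      also have "\<dots> < e / 2"
        using d subspace_diff[OF normed_space_on_subspace[OF summand[OF \<alpha>]] v dV]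
        by (simp add: norm_coord[OF \<alpha>])
      finally show ?thesis
        using dual_diff[OF dual_ball_subset[OF that] coord_in[OF \<alpha> v] coord_in[OF \<alpha> dV]]
        by (simp add: coord_diff)
    qed
    from this[OF \<phi>(1)] this[OF \<phi>(2)] eq[OF d(1)] show ?thesis by linarith
  qed
  then have "\<bar>\<phi> (coord \<alpha> v) - \<psi> (coord \<alpha> v)\<bar> \<le> 0" by (rule field_le_epsilon)
  then show ?thesis by simp
qed

text \<open>Evaluation at countably many vectors, dense in the summands indexed by \<open>B\<close>,
  maps \<open>K\<close> into a countable power of the reals, and the kernel of this map is
  \<open>coord_rel B\<close>.\<close>

lemma coord_rel_countable_weight:
  assumes B: "countable B" "B \<subseteq> A"
  shows "coord_rel B \<in> countable_weight_quotients K"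
proof -
  have "\<forall>\<alpha>\<in>A. \<exists>D. countable D \<and> D \<subseteq> V \<alpha> \<and> (\<forall>v\<in>V \<alpha>. \<forall>e>0. \<exists>d\<in>D. N \<alpha> (v - d) < e)"
    using separable summand by (simp add: separable_on_iff_dense)
  from bchoice[OF this] obtain D where D: "\<forall>\<alpha>\<in>A. countable (D \<alpha>) \<and> D \<alpha> \<subseteq> V \<alpha> \<and>
      (\<forall>v\<in>V \<alpha>. \<forall>e>0. \<exists>d\<in>D \<alpha>. N \<alpha> (v - d) < e)" by (rule exE)
  \<comment> \<open>The vector \<open>0\<close> makes \<open>J\<close> nonempty, as its enumeration
    requires, and separates nothing, since functionals vanish there.\<close>
  define J where "J = insert 0 (\<Union>\<alpha>\<in>B. coord \<alpha> ` D \<alpha>)"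
  have J: "countable J" "J \<noteq> {}" "J \<subseteq> X"
    using B D zero_in_sum coord_in unfolding J_def by (auto simp: subset_iff)
  define g where "g \<phi> n = \<phi> (from_nat_into J n)" for \<phi> :: "('i \<Rightarrow> 'b) \<Rightarrow> real" and n :: nat
  have g_eq: "g \<phi> = g \<psi> \<longleftrightarrow> agree B \<phi> \<psi>" if "\<phi> \<in> dual_ball X M" "\<psi> \<in> dual_ball X M" for \<phi> \<psi>
  proof -
    have "g \<phi> = g \<psi> \<longleftrightarrow> (\<forall>n. \<phi> (from_nat_into J n) = \<psi> (from_nat_into J n))"
      by (simp add: g_def fun_eq_iff)
    also have "\<dots> \<longleftrightarrow> (\<forall>j\<in>range (from_nat_into J). \<phi> j = \<psi> j)" by simp
    also have "\<dots> \<longleftrightarrow> (\<forall>j\<in>J. \<phi> j = \<psi> j)"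
      by (simp only: range_from_nat_into[OF J(2,1)])
    also have "\<dots> \<longleftrightarrow> (\<forall>\<alpha>\<in>B. \<forall>d\<in>D \<alpha>. \<phi> (coord \<alpha> d) = \<psi> (coord \<alpha> d))"
    proof -
      have "\<phi> 0 = \<psi> 0" using that by (simp only: dual_zero[OF dual_ball_subset])
      then show ?thesis unfolding J_def by blast
    qed
    also have "\<dots> \<longleftrightarrow> agree B \<phi> \<psi>"
    proof
      assume *: "\<forall>\<alpha>\<in>B. \<forall>d\<in>D \<alpha>. \<phi> (coord \<alpha> d) = \<psi> (coord \<alpha> d)"
      show "agree B \<phi> \<psi>"
        unfolding agree_def
      proof (intro ballI)
        fix \<alpha> v assume \<alpha>: "\<alpha> \<in> B" and v: "v \<in> V \<alpha>"
        then have \<alpha>A: "\<alpha> \<in> A" using B(2) by blast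
        show "\<phi> (coord \<alpha> v) = \<psi> (coord \<alpha> v)"
        proof (rule agree_dense[OF that \<alpha>A _ _ _ v])
          show "D \<alpha> \<subseteq> V \<alpha>" using D \<alpha>A by blast
          show "\<exists>d\<in>D \<alpha>. N \<alpha> (w - d) < e" if "w \<in> V \<alpha>" "0 < e" for w e
            using bspec[OF D \<alpha>A] that by blast
          show "\<phi> (coord \<alpha> d) = \<psi> (coord \<alpha> d)" if "d \<in> D \<alpha>" for d
            using * \<alpha> that by blast
        qed
      qed
    next
      assume "agree B \<phi> \<psi>"
      then show "\<forall>\<alpha>\<in>B. \<forall>d\<in>D \<alpha>. \<phi> (coord \<alpha> d) = \<psi> (coord \<alpha> d)"
        using D B unfolding agree_def by blast
    qed
    finally show ?thesis .
  qed
  have "continuous_map K (euclidean :: (nat \<Rightarrow> real) topology) g"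
    unfolding euclidean_product_topology[symmetric] continuous_map_componentwise_UNIV
  proof
    fix n
    have "from_nat_into J n \<in> X" using from_nat_into[OF J(2)] J(3) by blast
    then show "continuous_map K euclidean (\<lambda>\<phi>. g \<phi> n)"
      unfolding g_def by (rule continuous_map_weak_star_eval[OF normed])
  qed
  moreover have "coord_rel B = {(\<phi>, \<psi>) \<in> topspace K \<times> topspace K. g \<phi> = g \<psi>}"
    using g_eq by (auto simp: coord_rel_def topspace_K)
  ultimately show ?thesis
    by (rule countable_weight_quotients_kernel[OF compact_weak_star_ball[OF normed]
          Hausdorff_space_euclidean second_countable_euclidean])
qed

text \<open>Two countability statements are composed: a quotient of countable weight is controlled
  by countably many vectors, and each vector by countably many coordinates.\<close>

lemma coord_rel_cofinal:
  assumes "E \<in> countable_weight_quotients K"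
  obtains B where "countable B" "B \<subseteq> A" "coord_rel B \<subseteq> E"
proof -
  obtain J where J: "countable J" "J \<subseteq> X"
    "\<And>\<phi> \<psi>. \<phi> \<in> topspace K \<Longrightarrow> \<psi> \<in> topspace K \<Longrightarrow> (\<forall>f\<in>J. \<phi> f = \<psi> f) \<Longrightarrow> (\<phi>, \<psi>) \<in> E"
  proof (rule countable_weight_quotient_countable_coordinates[of K X "\<lambda>f \<phi>. \<phi> f" E])
    show "compact_space K" by (rule compact_weak_star_ball[OF normed])
    show "continuous_map K euclideanreal (\<lambda>\<phi>. \<phi> f)" if "f \<in> X" for f
      using that by (rule continuous_map_weak_star_eval[OF normed])
    show "\<exists>f\<in>X. \<phi> f \<noteq> \<psi> f" if "\<phi> \<in> topspace K" "\<psi> \<in> topspace K" "\<phi> \<noteq> \<psi>" for \<phi> \<psi>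
    proof (rule ccontr)
      assume "\<not> (\<exists>f\<in>X. \<phi> f \<noteq> \<psi> f)"
      then have "\<phi> = \<psi>"
        using that by (intro extensionalityI[of _ X]) (auto simp: topspace_K dual_ball_iff[OF normed])
      then show False using that(3) by simp
    qed
  qed (use assms in auto)
  from countably_many_coordinates have "\<forall>f\<in>X. \<exists>B. countable B \<and> B \<subseteq> A \<and>
    (\<forall>\<phi>\<in>dual_space X M. \<forall>\<psi>\<in>dual_space X M. agree B \<phi> \<psi> \<longrightarrow> \<phi> f = \<psi> f)" by blast
  from bchoice[OF this] obtain B where B: "\<forall>f\<in>X. countable (B f) \<and> B f \<subseteq> A \<and>
    (\<forall>\<phi>\<in>dual_space X M. \<forall>\<psi>\<in>dual_space X M. agree (B f) \<phi> \<psi> \<longrightarrow> \<phi> f = \<psi> f)" by (rule exE)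
  show ?thesis
  proof
    show "countable (\<Union>f\<in>J. B f)" using B J by (simp add: subset_iff)
    show "(\<Union>f\<in>J. B f) \<subseteq> A" using B J by blast
    show "coord_rel (\<Union>f\<in>J. B f) \<subseteq> E"
    proof (rule subrelI)
      fix \<phi> \<psi> assume *: "(\<phi>, \<psi>) \<in> coord_rel (\<Union>f\<in>J. B f)"
      have "\<phi> f = \<psi> f" if "f \<in> J" for f
      proof -
        have "agree (B f) \<phi> \<psi>"
          using * that by (auto simp: coord_rel_iff intro: agree_mono)
        then show ?thesis
          using * that B J(2) dual_ball_subset by (auto simp: coord_rel_iff)
      qed
      then show "(\<phi>, \<psi>) \<in> E"
        using * by (intro J(3)) (auto simp: coord_rel_iff topspace_K)
    qed
  qed
qed

section \<open>Consequences of having uncountably many nonzero summands\<close>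

lemma index_outside_countable:
  assumes "countable B"
  obtains \<gamma> where "\<gamma> \<in> A" "\<gamma> \<notin> B" "V \<gamma> \<noteq> {0}"
proof -
  have "\<not> {\<alpha> \<in> A. V \<alpha> \<noteq> {0}} \<subseteq> B"
    using uncountable_index countable_subset[OF _ assms] by (rule contrapos_nn)
  then obtain \<gamma> where "\<gamma> \<in> {\<alpha> \<in> A. V \<alpha> \<noteq> {0}}" "\<gamma> \<notin> B"
    unfolding subset_iff by meson
  then show ?thesis by (intro that[of \<gamma>]) simp_all
qed

lemma unit_vector:
  assumes "\<gamma> \<in> A" "V \<gamma> \<noteq> {0}"
  obtains v where "v \<in> V \<gamma>" "N \<gamma> v = 1"
proof -
  note n = summand[OF assms(1)]
  obtain w where w: "w \<in> V \<gamma>" "w \<noteq> 0"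
    using assms(2) subspace_0[OF normed_space_on_subspace[OF n]] by blast
  then have "N \<gamma> w > 0"
    using normed_space_on_nonneg[OF n] normed_space_on_eq_0[OF n] by fastforce
  then have "N \<gamma> ((1 / N \<gamma> w) *\<^sub>R w) = 1"
    using w by (simp add: normed_space_on_scale[OF n])
  then show ?thesis
    using w that subspace_scale[OF normed_space_on_subspace[OF n]] by blast
qed

text \<open>A norming functional of the summand, read off at the coordinate \<open>\<gamma>\<close>.
  Projecting onto one coordinate does not increase the norm, so it lies in the ball. It is the probe
  that a relation ignoring \<open>\<gamma>\<close> cannot detect.\<close>

lemma unit_functional:
  assumes \<gamma>: "\<gamma> \<in> A" "V \<gamma> \<noteq> {0}"
  obtains v \<epsilon> where "v \<in> V \<gamma>" "N \<gamma> v = 1" "\<epsilon> \<in> dual_ball X M" "\<epsilon> (coord \<gamma> v) = 1"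
    "\<And>\<alpha> w. \<alpha> \<in> A \<Longrightarrow> \<alpha> \<noteq> \<gamma> \<Longrightarrow> w \<in> V \<alpha> \<Longrightarrow> \<epsilon> (coord \<alpha> w) = 0"
proof -
  note n = summand[OF \<gamma>(1)]
  obtain v where v: "v \<in> V \<gamma>" "N \<gamma> v = 1" by (rule unit_vector[OF \<gamma>])
  obtain \<phi> where \<phi>: "\<And>x y. x \<in> V \<gamma> \<Longrightarrow> y \<in> V \<gamma> \<Longrightarrow> \<phi> (x + y) = \<phi> x + \<phi> y"
    "\<And>x c. x \<in> V \<gamma> \<Longrightarrow> \<phi> (c *\<^sub>R x) = c * \<phi> x"
    "\<And>x. x \<in> V \<gamma> \<Longrightarrow> \<bar>\<phi> x\<bar> \<le> N \<gamma> x" "\<phi> v = N \<gamma> v"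
    by (rule norming_functional[OF n v(1)]) (rule that)
  define \<epsilon> where "\<epsilon> = restrict (\<lambda>f. \<phi> (f \<gamma>)) X"
  have "\<epsilon> \<in> dual_ball X M"
    unfolding dual_ball_iff[OF normed]
  proof (intro conjI ballI allI)
    fix f assume f: "f \<in> X"
    have "\<bar>\<phi> (f \<gamma>)\<bar> \<le> N \<gamma> (f \<gamma>)" using \<phi>(3) in_summand f \<gamma> by blast
    also have "\<dots> = M (block {\<gamma>} f)"
      using norm_coord in_summand f \<gamma> by (simp add: block_singleton)
    also have "\<dots> \<le> M f" by (rule norm_block_le[OF f])
    finally show "\<bar>\<epsilon> f\<bar> \<le> M f" using f by (simp add: \<epsilon>_def)
  next
    show "\<epsilon> (c *\<^sub>R f) = c * \<epsilon> f" if "f \<in> X" for c f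
      using that subspace_scale[OF X_subspace that, of c] \<phi>(2) in_summand \<gamma>(1)
      by (simp add: \<epsilon>_def) (simp add: scaleR_fun_def)
  qed (use \<gamma> in_summand \<phi> in \<open>simp_all add: \<epsilon>_def subspace_add[OF X_subspace]\<close>)
  moreover have "\<epsilon> (coord \<alpha> w) = 0" if "\<alpha> \<in> A" "\<alpha> \<noteq> \<gamma>" "w \<in> V \<alpha>" for \<alpha> w
    using \<phi>(2)[OF subspace_0[OF normed_space_on_subspace[OF n]], of 0] coord_in[OF that(1,3)] that(2)
    by (simp add: \<epsilon>_def) (simp add: coord_def)
  moreover have "\<epsilon> (coord \<gamma> v) = 1"
    using coord_in[OF \<gamma>(1) v(1)] \<phi>(4) v(2) by (simp add: \<epsilon>_def) (simp add: coord_def)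
  ultimately show ?thesis using v by (intro that)
qed

lemma zero_in_dual_ball: "restrict (\<lambda>_. 0) X \<in> dual_ball X M"
  using normed_space_on_nonneg[OF normed] subspace_add[OF X_subspace] subspace_scale[OF X_subspace]
  by (simp add: dual_ball_iff[OF normed])

text \<open>Countable weight would make the identity relation contain some
  \<open>coord_rel B\<close> with \<open>B\<close> countable, but a unit functional at an index
  outside \<open>B\<close> agrees with zero on \<open>B\<close>.\<close>

lemma not_second_countable_K: "\<not> second_countable K"
proof
  assume "second_countable K"
  then have "Id_on (topspace K) \<in> countable_weight_quotients K"
    using Hausdorff_weak_star_ball[OF normed] by (intro Id_on_countable_weight_quotients)
  then obtain B where B: "countable B" "B \<subseteq> A" "coord_rel B \<subseteq> Id_on (topspace K)"
    by (rule coord_rel_cofinal)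
  obtain \<gamma> where \<gamma>: "\<gamma> \<in> A" "\<gamma> \<notin> B" "V \<gamma> \<noteq> {0}"
    using index_outside_countable[OF B(1)] .
  obtain v \<epsilon> where \<epsilon>: "v \<in> V \<gamma>" "N \<gamma> v = 1" "\<epsilon> \<in> dual_ball X M" "\<epsilon> (coord \<gamma> v) = 1"
    "\<And>\<alpha> w. \<alpha> \<in> A \<Longrightarrow> \<alpha> \<noteq> \<gamma> \<Longrightarrow> w \<in> V \<alpha> \<Longrightarrow> \<epsilon> (coord \<alpha> w) = 0"
    by (rule unit_functional[OF \<gamma>(1,3)]) (rule that)
  have "(\<epsilon>, restrict (\<lambda>_. 0) X) \<in> coord_rel B"
    unfolding coord_rel_iff agree_def
  proof (intro conjI ballI)
    fix \<alpha> w assume "\<alpha> \<in> B" "w \<in> V \<alpha>"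
    then have *: "\<alpha> \<in> A" "\<alpha> \<noteq> \<gamma>" using B(2) \<gamma>(2) by auto
    then show "\<epsilon> (coord \<alpha> w) = restrict (\<lambda>_. 0) X (coord \<alpha> w)"
      using coord_in[OF *(1)] \<epsilon>(5)[OF *] \<open>w \<in> V \<alpha>\<close> by simp
  qed (use \<epsilon>(3) zero_in_dual_ball in auto)
  then have "\<epsilon> = restrict (\<lambda>_. 0) X" using B(3) by auto
  then show False using \<epsilon>(4) coord_in[OF \<gamma>(1) \<epsilon>(1)] by simp
qed

text \<open>Unit vectors in different summands are at distance at least one, because a block
  projection recovers one of them from the difference. Approximants within \<open>1 / 2\<close> are
  then distinct, so a dense set cannot be countable.\<close>

lemma not_separable: "\<not> separable_on X M"
proof
  assume "separable_on X M"
  then obtain D where D: "countable D" "D \<subseteq> X" "\<forall>x\<in>X. \<forall>e>0. \<exists>d\<in>D. M (x - d) < e"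
    unfolding separable_on_iff_dense[OF normed] by blast
  let ?I = "{\<alpha> \<in> A. V \<alpha> \<noteq> {0}}"
  have "\<forall>\<alpha>\<in>?I. \<exists>d. d \<in> D \<and> (\<exists>v\<in>V \<alpha>. N \<alpha> v = 1 \<and> M (coord \<alpha> v - d) < 1 / 2)"
  proof
    fix \<alpha> assume "\<alpha> \<in> ?I"
    then obtain v where "v \<in> V \<alpha>" "N \<alpha> v = 1" using unit_vector[of \<alpha>] by blast
    moreover have "coord \<alpha> v \<in> X" using coord_in \<open>\<alpha> \<in> ?I\<close> \<open>v \<in> V \<alpha>\<close> by blast
    ultimately show "\<exists>d. d \<in> D \<and> (\<exists>v\<in>V \<alpha>. N \<alpha> v = 1 \<and> M (coord \<alpha> v - d) < 1 / 2)"
      using D(3)[rule_format, of "coord \<alpha> v" "1 / 2"] by auto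
  qed
  from bchoice[OF this] obtain d where d: "\<forall>\<alpha>\<in>?I. d \<alpha> \<in> D \<and>
      (\<exists>v\<in>V \<alpha>. N \<alpha> v = 1 \<and> M (coord \<alpha> v - d \<alpha>) < 1 / 2)" by (rule exE)
  have "inj_on d ?I"
  proof (rule inj_onI)
    fix \<alpha> \<beta> assume *: "\<alpha> \<in> ?I" "\<beta> \<in> ?I" "d \<alpha> = d \<beta>"
    obtain v where v: "v \<in> V \<alpha>" "N \<alpha> v = 1" "M (coord \<alpha> v - d \<alpha>) < 1 / 2" using d * by blast
    obtain w where w: "w \<in> V \<beta>" "N \<beta> w = 1" "M (coord \<beta> w - d \<alpha>) < 1 / 2" using d * by auto
    have X: "coord \<alpha> v \<in> X" "coord \<beta> w \<in> X" "d \<alpha> \<in> X" using coord_in v w * d D(2) by auto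
    note diff = subspace_diff[OF X_subspace]
    show "\<alpha> = \<beta>"
    proof (rule ccontr)
      assume "\<alpha> \<noteq> \<beta>"
      then have "block {\<alpha>} (coord \<alpha> v - coord \<beta> w) = coord \<alpha> v"
        by (auto simp: block_def coord_def fun_eq_iff)
      then have "1 \<le> M (coord \<alpha> v - coord \<beta> w)"
        using norm_block_le[OF diff[OF X(1,2)], of "{\<alpha>}"] norm_coord[of \<alpha> v] v * by simp
      also have "\<dots> = M ((coord \<alpha> v - d \<alpha>) + (d \<alpha> - coord \<beta> w))" by simp
      also have "\<dots> \<le> M (coord \<alpha> v - d \<alpha>) + M (d \<alpha> - coord \<beta> w)"
        using X by (intro normed_space_on_triangle[OF normed] diff)
      also have "\<dots> < 1"
        using v(3) w(3) normed_space_on_diff_commute[OF normed X(2,3)] by simp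
      finally show False by simp
    qed
  qed
  moreover have "countable (d ` ?I)" using d D(1) by (meson countable_subset image_subsetI)
  ultimately have "countable ?I" by (rule countable_image_inj_on[rotated])
  then show False using uncountable_index by blast
qed

text \<open>Reduces fiber convergence to lifting problems in \<open>K\<close> for a freely chosen
  family of index sets. Hypothesis \<open>union\<close>, taken at the empty family, puts
  \<open>{}\<close> into \<open>\<B>\<close>, since the supremum of no quotients must belong to the
  semilattice.\<close>

lemma fiber_convergentI:
  assumes x: "\<And>n. x n \<in> dual_ball X M" "limitin K x l sequentially"
    and \<B>: "\<And>B. B \<in> \<B> \<Longrightarrow> countable B \<and> B \<subseteq> A"
    and union: "\<And>\<C>. countable \<C> \<Longrightarrow> \<C> \<subseteq> \<B> \<Longrightarrow> \<Union>\<C> \<in> \<B>"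
    and cofinal: "\<And>B. countable B \<Longrightarrow> B \<subseteq> A \<Longrightarrow> \<exists>C\<in>\<B>. B \<subseteq> C"
    and lift: "\<And>B y. B \<in> \<B> \<Longrightarrow> y \<in> dual_ball X M \<Longrightarrow> agree B y l \<Longrightarrow>
      \<exists>z. (\<forall>n. z n \<in> dual_ball X M \<and> agree B (z n) (x n)) \<and> limitin K z y sequentially"
  shows "fiber_convergent K x l"
proof -
  let ?S = "coord_rel ` \<B>"
  have S: "?S \<subseteq> countable_weight_quotients K"
    using coord_rel_countable_weight \<B> by blast
  then have SH: "?S \<subseteq> hausdorff_quotients K"
    by (auto simp: countable_weight_quotients_def)
  have eq: "equiv (topspace K) L" if "L \<in> hausdorff_quotients K" for L
    using that by (simp add: hausdorff_quotients_def)
  have "cofinal_quotients K ?S"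
    unfolding cofinal_quotients_def
  proof
    fix L assume L: "L \<in> countable_weight_quotients K"
    obtain B where B: "countable B" "B \<subseteq> A" "coord_rel B \<subseteq> L" using coord_rel_cofinal[OF L] .
    obtain C where C: "C \<in> \<B>" "B \<subseteq> C" using cofinal[OF B(1,2)] by blast
    have "coord_rel C \<subseteq> L"
    proof (rule order_trans[OF _ B(3)])
      show "coord_rel C \<subseteq> coord_rel B"
        using agree_mono[OF _ C(2)] by (auto simp: coord_rel_def)
    qed
    moreover have "L \<in> hausdorff_quotients K" using L by (simp add: countable_weight_quotients_def)
    ultimately have "quotient_le K L (coord_rel C)"
      using C(1) SH by (subst quotient_le_iff_superset) (auto intro: eq)
    then show "\<exists>L'\<in>?S. quotient_le K L L'" using C(1) by blast
  qed
  moreover have "sigma_semilattice K ?S"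
    unfolding sigma_semilattice_def
  proof (intro allI impI)
    fix \<C> assume *: "\<C> \<subseteq> ?S \<and> countable \<C>"
    \<comment> \<open>Choosing countably many index sets for \<open>\<C>\<close> turns the
      intersection of its relations into the relation of one union.\<close>
    then obtain \<D> where \<D>: "\<D> \<subseteq> \<B>" "countable \<D>" "\<C> = coord_rel ` \<D>"
      by (meson countable_subset_image)
    have "\<Union>\<D> \<in> \<B>" using union \<D> by blast
    moreover have "is_quotient_sup K \<C> (coord_rel (\<Union>\<D>))"
    proof (rule is_quotient_sup_Inter)
      show "\<C> \<subseteq> hausdorff_quotients K" using * SH by blast
      show "coord_rel (\<Union>\<D>) \<in> hausdorff_quotients K" using SH \<open>\<Union>\<D> \<in> \<B>\<close> by blast
      show "coord_rel (\<Union>\<D>) = topspace K \<times> topspace K \<inter> \<Inter>\<C>"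
        unfolding \<D>(3) coord_rel_def agree_def by blast
    qed
    ultimately show "\<exists>L\<in>?S. is_quotient_sup K \<C> L" by blast
  qed
  moreover have "map_fiber_convergent (quotient_topology K L) (quotient_topology K L') \<pi>
      (\<lambda>n. quotient_proj L' (x n)) (quotient_proj L' l)"
    if L: "L \<in> ?S" "L' \<in> ?S" and \<pi>: "natural_projection K L L' \<pi>" for L L' \<pi>
  proof (rule map_fiber_convergent_quotients[OF _ _ \<pi>])
    show "equiv (topspace K) L" "equiv (topspace K) L'" using L SH eq by blast+
    show "x n \<in> topspace K" for n using x(1) by (simp add: topspace_K)
    fix y assume "(y, l) \<in> L'"
    moreover obtain B where B: "B \<in> \<B>" "L' = coord_rel B" using L by blast
    ultimately have "y \<in> dual_ball X M" "agree B y l" by (auto simp: coord_rel_iff)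
    from lift[OF B(1) this] show "\<exists>z. (\<forall>n. (z n, x n) \<in> L') \<and> limitin K z y sequentially"
      using x(1) by (auto simp: B(2) coord_rel_iff)
  qed (rule x(2))
  ultimately show ?thesis
    unfolding fiber_convergent_def
    using compact_weak_star_ball[OF normed] Hausdorff_weak_star_ball[OF normed]
      not_second_countable_K x S topspace_K
    by (intro conjI exI[of _ ?S]) auto
qed

text \<open>Hypothesis \<open>sum\<close> makes the dual norm the maximum over two complementary
  blocks, so parts of two members of the ball can be glued without leaving it.\<close>

lemma fiber_convergent_sum_norm:
  assumes sum: "\<And>f B. f \<in> X \<Longrightarrow> M (block B f) + M (block (- B) f) \<le> M f"
    and x: "\<And>n. x n \<in> dual_ball X M" "limitin K x l sequentially"
  shows "fiber_convergent K x l"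
proof (rule fiber_convergentI[OF x, of "{B. countable B \<and> B \<subseteq> A}"])
  have lim: "l \<in> dual_ball X M" "\<And>f. f \<in> X \<Longrightarrow> (\<lambda>n. x n f) \<longlonglongrightarrow> l f"
    using x(2) limitin_weak_star_ball[OF normed x(1)] by auto
  fix B y assume B: "B \<in> {B. countable B \<and> B \<subseteq> A}" and y: "y \<in> dual_ball X M" "agree B y l"
  define z where "z n = restrict (\<lambda>f. 1 * restr B (x n) f + 1 * restr (- B) y f) X" for n
  have zf: "z n f = x n (block B f) + y (block (- B) f)" if "f \<in> X" for n f
    using that by (simp add: z_def restr_apply)
  have z_dual: "z n \<in> dual_space X M" for n
    unfolding z_def using x(1) y(1)
    by (intro dual_space_combination[OF normed] restr_in dual_ball_subset)
  have z: "z n \<in> dual_ball X M" for n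
  proof -
    have "\<bar>z n f\<bar> \<le> M f" if "f \<in> X" for f
    proof -
      have "\<bar>x n (block B f)\<bar> \<le> M (block B f)" "\<bar>y (block (- B) f)\<bar> \<le> M (block (- B) f)"
        using x(1) y(1) block_in[OF that] by (simp_all add: dual_ball_iff[OF normed])
      then show ?thesis using sum[OF that, of B] by (simp add: zf[OF that])
    qed
    then show ?thesis
      using z_dual[of n] by (simp add: dual_ball_iff[OF normed] dual_space_def)
  qed
  show "\<exists>z. (\<forall>n. z n \<in> dual_ball X M \<and> agree B (z n) (x n)) \<and> limitin K z y sequentially"
  proof (intro exI[of _ z] conjI allI)
    show "z n \<in> dual_ball X M" for n by (rule z)
    show "agree B (z n) (x n)" for n
      unfolding agree_def
    proof (intro ballI)
      fix \<alpha> v assume "\<alpha> \<in> B" "v \<in> V \<alpha>"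
      then have "coord \<alpha> v \<in> X" using B coord_in by blast
      then show "z n (coord \<alpha> v) = x n (coord \<alpha> v)"
        using \<open>\<alpha> \<in> B\<close> dual_zero[OF dual_ball_subset[OF y(1)]] by (simp add: zf block_coord)
    qed
    have "(\<lambda>n. z n f) \<longlonglongrightarrow> y f" if f: "f \<in> X" for f
    proof -
      \<comment> \<open>On \<open>B\<close> the sequence tends to \<open>l\<close>, which agrees
        there with \<open>y\<close>; off \<open>B\<close> it equals \<open>y\<close>. So the glued
        sequence tends to \<open>y\<close>.\<close>
      have "restr B y f = restr B l f"
        using agree_imp_restr_eq[OF dual_ball_subset[OF y(1)] dual_ball_subset[OF lim(1)] y(2)] by simp
      then have "l (block B f) + y (block (- B) f) = y f"
        using dual_block_split[OF dual_ball_subset[OF y(1)] f, of B] f by (simp add: restr_apply)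
      moreover have "(\<lambda>n. z n f) \<longlonglongrightarrow> l (block B f) + y (block (- B) f)"
        unfolding zf[OF f] by (intro tendsto_add lim block_in f tendsto_const)
      ultimately show ?thesis by simp
    qed
    then show "limitin K z y sequentially"
      using y(1) limitin_weak_star_ball[OF normed, of z y] z by blast
  qed
next
  fix \<C> assume "countable \<C>" "\<C> \<subseteq> {B. countable B \<and> B \<subseteq> A}"
  then show "\<Union>\<C> \<in> {B. countable B \<and> B \<subseteq> A}"
    using countable_UN[of \<C> "\<lambda>B. B"] by (auto simp: subset_iff)
qed auto

end

section \<open>Sums with additive powers of the dual norm\<close>

context separable_sum
begin

abbreviation nrm :: "(('i \<Rightarrow> 'b) \<Rightarrow> real) \<Rightarrow> real" where
  "nrm \<equiv> dual_norm X M"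

lemma nrm_le:
  assumes "0 \<le> C" "\<And>f. f \<in> X \<Longrightarrow> \<bar>\<phi> f\<bar> \<le> C * M f"
  shows "nrm \<phi> \<le> C"
proof (rule dual_norm_le[OF normed])
  fix f assume f: "f \<in> X" "M f \<le> 1"
  have "\<bar>\<phi> f\<bar> \<le> C * M f" by (rule assms(2)[OF f(1)])
  also have "\<dots> \<le> C * 1" using f(2) assms(1) by (rule mult_left_mono)
  finally show "\<bar>\<phi> f\<bar> \<le> C" by simp
qed

lemmas nrm_nonneg = dual_norm_nonneg[OF normed]
lemmas abs_le_nrm = abs_le_dual_norm[OF normed]

lemma nrm_restr_le:
  assumes "\<phi> \<in> dual_space X M"
  shows "nrm (restr B \<phi>) \<le> nrm \<phi>"
  using nrm_nonneg[OF assms] abs_restr_le[OF assms] by (rule nrm_le)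

lemma restr_restr: "restr B (restr C \<phi>) = restr (B \<inter> C) \<phi>"
  by (rule extensionalityI[of _ X]) (simp_all add: restr_def block_in block_block Int_commute)

end

text \<open>The additivity is assumed for two complementary blocks only. Finite blocks and
  countability of supports are derived from it.\<close>

locale additive_dual_sum = separable_sum +
  fixes q :: real
  assumes q: "1 \<le> q"
    and complete: "banach_space_on X M"
    and dual_additive: "\<phi> \<in> dual_space X M \<Longrightarrow>
      dual_norm X M \<phi> powr q = dual_norm X M (restr B \<phi>) powr q + dual_norm X M (restr (- B) \<phi>) powr q"
begin

lemma sum_nrm_singletons:
  assumes \<phi>: "\<phi> \<in> dual_space X M" and F: "finite F"
  shows "(\<Sum>\<alpha>\<in>F. nrm (restr {\<alpha>} \<phi>) powr q) = nrm (restr F \<phi>) powr q"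
  using F
proof (induction F rule: finite_induct)
  case empty
  have "nrm (restr {} \<phi>) \<le> 0"
  proof (rule nrm_le)
    fix f assume "f \<in> X"
    moreover have "block {} f = 0" by (simp add: block_def fun_eq_iff)
    ultimately have "restr {} \<phi> f = 0" by (simp only: restr_apply dual_zero[OF \<phi>])
    then show "\<bar>restr {} \<phi> f\<bar> \<le> 0 * M f" by simp
  qed simp
  then have "nrm (restr {} \<phi>) = 0" using nrm_nonneg[OF restr_in[OF \<phi>], of "{}"] by simp
  then show ?case using q by simp
next
  case (insert \<alpha> F)
  \<comment> \<open>The hypothesis splits into complementary blocks, so it is applied at
    \<open>{\<alpha>}\<close> to the part on \<open>insert \<alpha> F\<close>.\<close>
  have "{\<alpha>} \<inter> insert \<alpha> F = {\<alpha>}" "- {\<alpha>} \<inter> insert \<alpha> F = F" using insert(2) by auto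
  then have "nrm (restr (insert \<alpha> F) \<phi>) powr q = nrm (restr {\<alpha>} \<phi>) powr q + nrm (restr F \<phi>) powr q"
    using dual_additive[OF restr_in[OF \<phi>], of "insert \<alpha> F" "{\<alpha>}"] by (simp only: restr_restr)
  then show ?case using insert by simp
qed

text \<open>All finite sums of the \<open>q\<close>-th powers of the coordinate norms are bounded by
  that of the whole functional, so only countably many coordinates are nonzero. Every
  \<open>C\<close> above the support is allowed, so that supports of several functionals can be
  merged.\<close>

lemma countable_support:
  assumes \<phi>: "\<phi> \<in> dual_space X M"
  shows "\<exists>B. countable B \<and> B \<subseteq> A \<and> (\<forall>C. B \<subseteq> C \<longrightarrow> restr C \<phi> = \<phi>)"
proof -
  let ?u = "\<lambda>\<alpha>. nrm (restr {\<alpha>} \<phi>) powr q"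
  have "sum ?u F \<le> nrm \<phi> powr q" if "finite F" for F
    unfolding sum_nrm_singletons[OF \<phi> that]
    using q nrm_restr_le[OF \<phi>] nrm_nonneg[OF restr_in[OF \<phi>]] by (intro powr_mono2) auto
  then have "?u summable_on A"
    by (intro nonneg_bdd_above_summable_on) (auto intro!: bdd_aboveI2)
  then have c: "countable {\<alpha> \<in> A. ?u \<alpha> \<noteq> 0}" by (rule summable_countable_real)
  have "restr C \<phi> = \<phi>" if C: "{\<alpha> \<in> A. ?u \<alpha> \<noteq> 0} \<subseteq> C" for C
  proof (rule restr_eq_self[OF \<phi>])
    fix \<alpha> v assume \<alpha>: "\<alpha> \<in> A" "\<alpha> \<notin> C" and v: "v \<in> V \<alpha>"
    then have "nrm (restr {\<alpha>} \<phi>) = 0" using C by auto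
    then have "\<bar>restr {\<alpha>} \<phi> (coord \<alpha> v)\<bar> \<le> 0"
      using abs_le_nrm[OF restr_in[OF \<phi>] coord_in[OF \<alpha>(1) v], of "{\<alpha>}"] by simp
    then show "\<phi> (coord \<alpha> v) = 0" by (simp add: restr_coord[OF \<phi> \<alpha>(1) v])
  qed
  then show ?thesis using c by (intro exI[of _ "{\<alpha> \<in> A. ?u \<alpha> \<noteq> 0}"]) auto
qed

lemma countable_support_family:
  assumes "countable \<Phi>" "\<Phi> \<subseteq> dual_space X M"
  obtains B where "countable B" "B \<subseteq> A" "\<And>\<phi> C. \<phi> \<in> \<Phi> \<Longrightarrow> B \<subseteq> C \<Longrightarrow> restr C \<phi> = \<phi>"
proof -
  have "\<forall>\<phi>\<in>\<Phi>. \<exists>B. countable B \<and> B \<subseteq> A \<and> (\<forall>C. B \<subseteq> C \<longrightarrow> restr C \<phi> = \<phi>)"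
    using countable_support assms(2) by blast
  from bchoice[OF this] obtain S where
    S: "\<forall>\<phi>\<in>\<Phi>. countable (S \<phi>) \<and> S \<phi> \<subseteq> A \<and> (\<forall>C. S \<phi> \<subseteq> C \<longrightarrow> restr C \<phi> = \<phi>)" by (rule exE)
  show ?thesis
  proof
    show "countable (\<Union>\<phi>\<in>\<Phi>. S \<phi>)" using S assms(1) by simp
    show "(\<Union>\<phi>\<in>\<Phi>. S \<phi>) \<subseteq> A" using S by blast
    show "restr C \<phi> = \<phi>" if "\<phi> \<in> \<Phi>" "(\<Union>\<phi>\<in>\<Phi>. S \<phi>) \<subseteq> C" for \<phi> C
      using S that by (meson UN_subset_iff)
  qed
qed

lemma nrm_powr_le_1: "\<phi> \<in> dual_ball X M \<Longrightarrow> nrm \<phi> powr q \<le> 1"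
  using powr_mono2[of q "nrm \<phi>" 1] q nrm_nonneg[OF dual_ball_subset, of \<phi>] by (simp add: dual_ball_def)

lemma dual_ballI_powr:
  assumes "\<phi> \<in> dual_space X M" "nrm \<phi> powr q \<le> 1"
  shows "\<phi> \<in> dual_ball X M"
proof -
  have "nrm \<phi> \<le> 1"
  proof (rule ccontr)
    assume "\<not> nrm \<phi> \<le> 1"
    then have "1 < nrm \<phi> powr q" using q by (intro gr_one_powr) auto
    then show False using assms(2) by simp
  qed
  then show ?thesis using assms(1) by (simp add: dual_ball_def)
qed

text \<open>A nonempty index set \<open>B\<close> of the family contains all supports. In
  \<open>q\<close>-th powers, the ball leaves the mass \<open>1 - a n\<close> for a lift of
  \<open>x n\<close> off \<open>B\<close>, against \<open>1 - a0\<close> for \<open>y\<close>. The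
  lift scales the part of \<open>y\<close> off \<open>B\<close> by the \<open>q\<close>-th root of
  their quotient, and convergence of the norms makes this factor tend to \<open>1\<close> when
  \<open>a0 < 1\<close>.\<close>

lemma fiber_convergent_if_norm_convergent:
  assumes x: "\<And>n. x n \<in> dual_ball X M" "limitin K x l sequentially"
    and norms: "(\<lambda>n. nrm (x n)) \<longlonglongrightarrow> nrm l"
  shows "fiber_convergent K x l"
proof -
  have l: "l \<in> dual_ball X M" and lim: "\<And>f. f \<in> X \<Longrightarrow> (\<lambda>n. x n f) \<longlonglongrightarrow> l f"
    using x(2) limitin_weak_star_ball[OF normed x(1)] by auto
  note l_dual = dual_ball_subset[OF l]
  have "insert l (range x) \<subseteq> dual_space X M" using x(1) l dual_ball_subset by auto
  then obtain B0 where B0: "countable B0" "B0 \<subseteq> A"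
    and supp: "\<And>\<phi> C. \<phi> \<in> insert l (range x) \<Longrightarrow> B0 \<subseteq> C \<Longrightarrow> restr C \<phi> = \<phi>"
    by (rule countable_support_family[rotated]) (rule that, auto)
  \<comment> \<open>\<open>B = {}\<close> gives the one-point quotient, which is the supremum of the empty family.\<close>
  let ?\<B> = "{B. countable B \<and> B \<subseteq> A \<and> (B = {} \<or> B0 \<subseteq> B)}"
  show ?thesis
  proof (rule fiber_convergentI[OF x, of ?\<B>])
    fix \<C> assume C: "countable \<C>" "\<C> \<subseteq> ?\<B>"
    then have "countable (\<Union>\<C>)" using countable_UN[of \<C> "\<lambda>B. B"] by (auto simp: subset_iff)
    then show "\<Union>\<C> \<in> ?\<B>" using C(2) by blast
  next
    fix B assume "countable B" "B \<subseteq> A"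
    then show "\<exists>C\<in>?\<B>. B \<subseteq> C" using B0 by (intro bexI[of _ "B \<union> B0"]) auto
  next
    fix B y assume B: "B \<in> ?\<B>" and y: "y \<in> dual_ball X M" and agree: "agree B y l"
    note y_dual = dual_ball_subset[OF y]
    show "\<exists>z. (\<forall>n. z n \<in> dual_ball X M \<and> agree B (z n) (x n)) \<and> limitin K z y sequentially"
    proof (cases "B = {}")
      case True
      \<comment> \<open>With no coordinates prescribed, the constant sequence is a lift.\<close>
      have "limitin K (\<lambda>_. y) y sequentially"
        using y by (subst limitin_weak_star_ball[OF normed]) auto
      then show ?thesis using True y by (intro exI[of _ "\<lambda>_. y"]) (simp add: agree_def)
    next
      case False
      then have "B0 \<subseteq> B" using B by blast
      then have Bx: "restr B (x n) = x n" and Bl: "restr B l = l" for n using supp by auto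
      have By: "restr B y = l"
        using agree_imp_restr_eq[OF y_dual l_dual agree] Bl by simp
      define a where "a n = nrm (x n) powr q" for n
      define a0 where "a0 = nrm l powr q"
      define b where "b = nrm (restr (- B) y)"
      \<comment> \<open>If \<open>a0 = 1\<close> then \<open>t\<close> is the junk value \<open>0\<close>, but then \<open>y\<close> vanishes off \<open>B\<close>.\<close>
      define t where "t n = ((1 - a n) / (1 - a0)) powr (1 / q)" for n
      have b: "0 \<le> b" unfolding b_def by (rule nrm_nonneg[OF restr_in[OF y_dual]])
      \<comment> \<open>On \<open>B\<close> the functional \<open>y\<close> is \<open>l\<close>, so
        membership of \<open>y\<close> in the ball bounds its part off \<open>B\<close>.\<close>
      have ab: "a0 + b powr q \<le> 1"
        using dual_additive[OF y_dual, of B] nrm_powr_le_1[OF y] By by (simp add: a0_def b_def)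
      have a1: "a n \<le> 1" for n using nrm_powr_le_1[OF x(1)] by (simp add: a_def)
      have a01: "a0 \<le> 1" using nrm_powr_le_1[OF l] by (simp add: a0_def)
      have a_lim: "a \<longlonglongrightarrow> a0"
        unfolding a_def a0_def using q nrm_nonneg[OF dual_ball_subset[OF x(1)]]
        by (intro tendsto_powr' norms tendsto_const) auto
      define z where "z n = restrict (\<lambda>f. 1 * x n f + t n * restr (- B) y f) X" for n
      have z_dual: "z n \<in> dual_space X M" for n
        unfolding z_def by (intro dual_space_combination[OF normed] restr_in y_dual dual_ball_subset x(1))
      have zf: "z n f = x n f + t n * y (block (- B) f)" if "f \<in> X" for n f
        using that by (simp add: z_def restr_apply)
      have t0: "0 \<le> t n" for n by (simp add: t_def)
      have tb: "(t n * b) powr q \<le> 1 - a n" for n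
      proof -
        have "(t n * b) powr q = ((1 - a n) / (1 - a0)) * b powr q"
          using t0 b q a1[of n] a01 by (simp add: powr_mult t_def powr_powr)
        \<comment> \<open>If \<open>a0 \<noteq> 1\<close>, the bound \<open>ab\<close> cancels the
          denominator; otherwise division by zero gives \<open>0\<close>.\<close>
        also have "\<dots> \<le> 1 - a n"
        proof (cases "a0 = 1")
          case False
          then have "b powr q / (1 - a0) \<le> 1" using ab a01 by simp
          from mult_left_mono[OF this, of "1 - a n"] show ?thesis using a1[of n] by simp
        qed (use a1[of n] in simp)
        finally show ?thesis .
      qed
      have "restr B (z n) = x n" for n
      proof (rule extensionalityI[of _ X])
        show "restr B (z n) f = x n f" if "f \<in> X" for f
        proof -
          have "block (- B) (block B f) = 0" by (auto simp: block_def fun_eq_iff)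
          then have "y (block (- B) (block B f)) = 0" by (simp only: dual_zero[OF y_dual])
          then have "restr B (z n) f = restr B (x n) f"
            using that by (simp add: restr_apply zf block_in)
          then show ?thesis by (simp only: Bx)
        qed
      qed (use x(1)[of n] in \<open>simp_all add: restr_def dual_ball_def dual_space_def\<close>)
      moreover have "nrm (restr (- B) (z n)) \<le> t n * b" for n
      proof (rule nrm_le)
        fix f assume f: "f \<in> X"
        have "block B (block (- B) f) = 0" by (auto simp: block_def fun_eq_iff)
        then have "x n (block B (block (- B) f)) = 0"
          by (simp only: dual_zero[OF dual_ball_subset[OF x(1)]])
        then have "x n (block (- B) f) = 0"
          using fun_cong[OF Bx, of n "block (- B) f"] by (simp add: restr_apply block_in f)
        then have "restr (- B) (z n) f = t n * restr (- B) y f"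
          using f by (simp add: restr_apply zf block_in block_block)
        then show "\<bar>restr (- B) (z n) f\<bar> \<le> t n * b * M f"
          using abs_le_nrm[OF restr_in[OF y_dual] f, of "- B"] t0
          by (simp add: b_def abs_mult mult_left_mono mult.assoc)
      qed (use t0 b in simp)
      then have "nrm (restr (- B) (z n)) powr q \<le> 1 - a n" for n
        using order_trans[OF powr_mono2 tb] q nrm_nonneg[OF restr_in[OF z_dual]] by simp
      ultimately have "nrm (z n) powr q \<le> 1" for n
        using dual_additive[OF z_dual, of n B] by (simp add: a_def le_diff_eq add.commute)
      then have z: "z n \<in> dual_ball X M" for n by (intro dual_ballI_powr z_dual)
      show ?thesis
      proof (intro exI[of _ z] conjI allI)
        show "z n \<in> dual_ball X M" for n by (rule z)
        show "agree B (z n) (x n)" for n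
          unfolding agree_def
        proof (intro ballI)
          fix \<alpha> v assume "\<alpha> \<in> B" "v \<in> V \<alpha>"
          then have "coord \<alpha> v \<in> X" using B coord_in by blast
          then show "z n (coord \<alpha> v) = x n (coord \<alpha> v)"
            using \<open>\<alpha> \<in> B\<close> dual_zero[OF y_dual] by (simp add: zf block_coord)
        qed
        have "(\<lambda>n. z n f) \<longlonglongrightarrow> y f" if f: "f \<in> X" for f
        proof -
          have yf: "y f = l f + y (block (- B) f)"
            using dual_block_split[OF y_dual f, of B] fun_cong[OF By, of f] f by (simp add: restr_apply)
          have "(\<lambda>n. t n * y (block (- B) f)) \<longlonglongrightarrow> y (block (- B) f)"
          proof (cases "a0 = 1")
            case True
            then have "b = 0" using ab b by simp
            then have "y (block (- B) f) = 0"
              using abs_le_nrm[OF restr_in[OF y_dual] f, of "- B"] f by (simp add: b_def restr_apply)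
            then show ?thesis by simp
          next
            case False
            then have "(\<lambda>n. (1 - a n) / (1 - a0)) \<longlonglongrightarrow> (1 - a0) / (1 - a0)"
              by (intro tendsto_divide tendsto_diff tendsto_const a_lim) simp
            then have "t \<longlonglongrightarrow> 1 powr (1 / q)"
              unfolding t_def using False by (intro tendsto_powr tendsto_const) auto
            then show ?thesis using tendsto_mult[OF _ tendsto_const] by fastforce
          qed
          then show ?thesis
            unfolding zf[OF f] yf by (intro tendsto_add lim f)
        qed
        then show "limitin K z y sequentially"
          using y limitin_weak_star_ball[OF normed, of z y] z by blast
      qed
    qed
  qed auto
qed

text \<open>Weak-star lower semicontinuity of the dual norm: a vector of the unit ball at which
  \<open>l\<close> exceeds \<open>c\<close> in absolute value is tested against the
  sequence.\<close>

lemma eventually_less_nrm: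
  assumes x: "\<And>n. x n \<in> dual_ball X M" and l: "l \<in> dual_ball X M"
    and lim: "\<And>f. f \<in> X \<Longrightarrow> (\<lambda>n. x n f) \<longlonglongrightarrow> l f" and c: "c < nrm l"
  shows "\<forall>\<^sub>F n in sequentially. c < nrm (x n)"
proof -
  obtain f where f: "f \<in> X" "M f \<le> 1" "c < \<bar>l f\<bar>"
    by (rule less_dual_norm[OF normed dual_ball_subset[OF l] c]) (rule that)
  have "(\<lambda>n. \<bar>x n f\<bar>) \<longlonglongrightarrow> \<bar>l f\<bar>" by (intro tendsto_rabs lim f)
  from order_tendstoD(1)[OF this f(3)] show ?thesis
  proof (rule eventually_mono)
    fix n assume "c < \<bar>x n f\<bar>"
    also have "\<dots> \<le> nrm (x n)"
      using f by (intro abs_le_dual_norm_unit[OF normed] dual_ball_subset x)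
    finally show "c < nrm (x n)" .
  qed
qed

text \<open>The lower half holds for every weak-star limit; fiber convergence gives the upper half.
  The given semilattice is arbitrary, so its members can only be compared with coordinate relations,
  from both sides.\<close>

lemma norm_convergent_if_fiber_convergent:
  assumes fc: "fiber_convergent K x l"
  shows "(\<lambda>n. nrm (x n)) \<longlonglongrightarrow> nrm l"
proof -
  have x: "x n \<in> dual_ball X M" for n
    using fc by (simp add: fiber_convergent_def topspace_K)
  have "limitin K x l sequentially" using fc by (simp add: fiber_convergent_def)
  then have l: "l \<in> dual_ball X M" and lim: "\<And>f. f \<in> X \<Longrightarrow> (\<lambda>n. x n f) \<longlonglongrightarrow> l f"
    using limitin_weak_star_ball[OF normed x] by auto
  note l_dual = dual_ball_subset[OF l]
  obtain \<S> where S: "\<S> \<subseteq> countable_weight_quotients K" "cofinal_quotients K \<S>"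
    and S_fc: "\<forall>L\<in>\<S>. \<forall>L'\<in>\<S>. \<forall>\<pi>. natural_projection K L L' \<pi> \<longrightarrow>
           map_fiber_convergent (quotient_topology K L) (quotient_topology K L') \<pi>
             (\<lambda>n. quotient_proj L' (x n)) (quotient_proj L' l)"
    using fc unfolding fiber_convergent_def by (elim conjE exE)
  have eq: "equiv (topspace K) L" if "L \<in> countable_weight_quotients K" for L
    using that by (simp add: countable_weight_quotients_def hausdorff_quotients_def)
  have above: "\<exists>L\<in>\<S>. L \<subseteq> coord_rel B" if "countable B" "B \<subseteq> A" for B
  proof -
    have B: "coord_rel B \<in> countable_weight_quotients K"
      using that by (rule coord_rel_countable_weight)
    then obtain L where L: "L \<in> \<S>" "quotient_le K (coord_rel B) L"
      using S(2) unfolding cofinal_quotients_def by (elim ballE bexE) auto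
    then have "L \<subseteq> coord_rel B"
      using quotient_le_iff_superset[OF eq[OF B] eq] S(1) by blast
    then show ?thesis using L(1) by (rule bexI)
  qed
  have "insert l (range x) \<subseteq> dual_space X M" using x l dual_ball_subset by auto
  then obtain B0 where B0: "countable B0" "B0 \<subseteq> A"
    and supp: "\<And>\<phi> C. \<phi> \<in> insert l (range x) \<Longrightarrow> B0 \<subseteq> C \<Longrightarrow> restr C \<phi> = \<phi>"
    by (rule countable_support_family[rotated]) (rule that, auto)
  \<comment> \<open>A relation inside \<open>coord_rel B0\<close> fixes all coordinates in
    \<open>B0\<close>, so every lift of \<open>x n\<close> over \<open>L'\<close> has
    \<open>x n\<close> as its part on \<open>B0\<close>.\<close>
  obtain L' where L': "L' \<in> \<S>" "L' \<subseteq> coord_rel B0" using above[OF B0] by (rule bexE)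
  \<comment> \<open>In the other direction \<open>L'\<close> ignores the coordinates outside
    \<open>B1\<close>, so changing \<open>l\<close> at a fresh \<open>\<gamma>\<close> stays in the
    class of \<open>l\<close>.\<close>
  obtain B1 where B1: "countable B1" "B1 \<subseteq> A" "coord_rel B1 \<subseteq> L'"
    by (rule coord_rel_cofinal[of L']) (use S(1) L'(1) in blast, rule that)
  obtain \<gamma> where \<gamma>: "\<gamma> \<in> A" "\<gamma> \<notin> B0 \<union> B1" "V \<gamma> \<noteq> {0}"
    by (rule index_outside_countable[of "B0 \<union> B1"]) (use B0(1) B1(1) in simp, rule that)
  obtain v \<epsilon> where v: "v \<in> V \<gamma>" "N \<gamma> v = 1" and \<epsilon>: "\<epsilon> \<in> dual_ball X M" "\<epsilon> (coord \<gamma> v) = 1"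
    "\<And>\<alpha> w. \<alpha> \<in> A \<Longrightarrow> \<alpha> \<noteq> \<gamma> \<Longrightarrow> w \<in> V \<alpha> \<Longrightarrow> \<epsilon> (coord \<alpha> w) = 0"
    by (rule unit_functional[OF \<gamma>(1,3)]) (rule that)
  have cv: "coord \<gamma> v \<in> X" "M (coord \<gamma> v) = 1"
    using coord_in norm_coord \<gamma>(1) v by auto
  \<comment> \<open>The largest mass that can be added to \<open>l\<close> at
    \<open>\<gamma>\<close> within the ball, as the \<open>q\<close>-th powers of the two norms add
    up.\<close>
  define t where "t = (1 - nrm l powr q) powr (1 / q)"
  have tq: "t powr q = 1 - nrm l powr q" and t0: "0 \<le> t"
    using nrm_powr_le_1[OF l] q by (simp_all add: t_def powr_powr)
  have l\<gamma>: "l (block {\<gamma>} f) = 0" if "f \<in> X" for f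
  proof -
    have "block B0 (block {\<gamma>} f) = 0" using \<gamma>(2) by (auto simp: block_def fun_eq_iff)
    then have "restr B0 l (block {\<gamma>} f) = 0"
      by (simp only: restr_apply[OF block_in[OF that]] dual_zero[OF l_dual])
    moreover have "restr B0 l = l" by (rule supp) auto
    ultimately show ?thesis by simp
  qed
  have \<epsilon>\<gamma>: "\<epsilon> (block (- {\<gamma>}) f) = 0" if "f \<in> X" for f
  proof -
    have "block {\<gamma>} (block (- {\<gamma>}) f) = 0" by (auto simp: block_def fun_eq_iff)
    then have "restr {\<gamma>} \<epsilon> (block (- {\<gamma>}) f) = 0"
      by (simp only: restr_apply[OF block_in[OF that]] dual_zero[OF dual_ball_subset[OF \<epsilon>(1)]])
    moreover have "restr {\<gamma>} \<epsilon> = \<epsilon>"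
      using \<epsilon>(3) by (intro restr_eq_self dual_ball_subset \<epsilon>(1)) auto
    ultimately show ?thesis by simp
  qed
  define y where "y = restrict (\<lambda>f. 1 * l f + t * \<epsilon> f) X"
  have y_dual: "y \<in> dual_space X M"
    unfolding y_def by (intro dual_space_combination[OF normed] dual_ball_subset l \<epsilon>(1))
  have yf: "y f = l f + t * \<epsilon> f" if "f \<in> X" for f using that by (simp add: y_def)
  have "nrm (restr {\<gamma>} y) \<le> t"
  proof (rule nrm_le[OF t0])
    fix f assume f: "f \<in> X"
    have "\<bar>\<epsilon> (block {\<gamma>} f)\<bar> \<le> M (block {\<gamma>} f)"
      using \<epsilon>(1) block_in[OF f] by (simp add: dual_ball_iff[OF normed])
    also have "\<dots> \<le> M f" by (rule norm_block_le[OF f])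
    finally show "\<bar>restr {\<gamma>} y f\<bar> \<le> t * M f"
      using t0 f by (simp add: restr_apply yf block_in l\<gamma> abs_mult mult_left_mono)
  qed
  moreover have "nrm (restr (- {\<gamma>}) y) \<le> nrm l"
  proof (rule nrm_le[OF nrm_nonneg[OF l_dual]])
    fix f assume f: "f \<in> X"
    show "\<bar>restr (- {\<gamma>}) y f\<bar> \<le> nrm l * M f"
      using abs_restr_le[OF l_dual f, of "- {\<gamma>}"] by (simp add: restr_apply f yf block_in \<epsilon>\<gamma>)
  qed
  ultimately have "nrm y powr q \<le> t powr q + nrm l powr q"
    unfolding dual_additive[OF y_dual, of "{\<gamma>}"]
    using q nrm_nonneg[OF restr_in[OF y_dual]] by (intro add_mono powr_mono2) auto
  then have y: "y \<in> dual_ball X M" using tq by (intro dual_ballI_powr y_dual) simp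
  have "agree B1 y l"
    unfolding agree_def
  proof (intro ballI)
    fix \<alpha> w assume "\<alpha> \<in> B1" "w \<in> V \<alpha>"
    then have *: "\<alpha> \<in> A" "\<alpha> \<noteq> \<gamma>" using B1(2) \<gamma>(2) by auto
    show "y (coord \<alpha> w) = l (coord \<alpha> w)"
      using \<epsilon>(3)[OF * \<open>w \<in> V \<alpha>\<close>] coord_in[OF *(1) \<open>w \<in> V \<alpha>\<close>] by (simp add: yf)
  qed
  then have yl: "(y, l) \<in> L'" using B1(3) y l by (auto simp: coord_rel_iff)
  \<comment> \<open>\<open>L\<close> has to notice \<open>\<gamma>\<close>, so that the lifts must
    follow \<open>y\<close> there; the indices of \<open>B1\<close> are kept to place
    \<open>L\<close> above \<open>L'\<close>.\<close>
  obtain L where L: "L \<in> \<S>" "L \<subseteq> coord_rel (insert \<gamma> B1)"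
  proof -
    have "countable (insert \<gamma> B1)" "insert \<gamma> B1 \<subseteq> A" using B1 \<gamma>(1) by auto
    from above[OF this] show ?thesis by (rule bexE) (rule that)
  qed
  have "L \<subseteq> L'"
    using L(2) B1(3) agree_mono[of "insert \<gamma> B1" _ _ B1] by (auto simp: coord_rel_def)
  then have "quotient_le K L' L"
    using L(1) L'(1) S(1) by (subst quotient_le_iff_superset) (auto intro!: eq)
  then obtain \<pi> where \<pi>: "natural_projection K L L' \<pi>"
    unfolding quotient_le_def by (rule exE)
  have eqL: "equiv (topspace K) L" "equiv (topspace K) L'" using L(1) L'(1) S(1) eq by auto
  have fcL: "map_fiber_convergent (quotient_topology K L) (quotient_topology K L') \<pi>
             (\<lambda>n. quotient_proj L' (x n)) (quotient_proj L' l)"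
    using S_fc L(1) L'(1) \<pi> by simp
  have x_top: "x n \<in> topspace K" for n using x by (simp add: topspace_K)
  obtain z where z: "\<And>n. (z n, x n) \<in> L'"
    and z_lim: "\<And>g. continuous_map K euclideanreal g \<Longrightarrow> \<forall>(a, b)\<in>L. g a = g b \<Longrightarrow>
      (\<lambda>n. g (z n)) \<longlonglongrightarrow> g y"
    by (rule map_fiber_convergent_quotients_lift[OF eqL \<pi> x_top fcL yl]) (rule that)
  have zx: "z n \<in> dual_ball X M" "agree B0 (z n) (x n)" for n
    using z[of n] L'(2) by (auto simp: coord_rel_iff)
  have z_dual: "z n \<in> dual_space X M" for n by (rule dual_ball_subset[OF zx(1)])
  \<comment> \<open>Evaluation at \<open>coord \<gamma> v\<close> is constant on
    \<open>L\<close>-classes, so it converges along the lifts even though they need not converge in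
    \<open>K\<close>.\<close>
  have "\<forall>(a, b)\<in>L. a (coord \<gamma> v) = b (coord \<gamma> v)"
    using L(2) v(1) by (auto simp: coord_rel_def agree_def)
  from z_lim[OF continuous_map_weak_star_eval[OF normed cv(1)] this]
  have "(\<lambda>n. z n (coord \<gamma> v)) \<longlonglongrightarrow> y (coord \<gamma> v)" .
  moreover have "y (coord \<gamma> v) = t"
    using l\<gamma>[OF cv(1)] \<epsilon>(2) by (simp add: yf[OF cv(1)] block_coord)
  ultimately have z_t: "(\<lambda>n. z n (coord \<gamma> v)) \<longlonglongrightarrow> t" by simp
  define w where "w n = \<bar>z n (coord \<gamma> v)\<bar> powr q" for n
  \<comment> \<open>\<open>x n\<close> is the part of the lift on \<open>B0\<close>, and
    \<open>\<gamma>\<close> lies off \<open>B0\<close>; both masses together fit into the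
    ball.\<close>
  have bound: "nrm (x n) powr q + w n \<le> 1" for n
  proof -
    have "restr B0 (z n) = restr B0 (x n)"
      by (rule agree_imp_restr_eq[OF z_dual dual_ball_subset[OF x] zx(2)])
    then have 1: "restr B0 (z n) = x n" using supp by simp
    have "restr (- B0) (z n) (coord \<gamma> v) = z n (coord \<gamma> v)"
      using restr_coord[OF z_dual \<gamma>(1) v(1), of "- B0"] \<gamma>(2) by simp
    then have "\<bar>z n (coord \<gamma> v)\<bar> \<le> nrm (restr (- B0) (z n))"
      using abs_le_nrm[OF restr_in[OF z_dual] cv(1), of "- B0" n] cv(2) by simp
    then have "w n \<le> nrm (restr (- B0) (z n)) powr q"
      unfolding w_def using q by (intro powr_mono2) auto
    then show ?thesis
      using dual_additive[OF z_dual, of n B0] nrm_powr_le_1[OF zx(1), of n] 1 by simp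
  qed
  have w_lim: "w \<longlonglongrightarrow> t powr q"
    unfolding w_def using tendsto_rabs[OF z_t] t0 q by (intro tendsto_powr' tendsto_const) auto
  have w1: "w n \<le> 1" for n
    using bound[of n] by (smt (verit) powr_ge_zero)
  \<comment> \<open>Solving \<open>bound\<close> for the norm gives an upper estimate. Its limit is
    exactly \<open>nrm l\<close> because \<open>t\<close> takes up all the remaining mass.\<close>
  have "(\<lambda>n. (1 - w n) powr (1 / q)) \<longlonglongrightarrow> (1 - t powr q) powr (1 / q)"
    using q w1 by (intro tendsto_powr' tendsto_diff w_lim tendsto_const) auto
  also have "(1 - t powr q) powr (1 / q) = nrm l"
    using q nrm_nonneg[OF l_dual] by (simp add: tq powr_powr)
  finally have upper: "(\<lambda>n. (1 - w n) powr (1 / q)) \<longlonglongrightarrow> nrm l" .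
  have le: "nrm (x n) \<le> (1 - w n) powr (1 / q)" for n
  proof -
    have "nrm (x n) = (nrm (x n) powr q) powr (1 / q)"
      using q nrm_nonneg[OF dual_ball_subset[OF x]] by (simp add: powr_powr)
    also have "\<dots> \<le> (1 - w n) powr (1 / q)"
      using bound[of n] q by (intro powr_mono2) auto
    finally show ?thesis .
  qed
  show ?thesis
  proof (rule order_tendstoI)
    fix c assume c: "c < nrm l"
    show "\<forall>\<^sub>F n in sequentially. c < nrm (x n)"
      by (rule eventually_less_nrm[OF x l _ c]) (rule lim)
  next
    fix c assume "nrm l < c"
    from order_tendstoD(2)[OF upper this] show "\<forall>\<^sub>F n in sequentially. nrm (x n) < c"
      by (rule eventually_mono) (use le order_le_less_trans in blast)
  qed
qed

theorem class_E0_sum: "class_E0 X M"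
  unfolding class_E0_def
proof (intro conjI allI iffI)
  fix x l assume fc: "fiber_convergent K x l"
  then have x: "x n \<in> dual_ball X M" and lim: "limitin K x l sequentially" for n
    by (simp_all add: fiber_convergent_def topspace_K)
  show "x n \<in> dual_ball X M" for n by (rule x)
  show "limitin K x l sequentially" by (rule lim)
  then show "l \<in> dual_ball X M" using limitin_topspace topspace_K by metis
  show "(\<lambda>n. nrm (x n)) \<longlonglongrightarrow> nrm l" by (rule norm_convergent_if_fiber_convergent[OF fc])
qed (use complete not_separable fiber_convergent_if_norm_convergent in blast)+

end

section \<open>Duality for two blocks\<close>

context separable_sum
begin

text \<open>A supremum is pulled through a nonnegative factor. The case \<open>s = 0\<close> is
  separate because \<open>D / s\<close> is then a junk value.\<close>

lemma scaled_dual_norm_le: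
  assumes s: "0 \<le> s" and D: "\<And>u. u \<in> X \<Longrightarrow> M u \<le> 1 \<Longrightarrow> s * \<bar>\<phi> u\<bar> \<le> D"
  shows "s * dual_norm X M \<phi> \<le> D"
proof (cases "s = 0")
  case True
  then show ?thesis using D[OF zero_in_sum] normed_space_on_zero[OF normed] by simp
next
  case False
  then have "dual_norm X M \<phi> \<le> D / s"
    using s D by (intro dual_norm_le[OF normed]) (simp add: le_divide_eq mult.commute)
  then show ?thesis using s False by (simp add: le_divide_eq mult.commute)
qed

text \<open>Bounds the norm of a functional from below by its parts: test vectors on the two blocks
  are combined with weights \<open>s\<close> and \<open>t\<close>. The bound \<open>C\<close> on the
  combined vector is left open, since it depends on the kind of sum.\<close>

lemma dual_norm_pair_le:
  assumes \<phi>: "\<phi> \<in> dual_space X M" and st: "0 \<le> s" "0 \<le> t"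
    and C: "\<And>f. f \<in> X \<Longrightarrow> M (block B f) \<le> s \<Longrightarrow> M (block (- B) f) \<le> t \<Longrightarrow> M f \<le> C"
  shows "s * dual_norm X M (restr B \<phi>) + t * dual_norm X M (restr (- B) \<phi>) \<le> dual_norm X M \<phi> * C"
proof -
  let ?D = "dual_norm X M \<phi> * C"
  have 1: "s * \<bar>restr B \<phi> u\<bar> + t * \<bar>restr (- B) \<phi> w\<bar> \<le> ?D"
    if u: "u \<in> X" "M u \<le> 1" and w: "w \<in> X" "M w \<le> 1" for u w
  proof -
    \<comment> \<open>The signs make both terms of \<open>\<phi> f\<close> nonnegative, so that the
      absolute values add up.\<close>
    define f where "f = (s * sgn (\<phi> (block B u))) *\<^sub>R block B u
      + (t * sgn (\<phi> (block (- B) w))) *\<^sub>R block (- B) w"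
    note in_X = block_in[OF u(1)] block_in[OF w(1)]
    have f: "f \<in> X"
      unfolding f_def by (intro subspace_add[OF X_subspace] subspace_scale[OF X_subspace] in_X)
    have "block B f = (s * sgn (\<phi> (block B u))) *\<^sub>R block B u"
      "block (- B) f = (t * sgn (\<phi> (block (- B) w))) *\<^sub>R block (- B) w"
      by (auto simp: f_def block_def fun_eq_iff scaleR_fun_def)
    moreover have "\<bar>c * sgn d\<bar> * e \<le> c" if "0 \<le> c" "e \<le> 1" "0 \<le> e" for c d e :: real
      using that by (auto simp: sgn_if abs_mult intro: mult_left_le)
    moreover have "M (block B u) \<le> 1" "M (block (- B) w) \<le> 1"
      using norm_block_le u w order_trans by blast+
    ultimately have "M (block B f) \<le> s" "M (block (- B) f) \<le> t"
      using st normed_space_on_nonneg[OF normed] in_X by (simp_all add: normed_space_on_scale[OF normed])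
    then have Mf: "M f \<le> C" by (rule C[OF f])
    have "\<phi> f = s * \<bar>restr B \<phi> u\<bar> + t * \<bar>restr (- B) \<phi> w\<bar>"
      unfolding f_def using dual_plus[OF \<phi>] dual_scaleR[OF \<phi>] in_X u w
      by (simp add: subspace_scale[OF X_subspace] restr_apply abs_sgn mult.assoc mult.commute
          del: plus_fun_apply)
    moreover have "\<phi> f \<le> dual_norm X M \<phi> * M f"
      using abs_le_dual_norm[OF normed \<phi> f] by simp
    moreover have "dual_norm X M \<phi> * M f \<le> ?D"
      using Mf dual_norm_nonneg[OF normed \<phi>] by (rule mult_left_mono)
    ultimately show ?thesis by simp
  qed
  \<comment> \<open>The supremum is taken over one test vector with the other fixed, then over the
    other.\<close>
  have "s * dual_norm X M (restr B \<phi>) \<le> ?D - t * \<bar>restr (- B) \<phi> w\<bar>"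
    if "w \<in> X" "M w \<le> 1" for w
    using 1 that by (intro scaled_dual_norm_le[OF st(1)]) (simp add: le_diff_eq)
  then have "t * dual_norm X M (restr (- B) \<phi>) \<le> ?D - s * dual_norm X M (restr B \<phi>)"
    by (intro scaled_dual_norm_le[OF st(2)]) (simp add: le_diff_eq add.commute)
  then show ?thesis by simp
qed

lemma abs_le_dual_norm_pair:
  assumes \<phi>: "\<phi> \<in> dual_space X M" and f: "f \<in> X"
  shows "\<bar>\<phi> f\<bar> \<le> dual_norm X M (restr B \<phi>) * M (block B f)
    + dual_norm X M (restr (- B) \<phi>) * M (block (- B) f)"
proof -
  have "\<bar>\<phi> (block C f)\<bar> \<le> dual_norm X M (restr C \<phi>) * M (block C f)" for C
    using abs_le_dual_norm[OF normed restr_in[OF \<phi>] block_in[OF f], of C C]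
    by (simp add: restr_apply block_in f block_block)
  from this[of B] this[of "- B"] show ?thesis
    using dual_block_split[OF \<phi> f, of B] by linarith
qed

text \<open>For a maximum norm both weights can be \<open>1\<close> without the combined vector
  leaving the unit ball, so the norms of the parts add up as in an l1-sum.\<close>

lemma dual_norm_additive_max:
  assumes max: "\<And>f B. f \<in> X \<Longrightarrow> M f \<le> max (M (block B f)) (M (block (- B) f))"
    and \<phi>: "\<phi> \<in> dual_space X M"
  shows "dual_norm X M \<phi> = dual_norm X M (restr B \<phi>) + dual_norm X M (restr (- B) \<phi>)"
    (is "?n = ?a + ?b")
proof (rule antisym)
  have ab: "0 \<le> ?a" "0 \<le> ?b" by (intro dual_norm_nonneg[OF normed] restr_in \<phi>)+
  show "?n \<le> ?a + ?b"
  proof (rule dual_norm_le[OF normed])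
    fix f assume f: "f \<in> X" "M f \<le> 1"
    have "M (block C f) \<le> 1" for C using norm_block_le[OF f(1)] f(2) by (rule order_trans)
    then have "?a * M (block B f) + ?b * M (block (- B) f) \<le> ?a * 1 + ?b * 1"
      using ab by (intro add_mono mult_left_mono)
    then show "\<bar>\<phi> f\<bar> \<le> ?a + ?b" using abs_le_dual_norm_pair[OF \<phi> f(1), of B] by simp
  qed
  show "?a + ?b \<le> ?n"
    using dual_norm_pair_le[OF \<phi>, of 1 1 B 1] max[of _ B] by fastforce
qed

text \<open>Hoelder duality for two blocks: Young's inequality gives the upper estimate, the
  extremal weights of Hoelder's inequality the lower one.\<close>

lemma dual_norm_additive_powr:
  assumes p: "1 < p" and pq: "1 / p + 1 / q = 1"
    and M: "\<And>f B. f \<in> X \<Longrightarrow> M f powr p = M (block B f) powr p + M (block (- B) f) powr p"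
    and \<phi>: "\<phi> \<in> dual_space X M"
  shows "dual_norm X M \<phi> powr q = dual_norm X M (restr B \<phi>) powr q + dual_norm X M (restr (- B) \<phi>) powr q"
    (is "?n powr q = ?a powr q + ?b powr q")
proof -
  have q: "1 < q"
  proof -
    have "1 / q = 1 - 1 / p" using pq by simp
    then have "0 < 1 / q" "1 / q < 1" using p by auto
    then show ?thesis by (simp add: divide_less_eq split: if_splits)
  qed
  have ab: "0 \<le> ?a" "0 \<le> ?b" by (intro dual_norm_nonneg[OF normed] restr_in \<phi>)+
  have n: "0 \<le> ?n" by (rule dual_norm_nonneg[OF normed \<phi>])
  define S where "S = ?a powr q + ?b powr q"
  define r where "r = S powr (1 / q)"
  have S: "0 \<le> S" by (simp add: S_def)
  have r: "0 \<le> r" "r powr q = S" using q S by (simp_all add: r_def powr_powr)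
  have "?n \<le> r"
  proof (cases "S = 0")
    case True
    then have "?a powr q = 0" "?b powr q = 0"
      unfolding S_def by (smt (verit) powr_ge_zero)+
    then have "?a = 0" "?b = 0" by auto
    then show ?thesis
      using abs_le_dual_norm_pair[OF \<phi>, of _ B] r(1) by (intro dual_norm_le[OF normed]) fastforce
  next
    case False
    then have r0: "0 < r" using r S by (simp add: r_def)
    show ?thesis
    proof (rule dual_norm_le[OF normed])
      fix f assume f: "f \<in> X" "M f \<le> 1"
      let ?x = "M (block B f)" and ?y = "M (block (- B) f)"
      have xy: "0 \<le> ?x" "0 \<le> ?y" using normed_space_on_nonneg[OF normed] block_in[OF f(1)] by auto
      have "?x powr p + ?y powr p \<le> 1"
        using M[OF f(1), of B] powr_mono2[of p "M f" 1] f normed_space_on_nonneg[OF normed f(1)] p by simp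
      \<comment> \<open>Young's inequality is applied to \<open>?a / r\<close> and
        \<open>?b / r\<close>, normalised so that their \<open>q\<close>-th powers sum to
        \<open>1\<close>.\<close>
      have "(?a / r) * ?x + (?b / r) * ?y
          \<le> ((?a / r) powr q / q + ?x powr p / p) + ((?b / r) powr q / q + ?y powr p / p)"
        using ab r0 xy p q pq by (intro add_mono Youngs_inequality) (auto simp: add.commute)
      also have "\<dots> = (?a powr q + ?b powr q) / r powr q / q + (?x powr p + ?y powr p) / p"
        using ab r0 by (simp add: powr_divide add_divide_distrib)
      also have "\<dots> \<le> 1 / q + 1 / p"
        using \<open>?x powr p + ?y powr p \<le> 1\<close> p False r(2)
        by (simp add: S_def[symmetric] divide_right_mono)
      also have "\<dots> = 1" using pq by simp
      finally have "?a * ?x + ?b * ?y \<le> r"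
        using r0 by (simp add: field_simps)
      then show "\<bar>\<phi> f\<bar> \<le> r" using abs_le_dual_norm_pair[OF \<phi> f(1), of B] by simp
    qed
  qed
  then have "?n powr q \<le> S" using powr_mono2[of q ?n r] n q r(2) by simp
  moreover have "S \<le> ?n powr q"
  proof (cases "S = 0")
    case False
    then have S0: "0 < S" using S by simp
    \<comment> \<open>The equality case of Hoelder's inequality: \<open>s powr p\<close> and
      \<open>t powr p\<close> are proportional to \<open>?a powr q\<close> and
      \<open>?b powr q\<close> and sum to \<open>1\<close>.\<close>
    define s where "s = (?a powr q / S) powr (1 / p)"
    define t where "t = (?b powr q / S) powr (1 / p)"
    have st: "0 \<le> s" "0 \<le> t" by (simp_all add: s_def t_def)
    have "s powr p + t powr p = ?a powr q / S + ?b powr q / S"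
      using p S0 by (simp add: s_def t_def powr_powr)
    also have "\<dots> = 1" using S0 by (simp add: S_def flip: add_divide_distrib)
    finally have st1: "s powr p + t powr p = 1" .
    have "M f \<le> 1" if "f \<in> X" "M (block B f) \<le> s" "M (block (- B) f) \<le> t" for f
    proof (rule ccontr)
      assume "\<not> M f \<le> 1"
      then have "1 < M f powr p" using p by (intro gr_one_powr) auto
      also have "M f powr p \<le> s powr p + t powr p"
        unfolding M[OF that(1), of B] using p that normed_space_on_nonneg[OF normed] block_in[OF that(1)]
        by (intro add_mono powr_mono2) auto
      finally show False using st1 by simp
    qed
    from dual_norm_pair_le[OF \<phi> st this]
    have "s * ?a + t * ?b \<le> ?n" by simp
    \<comment> \<open>Since \<open>q / p = q - 1\<close>, the product of \<open>c\<close> with its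
      weight is a multiple of \<open>c powr q\<close>.\<close>
    moreover have "c * (c powr q / S) powr (1 / p) = c powr q / S powr (1 / p)" if "0 \<le> c" for c
    proof -
      have "1 + q / p = q" using pq p q by (simp add: field_simps)
      then have "c powr q = c * c powr (q / p)"
        using that q powr_add[of c 1 "q / p"] by (cases "c = 0") simp_all
      moreover have "(c powr q / S) powr (1 / p) = c powr (q / p) / S powr (1 / p)"
        using that S0 by (simp add: powr_divide powr_powr)
      ultimately show ?thesis by simp
    qed
    ultimately have "(?a powr q + ?b powr q) / S powr (1 / p) \<le> ?n"
      using ab by (simp add: s_def t_def mult.commute add_divide_distrib)
    moreover have "S / S powr (1 / p) = S powr (1 / q)"
    proof -
      have "1 / q = 1 - 1 / p" using pq by simp
      then show ?thesis using S0 by (simp add: powr_diff)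
    qed
    ultimately have "r \<le> ?n" by (simp add: r_def S_def[symmetric])
    then show ?thesis using powr_mono2[of q r ?n] r q by simp
  qed simp
  ultimately show ?thesis by (simp add: S_def)
qed

end

section \<open>Completeness and norms of the classical sums\<close>

text \<open>Convexity is invoked for two positive arguments. If one of them is zero, the claim
  reduces to \<open>c powr p \<le> c\<close> for \<open>c\<close> between \<open>0\<close> and
  \<open>1\<close>.\<close>

lemma powr_convex_combination:
  fixes x y \<mu> p :: real
  assumes p: "1 \<le> p" and xy: "0 \<le> x" "0 \<le> y" and \<mu>: "0 \<le> \<mu>" "\<mu> \<le> 1"
  shows "(\<mu> * x + (1 - \<mu>) * y) powr p \<le> \<mu> * x powr p + (1 - \<mu>) * y powr p"
proof -
  have scaled: "(c * z) powr p \<le> c * z powr p" if "0 \<le> c" "c \<le> 1" "0 \<le> z" for c z :: real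
  proof -
    have "c powr p \<le> c powr 1" using that p by (intro powr_mono') auto
    then show ?thesis using that by (simp add: powr_mult mult_right_mono)
  qed
  consider "x = 0" | "y = 0" | "0 < x" "0 < y" using xy by linarith
  then show ?thesis
  proof cases
    case 1
    then show ?thesis using scaled[of "1 - \<mu>" y] \<mu> xy by simp
  next
    case 2
    then show ?thesis using scaled[of \<mu> x] \<mu> xy by simp
  next
    case 3
    then show ?thesis
      using convex_onD[OF powr_convex[OF p], of "1 - \<mu>" x y] \<mu> by simp
  qed
qed

text \<open>Minkowski's inequality for finite sums, with upper bounds \<open>s\<close> and
  \<open>t\<close> in place of the norms, so that it applies to finite subsums with the norms of the
  whole vectors.\<close>

lemma minkowski_sum_powr:
  fixes a b :: "'i \<Rightarrow> real"
  assumes p: "1 \<le> p" and F: "finite F" and ab: "\<And>i. i \<in> F \<Longrightarrow> 0 \<le> a i" "\<And>i. i \<in> F \<Longrightarrow> 0 \<le> b i"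
    and st: "0 \<le> s" "0 \<le> t" and a: "(\<Sum>i\<in>F. a i powr p) \<le> s powr p" and b: "(\<Sum>i\<in>F. b i powr p) \<le> t powr p"
  shows "(\<Sum>i\<in>F. (a i + b i) powr p) \<le> (s + t) powr p"
proof -
  have zero: "\<forall>i\<in>F. c i = 0" if "(\<Sum>i\<in>F. c i powr p) \<le> 0 powr p" for c :: "'i \<Rightarrow> real"
  proof -
    have "(\<Sum>i\<in>F. c i powr p) = 0"
      using that p sum_nonneg[of F "\<lambda>i. c i powr p"] by simp
    then show ?thesis using F by (simp add: sum_nonneg_eq_0_iff)
  qed
  consider "s = 0" | "t = 0" | "0 < s" "0 < t" using st by linarith
  then show ?thesis
  proof cases
    case 1
    then show ?thesis using zero[of a] a b by simp
  next
    case 2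
    then show ?thesis using zero[of b] a b by simp
  next
    case 3
    \<comment> \<open>With this weight, \<open>(a i + b i) / (s + t)\<close> is a convex combination
      of \<open>a i / s\<close> and \<open>b i / t\<close>, the entries of two vectors of the unit
      ball.\<close>
    define \<mu> where "\<mu> = s / (s + t)"
    have \<mu>: "0 \<le> \<mu>" "\<mu> \<le> 1" "1 - \<mu> = t / (s + t)"
      using 3 by (auto simp: \<mu>_def field_simps)
    have "(a i + b i) powr p \<le> (s + t) powr p * (\<mu> * (a i powr p / s powr p) + (1 - \<mu>) * (b i powr p / t powr p))"
      if i: "i \<in> F" for i
    proof -
      have "\<mu> * (a i / s) = a i / (s + t)" "(1 - \<mu>) * (b i / t) = b i / (s + t)"
        using 3 unfolding \<mu>(3) by (simp_all add: \<mu>_def)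
      then have "a i + b i = (s + t) * (\<mu> * (a i / s) + (1 - \<mu>) * (b i / t))"
        using 3 by (simp add: distrib_left)
      then have "(a i + b i) powr p = (s + t) powr p * (\<mu> * (a i / s) + (1 - \<mu>) * (b i / t)) powr p"
        using 3 ab[OF i] \<mu>(1,2) by (simp add: powr_mult)
      also have "\<dots> \<le> (s + t) powr p * (\<mu> * (a i / s) powr p + (1 - \<mu>) * (b i / t) powr p)"
        using 3 ab[OF i] \<mu> by (intro mult_left_mono powr_convex_combination p) auto
      finally show ?thesis using 3 ab[OF i] by (simp add: powr_divide)
    qed
    then have "(\<Sum>i\<in>F. (a i + b i) powr p) \<le>
        (\<Sum>i\<in>F. (s + t) powr p * (\<mu> * (a i powr p / s powr p) + (1 - \<mu>) * (b i powr p / t powr p)))"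
      by (rule sum_mono)
    also have "\<dots> = (s + t) powr p * (\<mu> * ((\<Sum>i\<in>F. a i powr p) / s powr p)
        + (1 - \<mu>) * ((\<Sum>i\<in>F. b i powr p) / t powr p))"
      by (simp add: sum.distrib flip: sum_distrib_left sum_divide_distrib)
    also have "\<dots> \<le> (s + t) powr p * (\<mu> * 1 + (1 - \<mu>) * 1)"
      using a b 3 \<mu> by (intro mult_left_mono add_mono) (auto simp: divide_le_eq)
    finally show ?thesis by simp
  qed
qed

text \<open>Here \<open>bd h e\<close> expresses that \<open>h\<close> has norm at most \<open>e\<close>, in a form that does not presuppose that
  \<open>h\<close> is a member of the sum.\<close>

lemma banach_space_on_sumI:
  fixes X :: "('i \<Rightarrow> 'b::real_vector) set" and bd :: "('i \<Rightarrow> 'b) \<Rightarrow> real \<Rightarrow> bool"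
  assumes banach: "\<And>\<alpha>. \<alpha> \<in> A \<Longrightarrow> banach_space_on (V \<alpha>) (N \<alpha>)"
    and X: "normed_space_on X M"
    and mem: "\<forall>f\<in>X. \<forall>\<alpha>\<in>A. f \<alpha> \<in> V \<alpha> \<and> N \<alpha> (f \<alpha>) \<le> M f"
    and limit: "\<forall>r h e. (\<forall>j::nat. r j \<in> X \<and> M (r j) \<le> e) \<longrightarrow>
      (\<forall>\<alpha>\<in>A. h \<alpha> \<in> V \<alpha> \<and> (\<lambda>j. N \<alpha> (r j \<alpha>)) \<longlonglongrightarrow> N \<alpha> (h \<alpha>)) \<longrightarrow> bd h e"
    and approx: "\<forall>g. (\<forall>\<alpha>\<in>A. g \<alpha> \<in> V \<alpha>) \<longrightarrow> (\<forall>\<alpha>. \<alpha> \<notin> A \<longrightarrow> g \<alpha> = 0) \<longrightarrow>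
      (\<forall>e>0. \<exists>f\<in>X. bd (f - g) e) \<longrightarrow> g \<in> X"
    and bd: "\<forall>h\<in>X. \<forall>e>0. bd h e \<longrightarrow> M h \<le> e"
  shows "banach_space_on X M"
proof -
  have n: "normed_space_on (V \<alpha>) (N \<alpha>)" if "\<alpha> \<in> A" for \<alpha>
    using banach[OF that] by (simp add: banach_space_on_def)
  note diff = subspace_diff[OF normed_space_on_subspace]
  have "\<exists>x\<in>X. (\<lambda>n. M (s n - x)) \<longlonglongrightarrow> 0"
    if s: "\<forall>n. s n \<in> X" and cauchy: "\<forall>e>0. \<exists>m. \<forall>i\<ge>m. \<forall>j\<ge>m. M (s i - s j) < e" for s
  proof -
    have "\<exists>x\<in>V \<alpha>. (\<lambda>n. N \<alpha> (s n \<alpha> - x)) \<longlonglongrightarrow> 0" if \<alpha>: "\<alpha> \<in> A" for \<alpha>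
    proof -
      have "\<exists>m. \<forall>i\<ge>m. \<forall>j\<ge>m. N \<alpha> (s i \<alpha> - s j \<alpha>) < e" if e: "0 < e" for e
      proof -
        obtain m where m: "\<forall>i\<ge>m. \<forall>j\<ge>m. M (s i - s j) < e" using cauchy e by blast
        have "N \<alpha> (s i \<alpha> - s j \<alpha>) \<le> M (s i - s j)" for i j
          using bspec[OF bspec[OF mem diff[OF X]] \<alpha>, of "s i" "s j"] s by simp
        then show ?thesis using m by (intro exI[of _ m]) (meson order_le_less_trans)
      qed
      moreover have "\<forall>n. s n \<alpha> \<in> V \<alpha>" using mem s \<alpha> by blast
      ultimately show ?thesis
        using banach[OF \<alpha>] unfolding banach_space_on_def mcomplete_norm_dist_iff[OF n[OF \<alpha>]] by simp
    qed
    then have "\<forall>\<alpha>\<in>A. \<exists>x. x \<in> V \<alpha> \<and> (\<lambda>n. N \<alpha> (s n \<alpha> - x)) \<longlonglongrightarrow> 0" by blast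
    from bchoice[OF this] obtain g0 where
      g0: "\<forall>\<alpha>\<in>A. g0 \<alpha> \<in> V \<alpha> \<and> (\<lambda>n. N \<alpha> (s n \<alpha> - g0 \<alpha>)) \<longlonglongrightarrow> 0" by (rule exE)
    \<comment> \<open>The candidate limit is built coordinatewise; it is made zero off
      \<open>A\<close>, as members of the sums are.\<close>
    define g where "g \<alpha> = (if \<alpha> \<in> A then g0 \<alpha> else 0)" for \<alpha>
    have g: "g \<alpha> \<in> V \<alpha>" "(\<lambda>n. N \<alpha> (s n \<alpha> - g \<alpha>)) \<longlonglongrightarrow> 0" if "\<alpha> \<in> A" for \<alpha>
      using g0 that by (auto simp: g_def)
    have bd_lim: "\<exists>m. \<forall>i\<ge>m. bd (s i - g) e" if e: "0 < e" for e
    proof -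
      obtain m where m: "\<forall>i\<ge>m. \<forall>j\<ge>m. M (s i - s j) < e" using cauchy e by blast
      have "bd (s i - g) e" if i: "m \<le> i" for i
      \<comment> \<open>The index \<open>i\<close> stays fixed while \<open>j\<close> tends to
        infinity. The shift by \<open>m\<close> makes the Cauchy bound hold for all
        \<open>j\<close>.\<close>
      proof (rule limit[rule_format, of "\<lambda>j. s i - s (j + m)"])
        show "s i - s (j + m) \<in> X \<and> M (s i - s (j + m)) \<le> e" for j
          using m i s by (simp add: diff[OF X] less_imp_le)
        fix \<alpha> assume \<alpha>: "\<alpha> \<in> A"
        have V: "s k \<alpha> \<in> V \<alpha>" for k using mem s \<alpha> by blast
        have "\<bar>N \<alpha> (s i \<alpha> - s k \<alpha>) - N \<alpha> (s i \<alpha> - g \<alpha>)\<bar> \<le> N \<alpha> (s k \<alpha> - g \<alpha>)" for k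
        proof -
          note tri = normed_space_on_triangle[OF n[OF \<alpha>]] and d = diff[OF n[OF \<alpha>]]
          have "N \<alpha> (s i \<alpha> - g \<alpha>) \<le> N \<alpha> (s i \<alpha> - s k \<alpha>) + N \<alpha> (s k \<alpha> - g \<alpha>)"
            using tri[OF d[OF V V] d[OF V g(1)[OF \<alpha>]], of i k k] by simp
          moreover have "N \<alpha> (s i \<alpha> - s k \<alpha>) \<le> N \<alpha> (s i \<alpha> - g \<alpha>) + N \<alpha> (g \<alpha> - s k \<alpha>)"
            using tri[OF d[OF V g(1)[OF \<alpha>]] d[OF g(1)[OF \<alpha>] V], of i k] by simp
          ultimately show ?thesis
            using normed_space_on_diff_commute[OF n[OF \<alpha>] V g(1)[OF \<alpha>], of k] by simp
        qed
        then have "(\<lambda>k. N \<alpha> (s i \<alpha> - s k \<alpha>)) \<longlonglongrightarrow> N \<alpha> (s i \<alpha> - g \<alpha>)"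
          by (intro LIM_zero_cancel[OF tendsto_rabs_zero_cancel[OF tendsto_sandwich[OF _ _ tendsto_const g(2)[OF \<alpha>]]]]) auto
        then have "(\<lambda>j. N \<alpha> ((s i - s (j + m)) \<alpha>)) \<longlonglongrightarrow> N \<alpha> ((s i - g) \<alpha>)"
          by (auto dest: LIMSEQ_ignore_initial_segment[where k = m])
        moreover have "(s i - g) \<alpha> \<in> V \<alpha>" using diff[OF n[OF \<alpha>] V g(1)[OF \<alpha>]] by simp
        ultimately show "(s i - g) \<alpha> \<in> V \<alpha> \<and>
            (\<lambda>j. N \<alpha> ((s i - s (j + m)) \<alpha>)) \<longlonglongrightarrow> N \<alpha> ((s i - g) \<alpha>)" by (rule conjI[rotated])
      qed
      then show ?thesis by blast
    qed
    \<comment> \<open>The norm of \<open>s n - g\<close> becomes meaningful only once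
      \<open>g\<close> is known to be in \<open>X\<close>; until then \<open>bd\<close> replaces
      it.\<close>
    have gX: "g \<in> X"
    proof (rule approx[rule_format])
      show "\<exists>f\<in>X. bd (f - g) e" if "0 < e" for e using bd_lim[OF that] s by blast
    qed (use g in \<open>auto simp: g_def\<close>)
    have "(\<lambda>n. M (s n - g)) \<longlonglongrightarrow> 0"
    proof (rule LIMSEQ_I)
      fix e :: real assume e: "0 < e"
      obtain m where m: "\<forall>i\<ge>m. bd (s i - g) (e / 2)" using bd_lim[of "e / 2"] e by auto
      have "norm (M (s i - g) - 0) < e" if "m \<le> i" for i
      proof -
        have d: "s i - g \<in> X" using diff[OF X] s gX by blast
        have "M (s i - g) \<le> e / 2" using m that by (intro bd[rule_format, OF d half_gt_zero[OF e]]) simp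
        then show ?thesis using normed_space_on_nonneg[OF X d] e by simp
      qed
      then show "\<exists>m. \<forall>i\<ge>m. norm (M (s i - g) - 0) < e" by blast
    qed
    then show ?thesis using gX by blast
  qed
  then show ?thesis
    unfolding banach_space_on_def using X by (simp add: mcomplete_norm_dist_iff)
qed

text \<open>The reverse inequality is the assumed one for the factor \<open>1 / c\<close>, applied
  to \<open>c *\<^sub>R x\<close>.\<close>

lemma norm_scale_eqI:
  fixes M :: "'v::real_vector \<Rightarrow> real"
  assumes le: "\<And>c x. x \<in> X \<Longrightarrow> M (c *\<^sub>R x) \<le> \<bar>c\<bar> * M x"
    and scale: "\<And>c x. x \<in> X \<Longrightarrow> c *\<^sub>R x \<in> X" and nonneg: "\<And>x. x \<in> X \<Longrightarrow> 0 \<le> M x" and x: "x \<in> X"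
  shows "M (c *\<^sub>R x) = \<bar>c\<bar> * M x"
proof (cases "c = 0")
  case True
  then show ?thesis using le[OF x, of 0] nonneg[OF scale[OF x, of 0]] by simp
next
  case False
  have "\<bar>c\<bar> * M x = \<bar>c\<bar> * M ((1 / c) *\<^sub>R (c *\<^sub>R x))" using False by simp
  also have "\<dots> \<le> \<bar>c\<bar> * (\<bar>1 / c\<bar> * M (c *\<^sub>R x))" by (intro mult_left_mono le scale x) simp
  also have "\<dots> = M (c *\<^sub>R x)" using False by simp
  finally show ?thesis using le[OF x, of c] by simp
qed

section \<open>The c0-sum: norm, block structure and completeness\<close>

locale normed_family =
  fixes A :: "'i set" and V :: "'i \<Rightarrow> 'b::real_vector set" and N :: "'i \<Rightarrow> 'b \<Rightarrow> real"
  assumes summands: "\<alpha> \<in> A \<Longrightarrow> normed_space_on (V \<alpha>) (N \<alpha>)"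
begin

lemma summand_zero: "\<alpha> \<in> A \<Longrightarrow> 0 \<in> V \<alpha>"
  using subspace_0[OF normed_space_on_subspace[OF summands]] .

lemma summand_norm_zero: "\<alpha> \<in> A \<Longrightarrow> N \<alpha> 0 = 0"
  using normed_space_on_zero[OF summands] .

lemma c0_sum_mem: "f \<in> c0_sum A V N \<Longrightarrow> \<alpha> \<in> A \<Longrightarrow> f \<alpha> \<in> V \<alpha>"
  by (simp add: c0_sum_def)

lemma c0_sum_finite: "f \<in> c0_sum A V N \<Longrightarrow> 0 < e \<Longrightarrow> finite {\<alpha> \<in> A. e \<le> N \<alpha> (f \<alpha>)}"
  by (simp add: c0_sum_def)

lemma c0_sum_nonneg: "f \<in> c0_sum A V N \<Longrightarrow> \<alpha> \<in> A \<Longrightarrow> 0 \<le> N \<alpha> (f \<alpha>)"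
  using normed_space_on_nonneg[OF summands c0_sum_mem] .

text \<open>Only finitely many coordinates have norm at least \<open>1\<close>, so the supremum is
  over a bounded set.\<close>

lemma c0_norm_ge:
  assumes f: "f \<in> c0_sum A V N" and \<alpha>: "\<alpha> \<in> A"
  shows "N \<alpha> (f \<alpha>) \<le> c0_norm A N f"
proof -
  have "finite {\<alpha> \<in> A. 1 \<le> N \<alpha> (f \<alpha>)}" using f by (simp add: c0_sum_def)
  then have "bdd_above ((\<lambda>\<alpha>. N \<alpha> (f \<alpha>)) ` ({\<alpha> \<in> A. 1 \<le> N \<alpha> (f \<alpha>)} \<union> {\<alpha> \<in> A. N \<alpha> (f \<alpha>) < 1}))"
    unfolding image_Un bdd_above_Un by (auto intro!: bdd_aboveI2[of _ _ 1])
  moreover have "{\<alpha> \<in> A. 1 \<le> N \<alpha> (f \<alpha>)} \<union> {\<alpha> \<in> A. N \<alpha> (f \<alpha>) < 1} = A" by auto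
  ultimately have "bdd_above ((\<lambda>\<alpha>. N \<alpha> (f \<alpha>)) ` A)" by simp
  then show ?thesis unfolding c0_norm_def using \<alpha> by (intro cSUP_upper)
qed

lemma c0_norm_le:
  assumes "A \<noteq> {}" "\<And>\<alpha>. \<alpha> \<in> A \<Longrightarrow> N \<alpha> (f \<alpha>) \<le> C"
  shows "c0_norm A N f \<le> C"
  unfolding c0_norm_def using assms by (rule cSUP_least)

lemma c0_sum_mono:
  assumes f: "f \<in> c0_sum A V N" and g: "\<And>\<alpha>. \<alpha> \<in> A \<Longrightarrow> g \<alpha> \<in> V \<alpha>" "\<And>\<alpha>. \<alpha> \<notin> A \<Longrightarrow> g \<alpha> = 0"
    and le: "\<And>\<alpha>. \<alpha> \<in> A \<Longrightarrow> N \<alpha> (g \<alpha>) \<le> N \<alpha> (f \<alpha>)"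
  shows "g \<in> c0_sum A V N"
proof -
  have "finite {\<alpha> \<in> A. e \<le> N \<alpha> (g \<alpha>)}" if "0 < e" for e
  proof (rule finite_subset)
    show "{\<alpha> \<in> A. e \<le> N \<alpha> (g \<alpha>)} \<subseteq> {\<alpha> \<in> A. e \<le> N \<alpha> (f \<alpha>)}" using le by fastforce
    show "finite {\<alpha> \<in> A. e \<le> N \<alpha> (f \<alpha>)}" using f that by (simp add: c0_sum_def)
  qed
  then show ?thesis using g by (simp add: c0_sum_def)
qed

lemma c0_sum_coord:
  assumes "\<alpha> \<in> A" "v \<in> V \<alpha>"
  shows "coord \<alpha> v \<in> c0_sum A V N"
proof -
  have "finite {\<beta> \<in> A. e \<le> N \<beta> (coord \<alpha> v \<beta>)}" if "0 < e" for e
    by (rule finite_subset[of _ "{\<alpha>}"]) (use that summand_norm_zero in \<open>auto simp: coord_def split: if_splits\<close>)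
  then show ?thesis using assms summand_zero by (auto simp: c0_sum_def coord_def)
qed

lemma c0_sum_block:
  assumes f: "f \<in> c0_sum A V N"
  shows "block B f \<in> c0_sum A V N"
proof (rule c0_sum_mono[OF f])
  show "N \<alpha> (block B f \<alpha>) \<le> N \<alpha> (f \<alpha>)" if "\<alpha> \<in> A" for \<alpha>
    using that c0_sum_nonneg[OF f] summand_norm_zero by (simp add: block_def)
qed (use f summand_zero in \<open>auto simp: c0_sum_def block_def\<close>)

lemma normed_space_c0_sum:
  assumes A: "A \<noteq> {}"
  shows "normed_space_on (c0_sum A V N) (c0_norm A N)"
proof -
  let ?X = "c0_sum A V N" and ?M = "c0_norm A N"
  note tri = normed_space_on_triangle[OF summands] and sub = normed_space_on_subspace[OF summands]
  have N_scale: "N \<alpha> ((c *\<^sub>R f) \<alpha>) = \<bar>c\<bar> * N \<alpha> (f \<alpha>)" if "f \<in> ?X" "\<alpha> \<in> A" for c f \<alpha>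
    using normed_space_on_scale[OF summands c0_sum_mem] that by (simp add: scaleR_fun_def)
  have add: "f + g \<in> ?X" if f: "f \<in> ?X" and g: "g \<in> ?X" for f g
  proof -
    have "finite {\<alpha> \<in> A. e \<le> N \<alpha> ((f + g) \<alpha>)}" if e: "0 < e" for e
    proof (rule finite_subset)
      show "{\<alpha> \<in> A. e \<le> N \<alpha> ((f + g) \<alpha>)} \<subseteq> {\<alpha> \<in> A. e / 2 \<le> N \<alpha> (f \<alpha>)} \<union> {\<alpha> \<in> A. e / 2 \<le> N \<alpha> (g \<alpha>)}"
      proof
        fix \<alpha> assume *: "\<alpha> \<in> {\<alpha> \<in> A. e \<le> N \<alpha> ((f + g) \<alpha>)}"
        then have "e \<le> N \<alpha> (f \<alpha>) + N \<alpha> (g \<alpha>)"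
          using tri[of \<alpha> "f \<alpha>" "g \<alpha>"] c0_sum_mem f g by fastforce
        then show "\<alpha> \<in> {\<alpha> \<in> A. e / 2 \<le> N \<alpha> (f \<alpha>)} \<union> {\<alpha> \<in> A. e / 2 \<le> N \<alpha> (g \<alpha>)}" using * by auto
      qed
      show "finite ({\<alpha> \<in> A. e / 2 \<le> N \<alpha> (f \<alpha>)} \<union> {\<alpha> \<in> A. e / 2 \<le> N \<alpha> (g \<alpha>)})"
        using c0_sum_finite[OF f half_gt_zero[OF e]] c0_sum_finite[OF g half_gt_zero[OF e]] by simp
    qed
    then show ?thesis using f g by (auto simp: c0_sum_def subspace_add[OF sub])
  qed
  have scale: "c *\<^sub>R f \<in> ?X" if f: "f \<in> ?X" for c f
  proof -
    have "finite {\<alpha> \<in> A. e \<le> N \<alpha> ((c *\<^sub>R f) \<alpha>)}" if e: "0 < e" for e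
    proof (rule finite_subset)
      \<comment> \<open>The denominator \<open>\<bar>c\<bar> + 1\<close> is positive even for
        \<open>c = 0\<close>.\<close>
      show "{\<alpha> \<in> A. e \<le> N \<alpha> ((c *\<^sub>R f) \<alpha>)} \<subseteq> {\<alpha> \<in> A. e / (\<bar>c\<bar> + 1) \<le> N \<alpha> (f \<alpha>)}"
      proof clarify
        fix \<alpha> assume \<alpha>: "\<alpha> \<in> A" and "e \<le> N \<alpha> ((c *\<^sub>R f) \<alpha>)"
        then have "e \<le> \<bar>c\<bar> * N \<alpha> (f \<alpha>)" by (simp add: N_scale[OF f])
        also have "\<dots> \<le> (\<bar>c\<bar> + 1) * N \<alpha> (f \<alpha>)"
          using c0_sum_nonneg[OF f \<alpha>] by (intro mult_right_mono) auto
        finally show "e / (\<bar>c\<bar> + 1) \<le> N \<alpha> (f \<alpha>)"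
          by (simp add: pos_divide_le_eq mult.commute add_nonneg_pos)
      qed
      show "finite {\<alpha> \<in> A. e / (\<bar>c\<bar> + 1) \<le> N \<alpha> (f \<alpha>)}"
        using f e by (simp add: c0_sum_def add_nonneg_pos)
    qed
    then show ?thesis using f by (auto simp: c0_sum_def scaleR_fun_def subspace_scale[OF sub])
  qed
  have "finite {\<alpha> \<in> A. e \<le> N \<alpha> 0}" if "0 < e" for e
    by (rule finite_subset[of _ "{}"]) (use that summand_norm_zero in fastforce)+
  then have zero: "0 \<in> ?X" using summand_zero by (simp add: c0_sum_def)
  have nonneg: "0 \<le> ?M f" if "f \<in> ?X" for f
  proof -
    obtain \<alpha> where "\<alpha> \<in> A" using A by blast
    then show ?thesis using c0_sum_nonneg[OF that] c0_norm_ge[OF that] order_trans by blast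
  qed
  show ?thesis
    unfolding normed_space_on_def
  proof (intro conjI ballI allI)
    show "subspace ?X" unfolding subspace_def using zero add scale by blast
    show "0 \<le> ?M f" if "f \<in> ?X" for f using that by (rule nonneg)
    show "?M f = 0 \<longleftrightarrow> f = 0" if f: "f \<in> ?X" for f
    proof
      assume "?M f = 0"
      then have "N \<alpha> (f \<alpha>) = 0" if "\<alpha> \<in> A" for \<alpha>
        using c0_norm_ge[OF f that] c0_sum_nonneg[OF f that] by simp
      then have "f \<alpha> = 0" for \<alpha>
        using normed_space_on_eq_0[OF summands c0_sum_mem[OF f]] f by (cases "\<alpha> \<in> A") (auto simp: c0_sum_def)
      then show "f = 0" by (simp add: fun_eq_iff)
    next
      assume "f = 0"
      then have "?M f \<le> 0" using A summand_norm_zero by (intro c0_norm_le) auto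
      then show "?M f = 0" using nonneg[OF f] by simp
    qed
    show "?M (c *\<^sub>R f) = \<bar>c\<bar> * ?M f" if "f \<in> ?X" for c f
    proof (rule norm_scale_eqI[where X = ?X])
      show "?M (c *\<^sub>R f) \<le> \<bar>c\<bar> * ?M f" if "f \<in> ?X" for c f
        using c0_norm_ge[OF that] by (intro c0_norm_le A) (simp add: N_scale[OF that] mult_left_mono)
    qed (use scale nonneg that in auto)
    show "?M (f + g) \<le> ?M f + ?M g" if f: "f \<in> ?X" and g: "g \<in> ?X" for f g
    proof (rule c0_norm_le[OF A])
      fix \<alpha> assume \<alpha>: "\<alpha> \<in> A"
      have "N \<alpha> ((f + g) \<alpha>) \<le> N \<alpha> (f \<alpha>) + N \<alpha> (g \<alpha>)"
        using tri[OF \<alpha> c0_sum_mem[OF f \<alpha>] c0_sum_mem[OF g \<alpha>]] by simp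
      also have "\<dots> \<le> ?M f + ?M g" by (intro add_mono c0_norm_ge f g \<alpha>)
      finally show "N \<alpha> ((f + g) \<alpha>) \<le> ?M f + ?M g" .
    qed
  qed
qed

lemma c0_norm_block_max:
  assumes "A \<noteq> {}" "f \<in> c0_sum A V N"
  shows "c0_norm A N f \<le> max (c0_norm A N (block B f)) (c0_norm A N (block (- B) f))"
proof (rule c0_norm_le[OF assms(1)])
  fix \<alpha> assume \<alpha>: "\<alpha> \<in> A"
  show "N \<alpha> (f \<alpha>) \<le> max (c0_norm A N (block B f)) (c0_norm A N (block (- B) f))"
    using c0_norm_ge[OF c0_sum_block[OF assms(2)] \<alpha>, of B]
      c0_norm_ge[OF c0_sum_block[OF assms(2)] \<alpha>, of "- B"]
    by (cases "\<alpha> \<in> B") (auto simp: block_def)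
qed

lemma separable_sum_c0:
  assumes "\<And>\<alpha>. \<alpha> \<in> A \<Longrightarrow> separable_on (V \<alpha>) (N \<alpha>)" "uncountable {\<alpha> \<in> A. V \<alpha> \<noteq> {0}}"
  shows "separable_sum A V N (c0_sum A V N) (c0_norm A N)"
proof -
  have A: "A \<noteq> {}" using assms(2) by auto
  let ?X = "c0_sum A V N" and ?M = "c0_norm A N"
  show ?thesis
  proof
    show "normed_space_on ?X ?M" by (rule normed_space_c0_sum[OF A])
    show "?M (coord \<alpha> v) = N \<alpha> v" if v: "\<alpha> \<in> A" "v \<in> V \<alpha>" for \<alpha> v
    proof (rule antisym)
      show "?M (coord \<alpha> v) \<le> N \<alpha> v"
        using v summand_norm_zero normed_space_on_nonneg[OF summands v(2)]
        by (intro c0_norm_le A) (auto simp: coord_def)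
      show "N \<alpha> v \<le> ?M (coord \<alpha> v)"
        using c0_norm_ge[OF c0_sum_coord[OF v] v(1)] by (simp add: coord_def)
    qed
    show "?M (block B f) \<le> ?M f" if f: "f \<in> ?X" for B f
    proof (rule c0_norm_le[OF A])
      fix \<alpha> assume \<alpha>: "\<alpha> \<in> A"
      show "N \<alpha> (block B f \<alpha>) \<le> ?M f"
        using c0_norm_ge[OF f \<alpha>] c0_sum_nonneg[OF f \<alpha>] summand_norm_zero[OF \<alpha>]
        by (simp add: block_def)
    qed
    show "\<exists>F. finite F \<and> F \<subseteq> A \<and> ?M (block (- F) f) < e" if f: "f \<in> ?X" and e: "0 < e" for f e
    proof (intro exI[of _ "{\<alpha> \<in> A. e / 2 \<le> N \<alpha> (f \<alpha>)}"] conjI)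
      show "finite {\<alpha> \<in> A. e / 2 \<le> N \<alpha> (f \<alpha>)}" by (rule c0_sum_finite[OF f half_gt_zero[OF e]])
      \<comment> \<open>A supremum of values below \<open>e / 2\<close> is only known to be at most
        \<open>e / 2\<close>, which is still below \<open>e\<close>.\<close>
      have "?M (block (- {\<alpha> \<in> A. e / 2 \<le> N \<alpha> (f \<alpha>)}) f) \<le> e / 2"
        using e summand_norm_zero by (intro c0_norm_le A) (auto simp: block_def)
      then show "?M (block (- {\<alpha> \<in> A. e / 2 \<le> N \<alpha> (f \<alpha>)}) f) < e" using e by simp
    qed auto
  qed (use summands assms c0_sum_mem c0_sum_coord c0_sum_block in auto)
qed

end

text \<open>Smallness in the abstract criterion is here a bound on every coordinate, which survives
  coordinatewise limits.\<close>

lemma banach_c0_sum: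
  fixes A :: "'i set" and V :: "'i \<Rightarrow> 'b::real_vector set"
  assumes banach: "\<And>\<alpha>. \<alpha> \<in> A \<Longrightarrow> banach_space_on (V \<alpha>) (N \<alpha>)" and A: "A \<noteq> {}"
  shows "banach_space_on (c0_sum A V N) (c0_norm A N)"
proof -
  have n: "normed_space_on (V \<alpha>) (N \<alpha>)" if "\<alpha> \<in> A" for \<alpha>
    using banach[OF that] by (simp add: banach_space_on_def)
  interpret normed_family A V N by unfold_locales (rule n)
  have mem: "\<forall>f\<in>c0_sum A V N. \<forall>\<alpha>\<in>A. f \<alpha> \<in> V \<alpha> \<and> N \<alpha> (f \<alpha>) \<le> c0_norm A N f"
    using c0_norm_ge c0_sum_mem by simp
  have limit: "\<forall>r h e. (\<forall>j::nat. r j \<in> c0_sum A V N \<and> c0_norm A N (r j) \<le> e) \<longrightarrow>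
      (\<forall>\<alpha>\<in>A. h \<alpha> \<in> V \<alpha> \<and> (\<lambda>j. N \<alpha> (r j \<alpha>)) \<longlonglongrightarrow> N \<alpha> (h \<alpha>)) \<longrightarrow> (\<forall>\<alpha>\<in>A. N \<alpha> (h \<alpha>) \<le> e)"
  proof (intro allI impI ballI)
    fix r :: "nat \<Rightarrow> 'i \<Rightarrow> 'b" and h e \<alpha>
    assume r: "\<forall>j. r j \<in> c0_sum A V N \<and> c0_norm A N (r j) \<le> e"
      and h: "\<forall>\<alpha>\<in>A. h \<alpha> \<in> V \<alpha> \<and> (\<lambda>j. N \<alpha> (r j \<alpha>)) \<longlonglongrightarrow> N \<alpha> (h \<alpha>)" and \<alpha>: "\<alpha> \<in> A"
    have "N \<alpha> (r j \<alpha>) \<le> e" for j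
      using mem r \<alpha> order_trans by blast
    moreover have "(\<lambda>j. N \<alpha> (r j \<alpha>)) \<longlonglongrightarrow> N \<alpha> (h \<alpha>)" using h \<alpha> by blast
    ultimately show "N \<alpha> (h \<alpha>) \<le> e" by (intro LIMSEQ_le_const2) auto
  qed
  have approx: "\<forall>g. (\<forall>\<alpha>\<in>A. g \<alpha> \<in> V \<alpha>) \<longrightarrow> (\<forall>\<alpha>. \<alpha> \<notin> A \<longrightarrow> g \<alpha> = 0) \<longrightarrow>
      (\<forall>e>0. \<exists>f\<in>c0_sum A V N. \<forall>\<alpha>\<in>A. N \<alpha> ((f - g) \<alpha>) \<le> e) \<longrightarrow> g \<in> c0_sum A V N"
  proof (intro allI impI)
    fix g assume g: "\<forall>\<alpha>\<in>A. g \<alpha> \<in> V \<alpha>" "\<forall>\<alpha>. \<alpha> \<notin> A \<longrightarrow> g \<alpha> = 0"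
      and approx: "\<forall>e>0. \<exists>f\<in>c0_sum A V N. \<forall>\<alpha>\<in>A. N \<alpha> ((f - g) \<alpha>) \<le> e"
    have "finite {\<alpha> \<in> A. e \<le> N \<alpha> (g \<alpha>)}" if e: "0 < e" for e
    proof -
      obtain f where f: "f \<in> c0_sum A V N" "\<forall>\<alpha>\<in>A. N \<alpha> ((f - g) \<alpha>) \<le> e / 2"
        using approx[rule_format, OF half_gt_zero[OF e]] by (rule bexE)
      \<comment> \<open>Where \<open>g\<close> has norm at least \<open>e\<close>, the approximant
        \<open>f\<close> has norm at least \<open>e / 2\<close>, and this happens finitely
        often.\<close>
      have "{\<alpha> \<in> A. e \<le> N \<alpha> (g \<alpha>)} \<subseteq> {\<alpha> \<in> A. e / 2 \<le> N \<alpha> (f \<alpha>)}"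
      proof clarify
        fix \<alpha> assume \<alpha>: "\<alpha> \<in> A" and e_le: "e \<le> N \<alpha> (g \<alpha>)"
        have fV: "f \<alpha> \<in> V \<alpha>" and gV: "g \<alpha> \<in> V \<alpha>" using mem f(1) g(1) \<alpha> by auto
        have "N \<alpha> (f \<alpha> + (g \<alpha> - f \<alpha>)) \<le> N \<alpha> (f \<alpha>) + N \<alpha> (g \<alpha> - f \<alpha>)"
          by (intro normed_space_on_triangle[OF n[OF \<alpha>]] fV gV
              subspace_diff[OF normed_space_on_subspace[OF n[OF \<alpha>]]])
        moreover have "N \<alpha> (g \<alpha> - f \<alpha>) \<le> e / 2"
          using bspec[OF f(2) \<alpha>] normed_space_on_diff_commute[OF n[OF \<alpha>] fV gV] by simp
        ultimately show "e / 2 \<le> N \<alpha> (f \<alpha>)" using e_le by simp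
      qed
      moreover have "finite {\<alpha> \<in> A. e / 2 \<le> N \<alpha> (f \<alpha>)}"
        using f(1) half_gt_zero[OF e] by (rule c0_sum_finite)
      ultimately show ?thesis by (rule finite_subset)
    qed
    then show "g \<in> c0_sum A V N" using g by (simp add: c0_sum_def)
  qed
  have bd: "\<forall>h\<in>c0_sum A V N. \<forall>e>0. (\<forall>\<alpha>\<in>A. N \<alpha> (h \<alpha>) \<le> e) \<longrightarrow> c0_norm A N h \<le> e"
    using c0_norm_le[OF A] by simp
  show ?thesis
    by (rule banach_space_on_sumI[where bd = "\<lambda>h e. \<forall>\<alpha>\<in>A. N \<alpha> (h \<alpha>) \<le> e",
          OF banach normed_space_c0_sum[OF A] mem limit approx bd])
qed

section \<open>The lp-sums: norm, block structure and completeness\<close>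

locale normed_family_lp = normed_family A V N
  for A :: "'i set" and V :: "'i \<Rightarrow> 'b::real_vector set" and N :: "'i \<Rightarrow> 'b \<Rightarrow> real" +
  fixes p :: real
  assumes p: "1 \<le> p"
begin

lemma lp_sum_mem: "f \<in> lp_sum p A V N \<Longrightarrow> \<alpha> \<in> A \<Longrightarrow> f \<alpha> \<in> V \<alpha>"
  by (simp add: lp_sum_def)

lemma lp_sum_nonneg: "f \<in> lp_sum p A V N \<Longrightarrow> \<alpha> \<in> A \<Longrightarrow> 0 \<le> N \<alpha> (f \<alpha>)"
  using normed_space_on_nonneg[OF summands lp_sum_mem] .

lemma lp_norm_nonneg: "0 \<le> lp_norm p A N f"
  by (simp add: lp_norm_def)

lemma lp_norm_powr: "lp_norm p A N f powr p = (\<Sum>\<^sub>\<infinity>\<alpha>\<in>A. N \<alpha> (f \<alpha>) powr p)"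
  using p infsum_nonneg[of A "\<lambda>\<alpha>. N \<alpha> (f \<alpha>) powr p"] by (simp add: lp_norm_def powr_powr)

lemma lp_sum_finite_le:
  assumes "f \<in> lp_sum p A V N" "finite F" "F \<subseteq> A"
  shows "(\<Sum>\<alpha>\<in>F. N \<alpha> (f \<alpha>) powr p) \<le> lp_norm p A N f powr p"
  unfolding lp_norm_powr using assms by (intro finite_sum_le_infsum) (auto simp: lp_sum_def)

lemma powr_le_cancel:
  assumes "a powr p \<le> b powr p" "0 \<le> b"
  shows "a \<le> b"
proof (rule ccontr)
  assume "\<not> a \<le> b"
  then have "b powr p < a powr p" using assms(2) p by (intro powr_less_mono2) auto
  then show False using assms(1) by simp
qed

lemma lp_norm_ge: "f \<in> lp_sum p A V N \<Longrightarrow> \<alpha> \<in> A \<Longrightarrow> N \<alpha> (f \<alpha>) \<le> lp_norm p A N f"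
  using lp_sum_finite_le[of f "{\<alpha>}"] by (intro powr_le_cancel[OF _ lp_norm_nonneg]) simp

text \<open>Membership is checked on finite subsums: a nonnegative family with bounded finite
  subsums is summable.\<close>

lemma lp_sumI:
  assumes "\<And>\<alpha>. \<alpha> \<in> A \<Longrightarrow> f \<alpha> \<in> V \<alpha>" "\<And>\<alpha>. \<alpha> \<notin> A \<Longrightarrow> f \<alpha> = 0"
    and C: "\<And>F. finite F \<Longrightarrow> F \<subseteq> A \<Longrightarrow> (\<Sum>\<alpha>\<in>F. N \<alpha> (f \<alpha>) powr p) \<le> C"
  shows "f \<in> lp_sum p A V N"
proof -
  have "(\<lambda>\<alpha>. N \<alpha> (f \<alpha>) powr p) summable_on A"
    using C by (intro nonneg_bdd_above_summable_on) (auto intro!: bdd_aboveI2)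
  then show ?thesis using assms by (simp add: lp_sum_def)
qed

lemma lp_norm_le:
  assumes f: "f \<in> lp_sum p A V N" and "0 \<le> C"
    and C: "\<And>F. finite F \<Longrightarrow> F \<subseteq> A \<Longrightarrow> (\<Sum>\<alpha>\<in>F. N \<alpha> (f \<alpha>) powr p) \<le> C powr p"
  shows "lp_norm p A N f \<le> C"
proof (rule powr_le_cancel[OF _ \<open>0 \<le> C\<close>])
  show "lp_norm p A N f powr p \<le> C powr p"
    unfolding lp_norm_powr using f C by (intro infsum_le_finite_sums) (auto simp: lp_sum_def)
qed

lemma lp_sum_mono:
  assumes f: "f \<in> lp_sum p A V N" and g: "\<And>\<alpha>. \<alpha> \<in> A \<Longrightarrow> g \<alpha> \<in> V \<alpha>" "\<And>\<alpha>. \<alpha> \<notin> A \<Longrightarrow> g \<alpha> = 0"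
    and le: "\<And>\<alpha>. \<alpha> \<in> A \<Longrightarrow> N \<alpha> (g \<alpha>) \<le> N \<alpha> (f \<alpha>)"
  shows "g \<in> lp_sum p A V N" "lp_norm p A N g \<le> lp_norm p A N f"
proof -
  have le: "(\<Sum>\<alpha>\<in>F. N \<alpha> (g \<alpha>) powr p) \<le> lp_norm p A N f powr p" if F: "finite F" "F \<subseteq> A" for F
  proof -
    have "(\<Sum>\<alpha>\<in>F. N \<alpha> (g \<alpha>) powr p) \<le> (\<Sum>\<alpha>\<in>F. N \<alpha> (f \<alpha>) powr p)"
      using p le normed_space_on_nonneg[OF summands g(1)] F(2) by (intro sum_mono powr_mono2) auto
    then show ?thesis using lp_sum_finite_le[OF f F] by simp
  qed
  then show g_in: "g \<in> lp_sum p A V N" using g by (intro lp_sumI)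
  show "lp_norm p A N g \<le> lp_norm p A N f"
    using le by (intro lp_norm_le g_in lp_norm_nonneg)
qed

lemma lp_sum_block:
  assumes f: "f \<in> lp_sum p A V N"
  shows "block B f \<in> lp_sum p A V N" "lp_norm p A N (block B f) \<le> lp_norm p A N f"
proof -
  have "N \<alpha> (block B f \<alpha>) \<le> N \<alpha> (f \<alpha>)" if "\<alpha> \<in> A" for \<alpha>
    using that lp_sum_nonneg[OF f] summand_norm_zero by (simp add: block_def)
  moreover have "block B f \<alpha> \<in> V \<alpha>" if "\<alpha> \<in> A" for \<alpha>
    using that lp_sum_mem[OF f] summand_zero by (simp add: block_def)
  moreover have "block B f \<alpha> = 0" if "\<alpha> \<notin> A" for \<alpha>
    using that f by (simp add: block_def lp_sum_def)
  ultimately show "block B f \<in> lp_sum p A V N" "lp_norm p A N (block B f) \<le> lp_norm p A N f"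
    using lp_sum_mono[OF f, of "block B f"] by auto
qed

lemma lp_norm_block_powr:
  assumes f: "f \<in> lp_sum p A V N"
  shows "lp_norm p A N f powr p = lp_norm p A N (block B f) powr p + lp_norm p A N (block (- B) f) powr p"
proof -
  have "lp_norm p A N f powr p =
      (\<Sum>\<^sub>\<infinity>\<alpha>\<in>A. N \<alpha> (block B f \<alpha>) powr p + N \<alpha> (block (- B) f \<alpha>) powr p)"
    unfolding lp_norm_powr using p summand_norm_zero
    by (intro infsum_cong) (simp add: block_def)
  also have "\<dots> = lp_norm p A N (block B f) powr p + lp_norm p A N (block (- B) f) powr p"
    unfolding lp_norm_powr using lp_sum_block(1)[OF f] by (intro infsum_add) (simp_all add: lp_sum_def)
  finally show ?thesis .
qed

lemma lp_sum_coord: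
  assumes v: "\<alpha> \<in> A" "v \<in> V \<alpha>"
  shows "coord \<alpha> v \<in> lp_sum p A V N" "lp_norm p A N (coord \<alpha> v) = N \<alpha> v"
proof -
  have Nv: "0 \<le> N \<alpha> v" by (rule normed_space_on_nonneg[OF summands[OF v(1)] v(2)])
  have le: "(\<Sum>\<beta>\<in>F. N \<beta> (coord \<alpha> v \<beta>) powr p) \<le> N \<alpha> v powr p" if F: "finite F" "F \<subseteq> A" for F
  proof -
    have "(\<Sum>\<beta>\<in>F. N \<beta> (coord \<alpha> v \<beta>) powr p) = (\<Sum>\<beta>\<in>F. if \<beta> = \<alpha> then N \<alpha> v powr p else 0)"
      using p F summand_norm_zero by (intro sum.cong) (auto simp: coord_def)
    then show ?thesis using F by simp
  qed
  show in_sum: "coord \<alpha> v \<in> lp_sum p A V N"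
    using v summand_zero le by (intro lp_sumI) (auto simp: coord_def)
  show "lp_norm p A N (coord \<alpha> v) = N \<alpha> v"
    using lp_norm_le[OF in_sum Nv le] lp_norm_ge[OF in_sum v(1)] by (simp add: coord_def)
qed

lemma normed_space_lp_sum: "normed_space_on (lp_sum p A V N) (lp_norm p A N)"
proof -
  let ?X = "lp_sum p A V N" and ?M = "lp_norm p A N"
  note sub = normed_space_on_subspace[OF summands]
  have add_le: "(\<Sum>\<alpha>\<in>F. N \<alpha> ((f + g) \<alpha>) powr p) \<le> (?M f + ?M g) powr p"
    if f: "f \<in> ?X" and g: "g \<in> ?X" and F: "finite F" "F \<subseteq> A" for f g F
  proof -
    have "(\<Sum>\<alpha>\<in>F. N \<alpha> ((f + g) \<alpha>) powr p) \<le> (\<Sum>\<alpha>\<in>F. (N \<alpha> (f \<alpha>) + N \<alpha> (g \<alpha>)) powr p)"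
    proof (rule sum_mono)
      fix \<alpha> assume "\<alpha> \<in> F"
      then have \<alpha>: "\<alpha> \<in> A" using F by blast
      note fg = lp_sum_mem[OF f \<alpha>] lp_sum_mem[OF g \<alpha>]
      show "N \<alpha> ((f + g) \<alpha>) powr p \<le> (N \<alpha> (f \<alpha>) + N \<alpha> (g \<alpha>)) powr p"
        using p normed_space_on_triangle[OF summands[OF \<alpha>] fg]
          normed_space_on_nonneg[OF summands[OF \<alpha>] subspace_add[OF sub[OF \<alpha>] fg]]
        by (intro powr_mono2) auto
    qed
    also have "\<dots> \<le> (?M f + ?M g) powr p"
      using F lp_sum_nonneg[OF f] lp_sum_nonneg[OF g]
      by (intro minkowski_sum_powr p lp_norm_nonneg lp_sum_finite_le f g) auto
    finally show ?thesis .
  qed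
  have add: "f + g \<in> ?X" if f: "f \<in> ?X" and g: "g \<in> ?X" for f g
    using add_le[OF f g] by (rule lp_sumI[rotated 2])
      (use f g in \<open>auto simp: lp_sum_def subspace_add[OF sub]\<close>)
  have scale_le: "(\<Sum>\<alpha>\<in>F. N \<alpha> ((c *\<^sub>R f) \<alpha>) powr p) \<le> (\<bar>c\<bar> * ?M f) powr p"
    if f: "f \<in> ?X" and F: "finite F" "F \<subseteq> A" for f c F
  proof -
    have "(\<Sum>\<alpha>\<in>F. N \<alpha> ((c *\<^sub>R f) \<alpha>) powr p) = (\<Sum>\<alpha>\<in>F. \<bar>c\<bar> powr p * N \<alpha> (f \<alpha>) powr p)"
    proof (rule sum.cong)
      fix \<alpha> assume "\<alpha> \<in> F"
      then have \<alpha>: "\<alpha> \<in> A" using F by blast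
      show "N \<alpha> ((c *\<^sub>R f) \<alpha>) powr p = \<bar>c\<bar> powr p * N \<alpha> (f \<alpha>) powr p"
        using normed_space_on_scale[OF summands[OF \<alpha>] lp_sum_mem[OF f \<alpha>]] lp_sum_nonneg[OF f \<alpha>]
        by (simp add: scaleR_fun_def powr_mult)
    qed simp
    also have "\<dots> = \<bar>c\<bar> powr p * (\<Sum>\<alpha>\<in>F. N \<alpha> (f \<alpha>) powr p)" by (simp add: sum_distrib_left)
    also have "\<dots> \<le> \<bar>c\<bar> powr p * ?M f powr p"
      using lp_sum_finite_le[OF f F] by (rule mult_left_mono) simp
    finally show ?thesis by (simp add: powr_mult lp_norm_nonneg)
  qed
  have scale: "c *\<^sub>R f \<in> ?X" if f: "f \<in> ?X" for c f
    using scale_le[OF f] by (rule lp_sumI[rotated 2])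
      (use f in \<open>auto simp: lp_sum_def scaleR_fun_def subspace_scale[OF sub]\<close>)
  have zero: "0 \<in> ?X"
    by (rule lp_sumI[of _ 0]) (use p summand_zero summand_norm_zero in
      \<open>auto intro!: sum_nonpos\<close>)
  show ?thesis
    unfolding normed_space_on_def
  proof (intro conjI ballI allI)
    show "subspace ?X" unfolding subspace_def using zero add scale by blast
    show "0 \<le> ?M f" for f by (rule lp_norm_nonneg)
    show "?M f = 0 \<longleftrightarrow> f = 0" if f: "f \<in> ?X" for f
    proof
      assume "?M f = 0"
      then have "N \<alpha> (f \<alpha>) = 0" if "\<alpha> \<in> A" for \<alpha>
        using lp_norm_ge[OF f that] lp_sum_nonneg[OF f that] by simp
      then have "f \<alpha> = 0" for \<alpha>
        using normed_space_on_eq_0[OF summands lp_sum_mem[OF f]] f by (cases "\<alpha> \<in> A") (auto simp: lp_sum_def)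
      then show "f = 0" by (simp add: fun_eq_iff)
    next
      assume "f = 0"
      then have "?M f \<le> 0"
        using p summand_norm_zero by (intro lp_norm_le[OF f]) (auto intro!: sum_nonpos)
      then show "?M f = 0" using lp_norm_nonneg[of f] by simp
    qed
    show "?M (c *\<^sub>R f) = \<bar>c\<bar> * ?M f" if f: "f \<in> ?X" for c f
    proof (rule norm_scale_eqI[of ?X ?M, OF _ scale lp_norm_nonneg f])
      show "?M (c *\<^sub>R f) \<le> \<bar>c\<bar> * ?M f" if f: "f \<in> ?X" for c f
        using scale_le[OF f] lp_norm_nonneg by (intro lp_norm_le scale f) simp_all
    qed
    show "?M (f + g) \<le> ?M f + ?M g" if f: "f \<in> ?X" and g: "g \<in> ?X" for f g
      using add_le[OF f g] lp_norm_nonneg by (intro lp_norm_le add f g) simp_all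
  qed
qed

text \<open>Finite subsums approach the infinite sum, and what a finite set \<open>F\<close> leaves
  over bounds every finite subsum off \<open>F\<close>.\<close>

lemma lp_sum_finite_approx:
  assumes f: "f \<in> lp_sum p A V N" and e: "0 < e"
  shows "\<exists>F. finite F \<and> F \<subseteq> A \<and> lp_norm p A N (block (- F) f) < e"
proof -
  let ?u = "\<lambda>\<alpha>. N \<alpha> (f \<alpha>) powr p"
  \<comment> \<open>Chosen so that a remainder below \<open>d\<close> means a norm of at most
    \<open>e / 2\<close>.\<close>
  define d where "d = (e / 2) powr p"
  have d: "0 < d" using e by (simp add: d_def)
  have u: "?u summable_on A" using f by (simp add: lp_sum_def)
  have "\<exists>F. finite F \<and> F \<subseteq> A \<and> infsum ?u A - d < sum ?u F"
  proof (rule ccontr)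
    assume "\<not> ?thesis"
    then have "infsum ?u A \<le> infsum ?u A - d"
      by (intro infsum_le_finite_sums[OF u]) (meson linorder_not_le)
    then show False using d by simp
  qed
  then obtain F where F: "finite F" "F \<subseteq> A" "infsum ?u A - d < sum ?u F" by blast
  have "lp_norm p A N (block (- F) f) \<le> e / 2"
  proof (rule lp_norm_le[OF lp_sum_block(1)[OF f]])
    fix G assume G: "finite G" "G \<subseteq> A"
    have "(\<Sum>\<alpha>\<in>G. N \<alpha> (block (- F) f \<alpha>) powr p) = sum ?u (G - F)"
      using G p summand_norm_zero
      by (intro sum.mono_neutral_cong_right) (auto simp: block_def)
    also have "\<dots> = sum ?u (G \<union> F) - sum ?u F"
      using G F sum.subset_diff[of F "G \<union> F" ?u] by (simp add: Un_Diff)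
    also have "sum ?u (G \<union> F) \<le> infsum ?u A"
      using G F by (intro finite_sum_le_infsum[OF u]) auto
    finally show "(\<Sum>\<alpha>\<in>G. N \<alpha> (block (- F) f \<alpha>) powr p) \<le> (e / 2) powr p"
      using F(3) by (simp add: d_def)
  qed (use e in simp)
  then show ?thesis using F(1,2) e by (intro exI[of _ F]) simp
qed

lemma separable_sum_lp:
  assumes "\<And>\<alpha>. \<alpha> \<in> A \<Longrightarrow> separable_on (V \<alpha>) (N \<alpha>)" "uncountable {\<alpha> \<in> A. V \<alpha> \<noteq> {0}}"
  shows "separable_sum A V N (lp_sum p A V N) (lp_norm p A N)"
  by unfold_locales
    (use summands assms normed_space_lp_sum lp_sum_mem lp_sum_coord lp_sum_block lp_sum_finite_approx in auto)

lemma banach_lp_sum: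
  assumes banach: "\<And>\<alpha>. \<alpha> \<in> A \<Longrightarrow> banach_space_on (V \<alpha>) (N \<alpha>)"
  shows "banach_space_on (lp_sum p A V N) (lp_norm p A N)"
proof -
  let ?X = "lp_sum p A V N" and ?M = "lp_norm p A N"
  \<comment> \<open>Membership of the coordinates is included so that the bound for
    \<open>f - g\<close> also shows its coordinates to lie in the summands.\<close>
  let ?bd = "\<lambda>h e. (\<forall>\<alpha>\<in>A. h \<alpha> \<in> V \<alpha>) \<and>
    (\<forall>F. finite F \<and> F \<subseteq> A \<longrightarrow> (\<Sum>\<alpha>\<in>F. N \<alpha> (h \<alpha>) powr p) \<le> e powr p)"
  have mem: "\<forall>f\<in>?X. \<forall>\<alpha>\<in>A. f \<alpha> \<in> V \<alpha> \<and> N \<alpha> (f \<alpha>) \<le> ?M f"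
    using lp_norm_ge lp_sum_mem by simp
  have limit: "\<forall>r h e. (\<forall>j::nat. r j \<in> ?X \<and> ?M (r j) \<le> e) \<longrightarrow>
      (\<forall>\<alpha>\<in>A. h \<alpha> \<in> V \<alpha> \<and> (\<lambda>j. N \<alpha> (r j \<alpha>)) \<longlonglongrightarrow> N \<alpha> (h \<alpha>)) \<longrightarrow> ?bd h e"
  proof (intro allI impI conjI)
    fix r :: "nat \<Rightarrow> 'i \<Rightarrow> 'b" and h e F
    assume r: "\<forall>j. r j \<in> ?X \<and> ?M (r j) \<le> e"
      and h: "\<forall>\<alpha>\<in>A. h \<alpha> \<in> V \<alpha> \<and> (\<lambda>j. N \<alpha> (r j \<alpha>)) \<longlonglongrightarrow> N \<alpha> (h \<alpha>)" and F: "finite F \<and> F \<subseteq> A"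
    have lim: "(\<lambda>j. \<Sum>\<alpha>\<in>F. N \<alpha> (r j \<alpha>) powr p) \<longlonglongrightarrow> (\<Sum>\<alpha>\<in>F. N \<alpha> (h \<alpha>) powr p)"
    proof (rule tendsto_sum)
      fix \<alpha> assume "\<alpha> \<in> F"
      then have \<alpha>: "\<alpha> \<in> A" using F by blast
      show "(\<lambda>j. N \<alpha> (r j \<alpha>) powr p) \<longlonglongrightarrow> N \<alpha> (h \<alpha>) powr p"
        using p h \<alpha> r lp_sum_nonneg[OF _ \<alpha>] by (intro tendsto_powr' tendsto_const) auto
    qed
    have "(\<Sum>\<alpha>\<in>F. N \<alpha> (r j \<alpha>) powr p) \<le> e powr p" for j
    proof -
      have "(\<Sum>\<alpha>\<in>F. N \<alpha> (r j \<alpha>) powr p) \<le> ?M (r j) powr p"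
        using r F by (intro lp_sum_finite_le) auto
      also have "\<dots> \<le> e powr p" using r p lp_norm_nonneg by (intro powr_mono2) auto
      finally show ?thesis .
    qed
    then show "(\<Sum>\<alpha>\<in>F. N \<alpha> (h \<alpha>) powr p) \<le> e powr p"
      by (intro LIMSEQ_le_const2[OF lim]) auto
  qed auto
  have approx: "\<forall>g. (\<forall>\<alpha>\<in>A. g \<alpha> \<in> V \<alpha>) \<longrightarrow> (\<forall>\<alpha>. \<alpha> \<notin> A \<longrightarrow> g \<alpha> = 0) \<longrightarrow>
      (\<forall>e>0. \<exists>f\<in>?X. ?bd (f - g) e) \<longrightarrow> g \<in> ?X"
  proof (intro allI impI)
    fix g assume g: "\<forall>\<alpha>\<in>A. g \<alpha> \<in> V \<alpha>" "\<forall>\<alpha>. \<alpha> \<notin> A \<longrightarrow> g \<alpha> = 0"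
      and approx: "\<forall>e>0. \<exists>f\<in>?X. ?bd (f - g) e"
    \<comment> \<open>A single \<open>f\<close> at distance \<open>1\<close> is enough:
      \<open>f - g\<close> is in the sum, and so is \<open>g = f - (f - g)\<close>.\<close>
    obtain f where f: "f \<in> ?X" "?bd (f - g) 1" using approx zero_less_one by blast
    have "f - g \<in> ?X"
    proof (rule lp_sumI)
      show "(f - g) \<alpha> \<in> V \<alpha>" if "\<alpha> \<in> A" for \<alpha> using f(2) that by blast
      show "(f - g) \<alpha> = 0" if "\<alpha> \<notin> A" for \<alpha> using f(1) g(2) that by (simp add: lp_sum_def)
      show "(\<Sum>\<alpha>\<in>F. N \<alpha> ((f - g) \<alpha>) powr p) \<le> 1 powr p" if "finite F" "F \<subseteq> A" for F
        using f(2) that by blast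
    qed
    then have "f - (f - g) \<in> ?X"
      using f(1) subspace_diff[OF normed_space_on_subspace[OF normed_space_lp_sum]] by blast
    then show "g \<in> ?X" by simp
  qed
  have bd: "\<forall>h\<in>?X. \<forall>e>0. ?bd h e \<longrightarrow> ?M h \<le> e"
    by (intro ballI allI impI lp_norm_le) auto
  show ?thesis
    by (rule banach_space_on_sumI[where bd = ?bd, OF banach normed_space_lp_sum mem limit approx bd])
qed

end

section \<open>The assertions for the c0-sum, the lp-sums and the l1-sum\<close>

theorem class_E0_c0_sum:
  fixes A :: "'i set" and V :: "'i \<Rightarrow> 'b::real_vector set"
  assumes banach: "\<And>\<alpha>. \<alpha> \<in> A \<Longrightarrow> banach_space_on (V \<alpha>) (N \<alpha>)"
    and sep: "\<And>\<alpha>. \<alpha> \<in> A \<Longrightarrow> separable_on (V \<alpha>) (N \<alpha>)"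
    and unc: "uncountable {\<alpha> \<in> A. V \<alpha> \<noteq> {0}}"
  shows "class_E0 (c0_sum A V N) (c0_norm A N)"
proof -
  have n: "normed_space_on (V \<alpha>) (N \<alpha>)" if "\<alpha> \<in> A" for \<alpha>
    using banach[OF that] by (simp add: banach_space_on_def)
  have A: "A \<noteq> {}" using unc by auto
  interpret normed_family A V N by unfold_locales (rule n)
  interpret separable_sum A V N "c0_sum A V N" "c0_norm A N"
    by (rule separable_sum_c0[OF sep unc])
  interpret additive_dual_sum A V N "c0_sum A V N" "c0_norm A N" 1
  proof
    fix \<phi> B assume \<phi>: "\<phi> \<in> dual_space (c0_sum A V N) (c0_norm A N)"
    note nonneg = dual_norm_nonneg[OF normed]
    have "nrm \<phi> = nrm (restr B \<phi>) + nrm (restr (- B) \<phi>)"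
      by (rule dual_norm_additive_max[OF c0_norm_block_max[OF A] \<phi>])
    then show "nrm \<phi> powr 1 = nrm (restr B \<phi>) powr 1 + nrm (restr (- B) \<phi>) powr 1"
      using nonneg[OF \<phi>] nonneg[OF restr_in[OF \<phi>]] by simp
  qed (use banach_c0_sum[OF banach A] in simp_all)
  show ?thesis by (rule class_E0_sum)
qed

theorem class_E0_lp_sum:
  fixes A :: "'i set" and V :: "'i \<Rightarrow> 'b::real_vector set"
  assumes gt: "1 < p" and banach: "\<And>\<alpha>. \<alpha> \<in> A \<Longrightarrow> banach_space_on (V \<alpha>) (N \<alpha>)"
    and sep: "\<And>\<alpha>. \<alpha> \<in> A \<Longrightarrow> separable_on (V \<alpha>) (N \<alpha>)"
    and unc: "uncountable {\<alpha> \<in> A. V \<alpha> \<noteq> {0}}"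
  shows "class_E0 (lp_sum p A V N) (lp_norm p A N)"
proof -
  have n: "normed_space_on (V \<alpha>) (N \<alpha>)" if "\<alpha> \<in> A" for \<alpha>
    using banach[OF that] by (simp add: banach_space_on_def)
  have p1: "1 \<le> p" using gt by simp
  define q where "q = p / (p - 1)"
  have q: "1 \<le> q" "1 / p + 1 / q = 1"
    using gt by (simp_all add: q_def field_simps)
  interpret normed_family_lp A V N p by unfold_locales (rule n, assumption, rule p1)
  interpret separable_sum A V N "lp_sum p A V N" "lp_norm p A N"
    by (rule separable_sum_lp[OF sep unc])
  interpret additive_dual_sum A V N "lp_sum p A V N" "lp_norm p A N" q
  proof
    show "nrm \<phi> powr q = nrm (restr B \<phi>) powr q + nrm (restr (- B) \<phi>) powr q"
      if "\<phi> \<in> dual_space (lp_sum p A V N) (lp_norm p A N)" for \<phi> B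
      by (rule dual_norm_additive_powr[OF gt q(2) lp_norm_block_powr that])
  qed (use q(1) banach_lp_sum[OF banach] in simp_all)
  show ?thesis by (rule class_E0_sum)
qed

text \<open>For \<open>p = 1\<close> the block formula for the \<open>p\<close>-th powers is
  additivity of the norm itself, which is the hypothesis of
  \<open>fiber_convergent_sum_norm\<close>.\<close>

theorem fiber_convergent_l1_sum:
  fixes A :: "'i set" and V :: "'i \<Rightarrow> 'b::real_vector set"
  assumes n: "\<And>\<alpha>. \<alpha> \<in> A \<Longrightarrow> normed_space_on (V \<alpha>) (N \<alpha>)"
    and sep: "\<And>\<alpha>. \<alpha> \<in> A \<Longrightarrow> separable_on (V \<alpha>) (N \<alpha>)"
    and unc: "uncountable {\<alpha> \<in> A. V \<alpha> \<noteq> {0}}"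
    and x: "\<And>n. x n \<in> dual_ball (lp_sum 1 A V N) (lp_norm 1 A N)"
      "limitin (weak_star_ball (lp_sum 1 A V N) (lp_norm 1 A N)) x l sequentially"
  shows "fiber_convergent (weak_star_ball (lp_sum 1 A V N) (lp_norm 1 A N)) x l"
proof -
  interpret normed_family_lp A V N 1 by unfold_locales (rule n, assumption, rule order_refl)
  interpret separable_sum A V N "lp_sum 1 A V N" "lp_norm 1 A N"
    by (rule separable_sum_lp[OF sep unc])
  show ?thesis
  proof (rule fiber_convergent_sum_norm[OF _ x])
    fix f B assume f: "f \<in> lp_sum 1 A V N"
    then show "lp_norm 1 A N (block B f) + lp_norm 1 A N (block (- B) f) \<le> lp_norm 1 A N f"
      using lp_norm_block_powr[OF f, of B] lp_norm_nonneg by simp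
  qed
qed

theorem theorem16:
  fixes A :: "'i set"
    and V :: "'i \<Rightarrow> 'b::real_vector set"
    and N :: "'i \<Rightarrow> 'b \<Rightarrow> real"
  assumes "\<And>\<alpha>. \<alpha> \<in> A \<Longrightarrow> banach_space_on (V \<alpha>) (N \<alpha>)"
    and "\<And>\<alpha>. \<alpha> \<in> A \<Longrightarrow> separable_on (V \<alpha>) (N \<alpha>)"
    and "uncountable {\<alpha> \<in> A. V \<alpha> \<noteq> {0}}"
  shows "class_E0 (c0_sum A V N) (c0_norm A N) \<and>
    (\<forall>p::real. 1 < p \<longrightarrow> class_E0 (lp_sum p A V N) (lp_norm p A N)) \<and>
    (\<forall>x l. (\<forall>n. x n \<in> dual_ball (lp_sum 1 A V N) (lp_norm 1 A N)) \<and>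
       limitin (weak_star_ball (lp_sum 1 A V N) (lp_norm 1 A N)) x l sequentially \<longrightarrow>
       fiber_convergent (weak_star_ball (lp_sum 1 A V N) (lp_norm 1 A N)) x l)"
proof (intro conjI allI impI)
  show "class_E0 (c0_sum A V N) (c0_norm A N)"
    by (rule class_E0_c0_sum[OF assms])
  show "class_E0 (lp_sum p A V N) (lp_norm p A N)" if "1 < p" for p
    by (rule class_E0_lp_sum[OF that assms])
  fix x l
  assume *: "(\<forall>n. x n \<in> dual_ball (lp_sum 1 A V N) (lp_norm 1 A N)) \<and>
    limitin (weak_star_ball (lp_sum 1 A V N) (lp_norm 1 A N)) x l sequentially"
  have "normed_space_on (V \<alpha>) (N \<alpha>)" if "\<alpha> \<in> A" for \<alpha>
    using assms(1)[OF that] by (simp add: banach_space_on_def)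
  then show "fiber_convergent (weak_star_ball (lp_sum 1 A V N) (lp_norm 1 A N)) x l"
    using * by (intro fiber_convergent_l1_sum assms(2,3)) auto
qed

end
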